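(* Let $\mathcal H=(\mathcal V,\mathcal E)$ be a (finite) tree-like higraph, i.e. $|t(\varepsilon)|=1$ for every edge $\varepsilon$, and let $\widetilde{\mathcal A}$ be the path DGA of its bigraph with differential $\tilde\delta$. Let $\tilde D=\sum\tilde\rho$, the sum over all good paths $\tilde\rho$ of weight $1$. Then $\tilde\delta\tilde D=\tilde D\,\tilde D$ (product in $\widetilde{\mathcal A}$).
   Context: $\mathbb F=\{0,1\}$. A directed hypergraph $\mathcal H=(\mathcal V,\mathcal E)$ has edges $\varepsilon=(I,J)\in2^{\mathcal V}\times2^{\mathcal V}$ with source $I$, target $J$. It is a higraph if for all edges $\varepsilon,\varepsilon'$: (Transitive) if $t(\varepsilon)\cap s(\varepsilon')\ne\emptyset$ then it equals $\{K\}$ for one vertex $K$, the unions $s(\varepsilon)\cup(s(\varepsilon')\setminus\{K\})$ and $(t(\varepsilon)\setminus\{K\})\cup t(\varepsilon')$ are disjoint unions and their pair is an edge; (Acyclic) if $t(\varepsilon)\cap s(\varepsilon')$ and $t(\varepsilon')\cap s(\varepsilon)$ are both non-empty then $\varepsilon=\varepsilon'=(\{K\},\{K\})$. $\mathcal V$ is finite. Bigraph: vertices $\mathcal V\times\{o,u,s\}$, projection $\eta$ to $\mathcal V$; a vertex $(K,X)$ has type $X$ (interior $o$, unstable $u$, stable $s$). Edges: triples $(\mu,\tilde I,\tilde J)$, $\mu\in\mathbb F$, $\eta$ injective on $\tilde I$ and on $\tilde J$, $(\eta\tilde I,\eta\tilde J)\in\mathcal E$, and if $\mu=0$ then $\tilde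 I$ has no stable and $\tilde J$ no unstable vertex, if $\mu=1$ then $\tilde I\cup\tilde J$ has no interior vertex; source $\tilde I$, target $\tilde J$; interior if $\mu=0$, boundary if $\mu=1$. Weight: $1$ for interior edges, $2-(\#\text{stable in }\tilde I)-(\#\text{unstable in }\tilde J)$ for boundary edges. A path is a non-empty finite directed tree $T=(V,E)$ (nodes, arrows) with a labeling $\tilde\rho:V\to$ bigraph edges such that for each arrow $e$, $t(\tilde\rho(s(e)))\cap s(\tilde\rho(t(e)))$ is a single vertex $\tilde\rho(e)$, and distinct arrows with a common source node or common target node have distinct $\tilde\rho(e)$; label-compatible tree isomorphisms identify paths. Source $s(\tilde\rho)=\bigcup_v(s(\tilde\rho(v))\setminus\{\tilde\rho(e):t(e)=v\})$, target $t(\tilde\rho)=\bigcup_v(t(\tilde\rho(v))\setminus\{\tilde\rho(e):s(e)=v\})$; a vertex of $s(\tilde\rho)$ in $s(\tilde\rho(v))$ is sourced by $v$, a vertex of $t(\tilde\rho)$ in $t(\tilde\rho(v))$ targeted by $v$. Weight of a path = sum of edge weights; length = number of nodes; boundary path = all edges boundary. A path is good if every vertex of $s(\tilde\rho)\cup t(\tilde\rho)$ is of type $o$ or $u$. Refinement $r((\tilde\rho,v),\tilde\rho'')$ for a node $v$ and a path $\tilde\rho''$ with the same source and target as the edge $\tilde\rho(v)$: replace $v$ by the tree of $\tilde\rho''$, each arrow $(a,v)$ by $(a,v'')$ with $v''$ sourcing $\tilde\rho((a,v))$ in $\tilde\rho''$, each $(v,b)$ by $(v'',b)$ with $v''$ targeting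 $\tilde\rho((v,b))$; it is $0$ otherwise. Path DGA $\widetilde{\mathcal A}$: $\mathbb F$-vector space on the set of paths, graded by weight. Product: if $t(\tilde\rho_1)\cap s(\tilde\rho_2)=\{K\}$, with $K$ targeted by node $v_1$ of $\tilde\rho_1$ and sourced by node $v_2$ of $\tilde\rho_2$, then $\tilde\rho_1\tilde\rho_2$ is the path on the disjoint union of the two trees plus the arrow $(v_1,v_2)$, with the combined labels; if the intersection is empty the product is $0$; extended bilinearly (for tree-like higraphs the intersection has at most one element). Differential: $\tilde\delta\tilde\rho=\sum_{v\text{ interior}}\sum_{\tilde\rho'}r((\tilde\rho,v),\tilde\rho')+\sum_{v\text{ boundary}}\sum_{\bar\rho'}r((\tilde\rho,v),\bar\rho')$, where $\tilde\rho'$ ranges over paths of weight $2$ and $\bar\rho'$ over boundary paths of length $2$, extended linearly. *)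

theory Defs
  imports Main
begin

section \<open>Higraphs\<close>

type_synonym 'v hedge = "'v set \<times> 'v set"

definition higraph :: "'v set \<Rightarrow> 'v hedge set \<Rightarrow> bool" where
  "higraph V E \<longleftrightarrow>
     finite V \<and> E \<subseteq> Pow V \<times> Pow V \<and>
     (\<forall>e\<in>E. \<forall>e'\<in>E. snd e \<inter> fst e' \<noteq> {} \<longrightarrow>
        (\<exists>K. snd e \<inter> fst e' = {K} \<and>
             fst e \<inter> (fst e' - {K}) = {} \<and>
             (snd e - {K}) \<inter> snd e' = {} \<and>
             (fst e \<union> (fst e' - {K}), (snd e - {K}) \<union> snd e') \<in> E)) \<and>
     (\<forall>e\<in>E. \<forall>e'\<in>E. snd e \<inter> fst e' \<noteq> {} \<and> snd e' \<inter> fst e \<noteq> {} \<longrightarrow>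
        (\<exists>K. e = ({K}, {K}) \<and> e' = ({K}, {K})))"

definition tree_like :: "'v hedge set \<Rightarrow> bool" where
  "tree_like E \<longleftrightarrow> (\<forall>e\<in>E. card (snd e) = 1)"

section \<open>Bigraph\<close>

datatype vtype = Int_o | Unst_u | Stab_s

type_synonym 'v bvert = "'v \<times> vtype"
(* (mu, source, target); mu = False means 0 (interior), True means 1 (boundary) *)
type_synonym 'v bedge = "bool \<times> 'v bvert set \<times> 'v bvert set"

definition bsrc :: "'v bedge \<Rightarrow> 'v bvert set" where "bsrc e = fst (snd e)"
definition btgt :: "'v bedge \<Rightarrow> 'v bvert set" where "btgt e = snd (snd e)"
definition bboundary :: "'v bedge \<Rightarrow> bool" where "bboundary e = fst e"

definition bigraph_edges :: "'v set \<Rightarrow> 'v hedge set \<Rightarrow> 'v bedge set" where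
  "bigraph_edges V E = {(\<mu>, I, J). I \<subseteq> V \<times> UNIV \<and> J \<subseteq> V \<times> UNIV \<and>
      inj_on fst I \<and> inj_on fst J \<and> (fst ` I, fst ` J) \<in> E \<and>
      (\<not> \<mu> \<longrightarrow> (\<forall>x\<in>I. snd x \<noteq> Stab_s) \<and> (\<forall>x\<in>J. snd x \<noteq> Unst_u)) \<and>
      (\<mu> \<longrightarrow> (\<forall>x\<in>I \<union> J. snd x \<noteq> Int_o))}"

definition bweight :: "'v bedge \<Rightarrow> int" where
  "bweight e = (if \<not> bboundary e then 1
     else 2 - int (card {x\<in>bsrc e. snd x = Stab_s}) - int (card {x\<in>btgt e. snd x = Unst_u}))"

section \<open>Concrete paths (labelled trees with nodes in nat)\<close>

record 'v pth =
  nodes :: "nat set"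
  arrs :: "(nat \<times> nat) set"
  lab :: "nat \<Rightarrow> 'v bedge"

(* the bigraph vertex labelling an arrow *)
definition avert :: "'v pth \<Rightarrow> nat \<times> nat \<Rightarrow> 'v bvert" where
  "avert p a = (THE x. x \<in> btgt (lab p (fst a)) \<inter> bsrc (lab p (snd a)))"

definition is_dtree :: "nat set \<Rightarrow> (nat \<times> nat) set \<Rightarrow> bool" where
  "is_dtree N A \<longleftrightarrow> finite N \<and> N \<noteq> {} \<and> A \<subseteq> N \<times> N \<and>
     (\<forall>a b. (a, b) \<in> A \<longrightarrow> a \<noteq> b \<and> (b, a) \<notin> A) \<and>
     card A + 1 = card N \<and>
     (\<forall>x\<in>N. \<forall>y\<in>N. (x, y) \<in> (A \<union> A\<inverse>)\<^sup>*)"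

definition is_path :: "'v set \<Rightarrow> 'v hedge set \<Rightarrow> 'v pth \<Rightarrow> bool" where
  "is_path V E p \<longleftrightarrow> is_dtree (nodes p) (arrs p) \<and>
     (\<forall>v\<in>nodes p. lab p v \<in> bigraph_edges V E) \<and>
     (\<forall>a\<in>arrs p. card (btgt (lab p (fst a)) \<inter> bsrc (lab p (snd a))) = 1) \<and>
     (\<forall>a\<in>arrs p. \<forall>b\<in>arrs p. a \<noteq> b \<and> fst a = fst b \<longrightarrow> avert p a \<noteq> avert p b) \<and>
     (\<forall>a\<in>arrs p. \<forall>b\<in>arrs p. a \<noteq> b \<and> snd a = snd b \<longrightarrow> avert p a \<noteq> avert p b)"

(* label-compatible isomorphism of trees *)
definition piso :: "'v pth \<Rightarrow> 'v pth \<Rightarrow> bool" where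
  "piso p q \<longleftrightarrow> (\<exists>f. bij_betw f (nodes p) (nodes q) \<and>
     (\<forall>a\<in>nodes p. \<forall>b\<in>nodes p. (a, b) \<in> arrs p \<longleftrightarrow> (f a, f b) \<in> arrs q) \<and>
     (\<forall>v\<in>nodes p. lab q (f v) = lab p v))"

(* vertices sourced / targeted by node w *)
definition sourced_by :: "'v pth \<Rightarrow> nat \<Rightarrow> 'v bvert set" where
  "sourced_by p w = bsrc (lab p w) - {avert p a | a. a \<in> arrs p \<and> snd a = w}"
definition targeted_by :: "'v pth \<Rightarrow> nat \<Rightarrow> 'v bvert set" where
  "targeted_by p w = btgt (lab p w) - {avert p a | a. a \<in> arrs p \<and> fst a = w}"

definition psrc :: "'v pth \<Rightarrow> 'v bvert set" where
  "psrc p = (\<Union>w\<in>nodes p. sourced_by p w)"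
definition ptgt :: "'v pth \<Rightarrow> 'v bvert set" where
  "ptgt p = (\<Union>w\<in>nodes p. targeted_by p w)"

definition pweight :: "'v pth \<Rightarrow> int" where
  "pweight p = (\<Sum>v\<in>nodes p. bweight (lab p v))"
definition plength :: "'v pth \<Rightarrow> nat" where
  "plength p = card (nodes p)"
definition boundary_path :: "'v pth \<Rightarrow> bool" where
  "boundary_path p \<longleftrightarrow> (\<forall>v\<in>nodes p. bboundary (lab p v))"
definition good :: "'v pth \<Rightarrow> bool" where
  "good p \<longleftrightarrow> (\<forall>x\<in>psrc p \<union> ptgt p. snd x = Int_o \<or> snd x = Unst_u)"

section \<open>Paths up to isomorphism (basis of the path DGA)\<close>

definition pclass :: "'v set \<Rightarrow> 'v hedge set \<Rightarrow> 'v pth \<Rightarrow> 'v pth set" where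
  "pclass V E p = {q. is_path V E q \<and> piso p q}"

definition pclasses :: "'v set \<Rightarrow> 'v hedge set \<Rightarrow> 'v pth set set" where
  "pclasses V E = {pclass V E p | p. is_path V E p}"

definition rep :: "'v pth set \<Rightarrow> 'v pth" where
  "rep X = (SOME p. p \<in> X)"

(* Refinement of node v of p by path q (disjoint union via even/odd renumbering) *)
definition refine :: "'v pth \<Rightarrow> nat \<Rightarrow> 'v pth \<Rightarrow> 'v pth" where
  "refine p v q =
    \<lparr> nodes = (\<lambda>n. 2 * n) ` (nodes p - {v}) \<union> (\<lambda>m. 2 * m + 1) ` nodes q,
      arrs = {(2 * a, 2 * b) | a b. (a, b) \<in> arrs p \<and> a \<noteq> v \<and> b \<noteq> v}
           \<union> {(2 * a + 1, 2 * b + 1) | a b. (a, b) \<in> arrs q}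
           \<union> {(2 * a, 2 * (SOME w. w \<in> nodes q \<and> avert p (a, v) \<in> sourced_by q w) + 1)
               | a. (a, v) \<in> arrs p}
           \<union> {(2 * (SOME w. w \<in> nodes q \<and> avert p (v, b) \<in> targeted_by q w) + 1, 2 * b)
               | b. (v, b) \<in> arrs p},
      lab = (\<lambda>n. if even n then lab p (n div 2) else lab q (n div 2)) \<rparr>"

(* Concatenation product of concrete paths, defined when ptgt p1 \<inter> psrc p2 = {K} *)
definition concat :: "'v pth \<Rightarrow> 'v pth \<Rightarrow> 'v pth" where
  "concat p1 p2 =
    (let K = (THE K. ptgt p1 \<inter> psrc p2 = {K});
         v1 = (SOME w. w \<in> nodes p1 \<and> K \<in> targeted_by p1 w);
         v2 = (SOME w. w \<in> nodes p2 \<and> K \<in> sourced_by p2 w)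
     in \<lparr> nodes = (\<lambda>n. 2 * n) ` nodes p1 \<union> (\<lambda>m. 2 * m + 1) ` nodes p2,
          arrs = {(2 * a, 2 * b) | a b. (a, b) \<in> arrs p1}
               \<union> {(2 * a + 1, 2 * b + 1) | a b. (a, b) \<in> arrs p2}
               \<union> {(2 * v1, 2 * v2 + 1)},
          lab = (\<lambda>n. if even n then lab p1 (n div 2) else lab p2 (n div 2)) \<rparr>)"

definition prod_defined :: "'v pth \<Rightarrow> 'v pth \<Rightarrow> bool" where
  "prod_defined p1 p2 \<longleftrightarrow> (\<exists>K. ptgt p1 \<inter> psrc p2 = {K})"

section \<open>Elements of the path DGA over F_2, via coefficients on basis classes\<close>

(* terms of the differential of the basis element X: pairs (node v, class Y) *)
definition delta_terms :: "'v set \<Rightarrow> 'v hedge set \<Rightarrow> 'v pth set \<Rightarrow> (nat \<times> 'v pth set) set" where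
  "delta_terms V E X = {(v, Y). v \<in> nodes (rep X) \<and> Y \<in> pclasses V E \<and>
      (if \<not> bboundary (lab (rep X) v) then pweight (rep Y) = 2
       else boundary_path (rep Y) \<and> plength (rep Y) = 2) \<and>
      psrc (rep Y) = bsrc (lab (rep X) v) \<and> ptgt (rep Y) = btgt (lab (rep X) v)}"

(* coefficient (in F_2) of the basis class C in \<delta>(X) *)
definition delta_coeff :: "'v set \<Rightarrow> 'v hedge set \<Rightarrow> 'v pth set \<Rightarrow> 'v pth set \<Rightarrow> bool" where
  "delta_coeff V E X C \<longleftrightarrow>
     odd (card {(v, Y) \<in> delta_terms V E X. refine (rep X) v (rep Y) \<in> C})"

(* the basis classes appearing in D: good paths of weight 1 *)
definition Dset :: "'v set \<Rightarrow> 'v hedge set \<Rightarrow> 'v pth set set" where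
  "Dset V E = {X \<in> pclasses V E. good (rep X) \<and> pweight (rep X) = 1}"

definition deltaD_coeff :: "'v set \<Rightarrow> 'v hedge set \<Rightarrow> 'v pth set \<Rightarrow> bool" where
  "deltaD_coeff V E C \<longleftrightarrow> odd (card {X \<in> Dset V E. delta_coeff V E X C})"

definition DD_coeff :: "'v set \<Rightarrow> 'v hedge set \<Rightarrow> 'v pth set \<Rightarrow> bool" where
  "DD_coeff V E C \<longleftrightarrow> odd (card {(X1, X2) \<in> Dset V E \<times> Dset V E.
      prod_defined (rep X1) (rep X2) \<and> concat (rep X1) (rep X2) \<in> C})"

end

theory Submission
  imports Defs
begin

text \<open>
  Each edge has a single target, so a path is a rooted tree in which the arrows into a node are
  told apart by the bigraph vertices labelling them. Hence paths have no non-trivial label-compatible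
  automorphisms, and isomorphism classes of paths are the terms of a recursive datatype. In this
  description the product grafts one tree onto an open source of another.

  Charging a stable arrow to the node it leaves shows that a tree without stable sources has weight
  at least 1. The good trees of weight 1 are the single interior edges with interior target
  and the corollas, i.e. boundary edges with unstable target whose stable sources are filled
  by interior edges (feeders) and whose other sources are open. Refining a node of such a
  tree yields one of four kinds of trees: an interior edge with one good subtree of weight 1 (from an
  interior edge), a corolla with one feeder continued by a good tree of weight 1 (from a feeder),
  a corolla with another corolla attached at an unstable source (from the root), and a corolla with
  one feeder replaced by a boundary edge with its own feeders. The last kind arises
  twice, from the root and from a feeder, and cancels; each tree of the first three kinds arises
  exactly once, and these are exactly the products, with a unique factorization.
\<close>

section \<open>Rigid trees and rooted paths\<close>

text \<open>The identity is checked one basis class at a time. For the class of a fixed tree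
  \<open>t\<close>, the coefficient on the product side counts the factorizations
  \<open>DDpairs t\<close>, and the coefficient on the other side counts, modulo 2, the preimages
  \<open>Drefinements t\<close>. Kids form a partial map on bigraph vertices, without an order, so
  that equality of trees already is isomorphism and both counts are counts of plain sets. The axiom
  (Transitive) enters in two ways. It makes the open sources at different places of a tree disjoint,
  so the node to which an arrow is attached is determined and a product alters a tree at one place
  only. It also supplies the edge to which a subtree collapses, and without such edges the preimages
  under refinement would not exist. Good trees of weight 1 have depth at most 1. Therefore
  refinements have to be computed only at the root and at a leaf directly below the root.\<close>

datatype 'v tr = Nd (lb: "'v bedge") (kd: "'v bvert \<Rightarrow> 'v tr option")

text \<open>The generated rule reaches a kid through the range of \<open>k\<close> and the elements
  of an option; this form keeps the vertex \<open>x\<close> at which the kid hangs.\<close>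

lemma tr_induct [case_names Nd]:
  assumes "\<And>e k. (\<And>x s. k x = Some s \<Longrightarrow> P s) \<Longrightarrow> P (Nd e k)"
  shows "P t"
proof (induction t)
  case (Nd e k)
  show ?case
  proof (rule assms)
    fix x s
    assume "k x = Some s"
    then have "Some s \<in> range k" by (metis rangeI)
    then show "P s" by (rule Nd) simp
  qed
qed

text \<open>Recursion through the option-valued map has to go through \<open>map_option\<close>;
  \<open>tsrc_Nd\<close> is the equation for use. By \<open>psrc_shape\<close> this is the source of
  the path.\<close>

primrec tsrc :: "'v tr \<Rightarrow> 'v bvert set" where
  "tsrc (Nd e k) = (bsrc e - dom k) \<union> (\<Union>x. case map_option tsrc (k x) of None \<Rightarrow> {} | Some A \<Rightarrow> A)"

lemma tsrc_Nd: "tsrc (Nd e k) = (bsrc e - dom k) \<union> (\<Union>s\<in>ran k. tsrc s)"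
proof -
  have "(case map_option tsrc (k x) of None \<Rightarrow> {} | Some A \<Rightarrow> A) = (\<Union>s\<in>set_option (k x). tsrc s)" for x
    by (cases "k x") simp_all
  moreover have "ran k = (\<Union>x. set_option (k x))"
    by (simp add: ran_def set_eq_iff elem_set)
  ultimately show ?thesis by simp
qed

lemma tsrc_cases:
  assumes "y \<in> tsrc (Nd e k)"
  obtains "y \<in> bsrc e" "k y = None" | x s where "k x = Some s" "y \<in> tsrc s"
  using assms unfolding tsrc_Nd ran_def by blast

lemma tsrc_NdI:
  shows "y \<in> bsrc e \<Longrightarrow> k y = None \<Longrightarrow> y \<in> tsrc (Nd e k)"
    and "k x = Some s \<Longrightarrow> y \<in> tsrc s \<Longrightarrow> y \<in> tsrc (Nd e k)"
  unfolding tsrc_Nd ran_def by blast+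

declare tsrc.simps [simp del]

text \<open>General in \<open>g\<close> because weight, number of nodes and number of interior edges
  are all instances, and \<open>sum_shape\<close> transports them at once.\<close>

primrec tsum :: "('v bedge \<Rightarrow> int) \<Rightarrow> 'v tr \<Rightarrow> int" where
  "tsum g (Nd e k) = g e + (\<Sum>x\<in>bsrc e. case map_option (tsum g) (k x) of None \<Rightarrow> 0 | Some n \<Rightarrow> n)"

lemma tsum_Nd:
  assumes "finite (bsrc e)" "dom k \<subseteq> bsrc e"
  shows "tsum g (Nd e k) = g e + (\<Sum>x\<in>dom k. tsum g (the (k x)))"
proof -
  have "(\<Sum>x\<in>bsrc e. case map_option (tsum g) (k x) of None \<Rightarrow> 0 | Some n \<Rightarrow> n)
      = (\<Sum>x\<in>dom k. case map_option (tsum g) (k x) of None \<Rightarrow> 0 | Some n \<Rightarrow> n)"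
    using assms by (intro sum.mono_neutral_right) (simp_all add: domIff)
  also have "\<dots> = (\<Sum>x\<in>dom k. tsum g (the (k x)))"
    by (rule sum.cong) auto
  finally show ?thesis by simp
qed

declare tsum.simps [simp del]

text \<open>Fills all free sources simultaneously. A one-point \<open>M\<close> gives the product;
  the kid map of a refined root gives the reattachment of its subtrees to the replacement.\<close>

primrec graft :: "('v bvert \<Rightarrow> 'v tr option) \<Rightarrow> 'v tr \<Rightarrow> 'v tr" where
  "graft M (Nd e k) = Nd e (\<lambda>x. case map_option (graft M) (k x) of
      Some s \<Rightarrow> Some s | None \<Rightarrow> if x \<in> bsrc e then M x else None)"

lemma lb_graft [simp]: "lb (graft M t) = lb t"
  by (cases t) simp

lemma kd_graft: "kd (graft M t) x = (case kd t x of Some s \<Rightarrow> Some (graft M s)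
    | None \<Rightarrow> if x \<in> bsrc (lb t) then M x else None)"
  by (cases t) (simp split: option.splits)

lemma graft_idle: "tsrc t \<inter> dom M = {} \<Longrightarrow> graft M t = t"
proof (induction t rule: tr_induct)
  case (Nd e k)
  have kid: "graft M s = s" if "k x = Some s" for x s
  proof (rule Nd.IH[OF that])
    have "tsrc s \<subseteq> tsrc (Nd e k)" using tsrc_NdI(2)[of k] that by blast
    then show "tsrc s \<inter> dom M = {}" using Nd.prems by blast
  qed
  have none: "M x = None" if "k x = None" "x \<in> bsrc e" for x
  proof -
    have "x \<in> tsrc (Nd e k)" using tsrc_NdI(1) that by blast
    then show ?thesis using Nd.prems by blast
  qed
  have "(case map_option (graft M) (k x) of Some s \<Rightarrow> Some s
      | None \<Rightarrow> if x \<in> bsrc e then M x else None) = k x" for x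
    using kid none by (cases "k x") simp_all
  then show ?case by simp
qed

section \<open>Rooted paths and the trees to which they unfold\<close>

definition out :: "'v pth \<Rightarrow> nat \<Rightarrow> 'v bvert" where
  "out p a = the_elem (btgt (lab p a))"

text \<open>The purely combinatorial content of a path: one arrow out of every node but the root,
  and siblings told apart by their targets. What concerns edges of the higraph is left to
  \<open>wft\<close>.\<close>

definition rooted :: "'v pth \<Rightarrow> nat \<Rightarrow> bool" where
  "rooted p r \<longleftrightarrow> finite (nodes p) \<and> r \<in> nodes p \<and> arrs p \<subseteq> nodes p \<times> nodes p \<and>
     single_valued (arrs p) \<and> r \<notin> Domain (arrs p) \<and> (\<forall>w\<in>nodes p. (w, r) \<in> (arrs p)\<^sup>*) \<and>
     (\<forall>a b w. (a, w) \<in> arrs p \<longrightarrow> (b, w) \<in> arrs p \<longrightarrow> out p a = out p b \<longrightarrow> a = b)"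

text \<open>\<open>\<tau> w\<close> is the part of the path that flows into \<open>w\<close>. A
  property of \<open>\<tau>\<close> instead of a recursion, so that the tree of a product or a
  refinement can be exhibited and verified node by node.\<close>

definition unfolds :: "'v pth \<Rightarrow> (nat \<Rightarrow> 'v tr) \<Rightarrow> bool" where
  "unfolds p \<tau> \<longleftrightarrow> (\<forall>w\<in>nodes p. lb (\<tau> w) = lab p w \<and>
     (\<forall>x s. kd (\<tau> w) x = Some s \<longleftrightarrow> (\<exists>a. (a, w) \<in> arrs p \<and> out p a = x \<and> \<tau> a = s)))"

lemma rootedD:
  assumes "rooted p r"
  shows "finite (nodes p)" "r \<in> nodes p" "\<And>a b. (a, b) \<in> arrs p \<Longrightarrow> a \<in> nodes p \<and> b \<in> nodes p"
    "\<And>a b c. (a, b) \<in> arrs p \<Longrightarrow> (a, c) \<in> arrs p \<Longrightarrow> b = c" "\<And>a. (r, a) \<notin> arrs p"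
    "\<And>w. w \<in> nodes p \<Longrightarrow> (w, r) \<in> (arrs p)\<^sup>*"
    "\<And>a b w. (a, w) \<in> arrs p \<Longrightarrow> (b, w) \<in> arrs p \<Longrightarrow> out p a = out p b \<Longrightarrow> a = b"
  using assms unfolding rooted_def single_valued_def by blast+

lemma unfoldsD:
  assumes "unfolds p \<tau>" "w \<in> nodes p"
  shows "lb (\<tau> w) = lab p w"
    "kd (\<tau> w) x = Some s \<longleftrightarrow> (\<exists>a. (a, w) \<in> arrs p \<and> out p a = x \<and> \<tau> a = s)"
  using assms unfolding unfolds_def by blast+

lemma unfolds_None:
  assumes "unfolds p \<tau>" "w \<in> nodes p"
  shows "kd (\<tau> w) x = None \<longleftrightarrow> (\<forall>a. (a, w) \<in> arrs p \<longrightarrow> out p a \<noteq> x)"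
  using unfoldsD(2)[OF assms] by (metis not_Some_eq)

lemma unfolds_dom:
  assumes "unfolds p \<tau>" "w \<in> nodes p"
  shows "dom (kd (\<tau> w)) = out p ` {a. (a, w) \<in> arrs p}"
proof (rule set_eqI)
  fix x
  show "x \<in> dom (kd (\<tau> w)) \<longleftrightarrow> x \<in> out p ` {a. (a, w) \<in> arrs p}"
    using unfoldsD(2)[OF assms, of x] by blast
qed

lemma rooted_parent:
  assumes "rooted p r" "w \<in> nodes p" "w \<noteq> r"
  obtains b where "(w, b) \<in> arrs p"
  using rootedD(6)[OF assms(1,2)] assms(3) by (meson converse_rtranclE)

text \<open>Each arrow leads closer to the root: only one arrow leaves a node, so the shortest chain
  from the node to the root starts with that arrow.\<close>

lemma rooted_wf:
  assumes "rooted p r"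
  shows "wf (arrs p)"
proof -
  define d where "d w = (LEAST n. (w, r) \<in> arrs p ^^ n)" for w
  have "d w < d a" if aw: "(a, w) \<in> arrs p" for a w
  proof -
    have "(a, r) \<in> (arrs p)\<^sup>*" using rootedD(3,6)[OF assms] aw by blast
    then have "\<exists>n. (a, r) \<in> arrs p ^^ n" by (rule rtrancl_imp_relpow)
    then have *: "(a, r) \<in> arrs p ^^ d a" unfolding d_def by (rule LeastI_ex)
    have "d a \<noteq> 0"
    proof
      assume "d a = 0"
      with * have "a = r" by simp
      with aw rootedD(5)[OF assms] show False by blast
    qed
    then obtain m where m: "d a = Suc m" by (cases "d a") auto
    with * obtain b where "(a, b) \<in> arrs p" "(b, r) \<in> arrs p ^^ m"
      by (metis relpow_Suc_E2)
    then have "(w, r) \<in> arrs p ^^ m" using rootedD(4)[OF assms aw] by blast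
    then have "d w \<le> m" unfolding d_def by (rule Least_le)
    then show ?thesis using m by simp
  qed
  \<comment> \<open>The distance orders nodes towards the root, whereas recursion runs from a node
    to its kids; acyclicity of a finite relation reverses the direction.\<close>
  then have "(arrs p)\<inverse> \<subseteq> measure d" by auto
  then have "wf ((arrs p)\<inverse>)" by (rule wf_subset[OF wf_measure])
  then have "acyclic (arrs p)" using wf_acyclic acyclic_converse by blast
  moreover have "arrs p \<subseteq> nodes p \<times> nodes p" "finite (nodes p)"
    using assms unfolding rooted_def by blast+
  then have "finite (arrs p)" by (meson finite_SigmaI finite_subset)
  ultimately show ?thesis by (simp add: finite_acyclic_wf)
qed

text \<open>Well-founded recursion on arrows. The description of the kid at \<open>x\<close> is
  proper because siblings have different \<open>out\<close>.\<close>

lemma rooted_unfolds_ex: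
  assumes "rooted p r"
  obtains \<tau> where "unfolds p \<tau>"
proof -
  define F where "F f w = Nd (lab p w) (\<lambda>x. if \<exists>a. (a, w) \<in> arrs p \<and> out p a = x
      then Some (f (THE a. (a, w) \<in> arrs p \<and> out p a = x)) else None)"
    for f :: "nat \<Rightarrow> 'a tr" and w
  define \<tau> where "\<tau> = wfrec (arrs p) F"
  have the: "(THE a. (a, w) \<in> arrs p \<and> out p a = x) = b"
    if "(b, w) \<in> arrs p" "out p b = x" for b w x
    using that rootedD(7)[OF assms] by (intro the_equality) auto
  have "\<tau> w = F (cut \<tau> (arrs p) w) w" for w
    unfolding \<tau>_def by (rule wfrec[OF rooted_wf[OF assms]])
  also have "F (cut \<tau> (arrs p) w) w = F \<tau> w" for w
  proof -
    have "cut \<tau> (arrs p) w (THE a. (a, w) \<in> arrs p \<and> out p a = x) = \<tau> (THE a. (a, w) \<in> arrs p \<and> out p a = x)"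
      if ex: "\<exists>a. (a, w) \<in> arrs p \<and> out p a = x" for x
    proof -
      obtain b where b: "(b, w) \<in> arrs p" "out p b = x" using ex by blast
      show ?thesis unfolding the[OF b] by (rule cut_apply[OF b(1)])
    qed
    then show ?thesis unfolding F_def by (intro arg_cong2[of _ _ _ _ Nd] refl ext if_cong) simp_all
  qed
  finally have \<tau>: "\<tau> w = F \<tau> w" for w .
  have kd: "kd (\<tau> w) x = (if \<exists>a. (a, w) \<in> arrs p \<and> out p a = x
      then Some (\<tau> (THE a. (a, w) \<in> arrs p \<and> out p a = x)) else None)" for w x
    using arg_cong[OF \<tau>[of w], of "\<lambda>t. kd t x"] unfolding F_def tr.sel .
  have "unfolds p \<tau>"
    unfolding unfolds_def
  proof (intro ballI conjI allI)
    fix w x s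
    show "lb (\<tau> w) = lab p w" using arg_cong[OF \<tau>[of w], of lb] unfolding F_def tr.sel .
    show "(kd (\<tau> w) x = Some s) = (\<exists>a. (a, w) \<in> arrs p \<and> out p a = x \<and> \<tau> a = s)"
    proof (cases "\<exists>a. (a, w) \<in> arrs p \<and> out p a = x")
      case True
      then obtain b where b: "(b, w) \<in> arrs p" "out p b = x" by blast
      have "kd (\<tau> w) x = Some (\<tau> b)" unfolding kd the[OF b] using True by simp
      then show ?thesis using b rootedD(7)[OF assms] by (metis option.inject)
    next
      case False
      then have "kd (\<tau> w) x = None" unfolding kd by simp
      then show ?thesis using False by auto
    qed
  qed
  then show ?thesis by (rule that)
qed

text \<open>An isomorphism maps root to root, the only node that no arrow leaves, and preserves
  \<open>out\<close> with the labels; so it respects which kid hangs at which vertex.\<close>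

lemma rooted_piso_unfolds:
  assumes p: "rooted p r" "unfolds p \<tau>" and q: "rooted q r'" "unfolds q \<tau>'" and "piso p q"
  shows "\<tau> r = \<tau>' r'"
proof -
  obtain f where f: "bij_betw f (nodes p) (nodes q)"
    "\<And>a b. a \<in> nodes p \<Longrightarrow> b \<in> nodes p \<Longrightarrow> (a, b) \<in> arrs p \<longleftrightarrow> (f a, f b) \<in> arrs q"
    "\<And>v. v \<in> nodes p \<Longrightarrow> lab q (f v) = lab p v"
    using \<open>piso p q\<close> unfolding piso_def by blast
  have out: "out q (f v) = out p v" if "v \<in> nodes p" for v
    using f(3)[OF that] by (simp add: out_def)
  have img: "f v \<in> nodes q" if "v \<in> nodes p" for v
    using f(1) that by (auto dest: bij_betwE)
  have "f r = r'"
  proof (rule ccontr)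
    assume "f r \<noteq> r'"
    then obtain b where b: "(f r, b) \<in> arrs q"
      using rooted_parent[OF q(1) img[OF rootedD(2)[OF p(1)]]] by blast
    then obtain c where "c \<in> nodes p" "b = f c"
      using rootedD(3)[OF q(1)] f(1) by (metis bij_betw_def imageE)
    then show False using b f(2) rootedD(2,5)[OF p(1)] by blast
  qed
  moreover have "\<tau> w = t \<Longrightarrow> w \<in> nodes p \<Longrightarrow> \<tau>' (f w) = t" for w t
  proof (induction t arbitrary: w rule: tr_induct)
    case (Nd e k)
    have "lb (\<tau>' (f w)) = e"
      using unfoldsD(1)[OF q(2) img] unfoldsD(1)[OF p(2)] Nd.prems f(3) by (metis tr.sel(1))
    moreover have "kd (\<tau>' (f w)) x = k x" for x
    proof (cases "k x")
      case None
      then have no: "\<And>a. (a, w) \<in> arrs p \<Longrightarrow> out p a \<noteq> x"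
        using unfolds_None[OF p(2) Nd.prems(2)] Nd.prems(1) by (metis tr.sel(2))
      have "out q b \<noteq> x" if b: "(b, f w) \<in> arrs q" for b
      proof -
        obtain c where "c \<in> nodes p" "b = f c"
          using rootedD(3)[OF q(1) b] f(1) by (metis bij_betw_def imageE)
        then show ?thesis using no f(2) out b Nd.prems(2) by metis
      qed
      then show ?thesis using unfolds_None[OF q(2) img[OF Nd.prems(2)]] None by simp
    next
      case (Some s)
      then obtain a where a: "(a, w) \<in> arrs p" "out p a = x" "\<tau> a = s"
        using unfoldsD(2)[OF p(2) Nd.prems(2)] Nd.prems(1) by (metis tr.sel(2))
      then have an: "a \<in> nodes p" using rootedD(3)[OF p(1)] by blast
      have "\<tau>' (f a) = s" using Nd.IH[OF Some a(3) an] .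
      then show ?thesis
        using unfoldsD(2)[OF q(2) img[OF Nd.prems(2)], of x s] a an f(2) out Nd.prems(2) Some by metis
    qed
    ultimately show ?case by (metis ext tr.collapse)
  qed
  ultimately show ?thesis using rootedD(2)[OF p(1)] by metis
qed

lemma piso_refl: "piso p p"
  unfolding piso_def by (rule exI[of _ id]) auto

text \<open>The isomorphism forced by equal trees: begin at the roots and pass to kids at the same
  vertex. The relation is symmetric in the two paths, so totality and functionality in one direction
  yield a bijection.\<close>

inductive matched :: "'v pth \<Rightarrow> nat \<Rightarrow> 'v pth \<Rightarrow> nat \<Rightarrow> nat \<Rightarrow> nat \<Rightarrow> bool" for p r q r' where
  root: "matched p r q r' r r'"
| step: "matched p r q r' w u \<Longrightarrow> (a, w) \<in> arrs p \<Longrightarrow> (b, u) \<in> arrs q \<Longrightarrow> out p a = out q b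
    \<Longrightarrow> matched p r q r' a b"

lemma matched_sym: "matched p r q r' w u \<Longrightarrow> matched q r' p r u w"
  by (induction rule: matched.induct) (auto intro: matched.intros)

lemma matched_unfolds:
  assumes p: "rooted p r" "unfolds p \<tau>" and q: "rooted q r'" "unfolds q \<tau>'" and "\<tau> r = \<tau>' r'"
    and "matched p r q r' w u"
  shows "w \<in> nodes p \<and> u \<in> nodes q \<and> \<tau> w = \<tau>' u"
  using assms(6)
proof induction
  case root
  then show ?case using rootedD(2)[OF p(1)] rootedD(2)[OF q(1)] assms(5) by blast
next
  case (step w u a b)
  then show ?case
    using unfoldsD(2)[OF p(2), of w "out p a" "\<tau> a"] unfoldsD(2)[OF q(2), of u "out q b" "\<tau>' b"]
      rootedD(3)[OF p(1)] rootedD(3)[OF q(1)] by (metis option.inject)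
qed

lemma matched_child:
  assumes p: "rooted p r" "unfolds p \<tau>" and q: "rooted q r'" "unfolds q \<tau>'" and eq: "\<tau> r = \<tau>' r'"
    and m: "matched p r q r' w u" and a: "(a, w) \<in> arrs p"
  obtains b where "(b, u) \<in> arrs q" "matched p r q r' a b"
proof -
  have *: "w \<in> nodes p" "u \<in> nodes q" "\<tau> w = \<tau>' u"
    using matched_unfolds[OF p q eq m] by auto
  then have "kd (\<tau>' u) (out p a) = Some (\<tau> a)"
    using unfoldsD(2)[OF p(2)] a by metis
  then obtain b where "(b, u) \<in> arrs q" "out q b = out p a"
    using unfoldsD(2)[OF q(2)] * by blast
  then show ?thesis using that matched.step[OF m a] by metis
qed

lemma matched_total:
  assumes p: "rooted p r" "unfolds p \<tau>" and q: "rooted q r'" "unfolds q \<tau>'" and eq: "\<tau> r = \<tau>' r'"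
    and "w \<in> nodes p"
  obtains u where "matched p r q r' w u"
proof -
  have "(w, r) \<in> (arrs p)\<^sup>*" using rootedD(6)[OF p(1)] assms(6) .
  then have "\<exists>u. matched p r q r' w u"
  proof (induction rule: converse_rtrancl_induct)
    case base
    then show ?case using matched.root by blast
  next
    case (step y z)
    then show ?case using matched_child[OF p q eq] by metis
  qed
  then show ?thesis using that by blast
qed

lemma matched_functional:
  assumes p: "rooted p r" and q: "rooted q r'"
    and "matched p r q r' w u" "matched p r q r' w u'"
  shows "u = u'"
  using assms(3,4)
proof (induction arbitrary: u')
  case root
  then show ?case using rootedD(5)[OF p] by (cases rule: matched.cases) auto
next
  case (step w u a b)
  from step.prems show ?case
  proof (cases rule: matched.cases)
    case root
    then show ?thesis using step.hyps rootedD(5)[OF p] by auto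
  next
    case (step w' u'')
    then have "u'' = u" using rootedD(4)[OF p] \<open>(a, w) \<in> arrs p\<close> \<open>\<And>u'. matched p r q r' w u' \<Longrightarrow> u = u'\<close> by metis
    then show ?thesis
      using step rootedD(7)[OF q] \<open>(b, u) \<in> arrs q\<close> \<open>out p a = out q b\<close> by metis
  qed
qed

lemma unfolds_piso:
  assumes p: "rooted p r" "unfolds p \<tau>" and q: "rooted q r'" "unfolds q \<tau>'" and eq: "\<tau> r = \<tau>' r'"
  shows "piso p q"
proof -
  let ?m = "matched p r q r'"
  define f where "f w = (THE u. ?m w u)" for w
  have f: "f w = u" if "?m w u" for w u
    unfolding f_def using that matched_functional[OF p(1) q(1)] by blast
  have mf: "?m w (f w)" if "w \<in> nodes p" for w
    using matched_total[OF p q eq that] f by metis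
  have inj: "w = w'" if "?m w u" "?m w' u" for w w' u
    using matched_functional[OF q(1) p(1)] that matched_sym by metis
  have nd: "w \<in> nodes p" "u \<in> nodes q" "\<tau> w = \<tau>' u" if "?m w u" for w u
    using matched_unfolds[OF p q eq that] by auto
  have "bij_betw f (nodes p) (nodes q)"
    unfolding bij_betw_def
  proof
    show "inj_on f (nodes p)"
      using inj mf by (metis inj_onI)
    have "u \<in> f ` nodes p" if u: "u \<in> nodes q" for u
    proof -
      obtain w where "matched q r' p r u w"
        using matched_total[OF q p eq[symmetric] u] .
      then have "?m w u" by (rule matched_sym)
      then show ?thesis using f nd by blast
    qed
    then show "f ` nodes p = nodes q" using mf nd by blast
  qed
  moreover have "(a, b) \<in> arrs p \<longleftrightarrow> (f a, f b) \<in> arrs q" if an: "a \<in> nodes p" and bn: "b \<in> nodes p" for a b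
  proof
    assume "(a, b) \<in> arrs p"
    then show "(f a, f b) \<in> arrs q"
      using matched_child[OF p q eq mf[OF bn]] f by metis
  next
    assume "(f a, f b) \<in> arrs q"
    then obtain c where "(c, b) \<in> arrs p" "matched q r' p r (f a) c"
      using matched_child[OF q p eq[symmetric] matched_sym[OF mf[OF bn]]] by metis
    then show "(a, b) \<in> arrs p" using inj matched_sym mf an by metis
  qed
  moreover have "lab q (f v) = lab p v" if "v \<in> nodes p" for v
    using nd[OF mf[OF that]] unfoldsD(1)[OF p(2)] unfoldsD(1)[OF q(2)] by metis
  ultimately show ?thesis unfolding piso_def by blast
qed

section \<open>Paths of a tree-like higraph\<close>

locale tree_higraph =
  fixes V :: "'v set" and E :: "'v hedge set"
  assumes higraph: "higraph V E" and tree_like: "tree_like E"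
begin

text \<open>The trees of paths. That arrows into a node carry distinct vertices is built in, since a
  map has at most one kid at each vertex.\<close>

inductive wft :: "'v tr \<Rightarrow> bool" where
  Nd: "e \<in> bigraph_edges V E \<Longrightarrow> (\<And>x s. k x = Some s \<Longrightarrow> x \<in> bsrc e \<and> btgt (lb s) = {x} \<and> wft s)
    \<Longrightarrow> wft (Nd e k)"

lemma wft_Nd: "wft (Nd e k) \<longleftrightarrow> e \<in> bigraph_edges V E \<and>
    (\<forall>x s. k x = Some s \<longrightarrow> x \<in> bsrc e \<and> btgt (lb s) = {x} \<and> wft s)"
  by (auto intro: wft.intros elim: wft.cases)

lemma wft_edge: "wft t \<Longrightarrow> lb t \<in> bigraph_edges V E"
  by (cases t) (simp add: wft_Nd)

lemma wft_kid: "wft t \<Longrightarrow> kd t x = Some s \<Longrightarrow> x \<in> bsrc (lb t) \<and> btgt (lb s) = {x} \<and> wft s"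
  using wft_Nd[of "lb t" "kd t"] unfolding tr.collapse by blast

lemma edge_tgt:
  assumes "e \<in> bigraph_edges V E"
  obtains y where "btgt e = {y}"
proof -
  have "(fst ` bsrc e, fst ` btgt e) \<in> E" "inj_on fst (btgt e)"
    using assms by (auto simp: bigraph_edges_def bsrc_def btgt_def)
  then have "card (btgt e) = 1"
    using tree_like card_image unfolding tree_like_def by fastforce
  then show ?thesis using that by (auto simp: card_1_singleton_iff)
qed

lemma edge_finite:
  assumes "e \<in> bigraph_edges V E"
  shows "finite (bsrc e)"
proof -
  have "fst ` bsrc e \<subseteq> V" "inj_on fst (bsrc e)"
    using assms by (auto simp: bigraph_edges_def bsrc_def)
  moreover have "finite V" using higraph by (simp add: higraph_def)
  ultimately show ?thesis by (meson finite_imageD finite_subset)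
qed

text \<open>A node has a single target, which every arrow leaving it must carry; hence
  \<open>avert\<close> depends only on the start of the arrow.\<close>

lemma path_arrow:
  assumes "is_path V E p" "(a, w) \<in> arrs p"
  shows "a \<in> nodes p" "w \<in> nodes p" "btgt (lab p a) = {out p a}" "out p a \<in> bsrc (lab p w)"
    "avert p (a, w) = out p a"
proof -
  show n: "a \<in> nodes p" "w \<in> nodes p"
    using assms unfolding is_path_def is_dtree_def by auto
  then obtain y where y: "btgt (lab p a) = {y}"
    using assms(1) edge_tgt unfolding is_path_def by blast
  then show "btgt (lab p a) = {out p a}" by (simp add: out_def)
  have "card (btgt (lab p a) \<inter> bsrc (lab p w)) = 1"
    using assms unfolding is_path_def by force
  then have "y \<in> bsrc (lab p w)"
    using y by (cases "y \<in> bsrc (lab p w)") auto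
  then show "out p a \<in> bsrc (lab p w)" "avert p (a, w) = out p a"
    using y by (auto simp: out_def avert_def)
qed

text \<open>Arrows leaving one node all carry its only target but would have to carry distinct
  vertices, so there is at most one. With one arrow fewer than nodes, some node has none; this is
  the root.\<close>

lemma path_rooted:
  assumes "is_path V E p"
  obtains r where "rooted p r"
proof -
  let ?A = "arrs p"
  have dt: "finite (nodes p)" "?A \<subseteq> nodes p \<times> nodes p" "card ?A + 1 = card (nodes p)"
    "\<And>x y. x \<in> nodes p \<Longrightarrow> y \<in> nodes p \<Longrightarrow> (x, y) \<in> (?A \<union> ?A\<inverse>)\<^sup>*"
    using assms unfolding is_path_def is_dtree_def by auto
  have sv: "b = c" if "(a, b) \<in> ?A" "(a, c) \<in> ?A" for a b c
  proof (rule ccontr)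
    assume "b \<noteq> c"
    then have "avert p (a, b) \<noteq> avert p (a, c)"
      using assms that unfolding is_path_def by auto
    then show False using path_arrow(5)[OF assms] that by metis
  qed
  have inj: "a = b" if "(a, w) \<in> ?A" "(b, w) \<in> ?A" "out p a = out p b" for a b w
  proof (rule ccontr)
    assume "a \<noteq> b"
    then have "avert p (a, w) \<noteq> avert p (b, w)"
      using assms that unfolding is_path_def by auto
    then show False using path_arrow(5)[OF assms] that by metis
  qed
  have "card (Domain ?A) = card ?A"
  proof -
    have "inj_on fst ?A" using sv by (auto simp: inj_on_def)
    then show ?thesis by (simp add: card_image Domain_fst)
  qed
  moreover have "Domain ?A \<subseteq> nodes p" using dt(2) by blast
  ultimately have "\<exists>r. r \<in> nodes p - Domain ?A"
    using dt(3) by (metis Diff_eq_empty_iff add_cancel_right_right equals0I subset_antisym zero_neq_one)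
  then obtain r where r: "r \<in> nodes p" "r \<notin> Domain ?A" by blast
  \<comment> \<open>Walk from the root along an undirected path. A step against an arrow prolongs
    the chain to the root; a step along an arrow drops the first link of the chain found so
    far.\<close>
  have "(w, r) \<in> ?A\<^sup>*" if "w \<in> nodes p" for w
    using dt(4)[OF r(1) that]
  proof (induction rule: rtrancl_induct)
    case base
    then show ?case by blast
  next
    case (step y z)
    show ?case
    proof (cases "(z, y) \<in> ?A")
      case True
      then show ?thesis using step.IH by (rule converse_rtrancl_into_rtrancl)
    next
      case False
      then have yz: "(y, z) \<in> ?A" using step.hyps by blast
      then have "y \<noteq> r" using r(2) by blast
      then obtain z' where "(y, z') \<in> ?A" "(z', r) \<in> ?A\<^sup>*"
        using step.IH by (meson converse_rtranclE)
      then show ?thesis using sv yz by blast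
    qed
  qed
  then have "rooted p r"
    unfolding rooted_def single_valued_def using dt(1,2) r sv inj by blast
  then show ?thesis by (rule that)
qed

lemma path_unfolds_wft:
  assumes "is_path V E p" "rooted p r" "unfolds p \<tau>" "w \<in> nodes p"
  shows "wft (\<tau> w)"
proof -
  have "\<tau> w = t \<Longrightarrow> w \<in> nodes p \<Longrightarrow> wft t" for t w
  proof (induction t arbitrary: w rule: tr_induct)
    case (Nd e k)
    have "e = lab p w" using Nd.prems unfoldsD(1)[OF assms(3)] by fastforce
    moreover have "lab p w \<in> bigraph_edges V E"
      using assms(1) Nd.prems unfolding is_path_def by blast
    moreover have "x \<in> bsrc (lab p w) \<and> btgt (lb s) = {x} \<and> wft s" if kx: "k x = Some s" for x s
    proof -
      obtain a where a: "(a, w) \<in> arrs p" "out p a = x" "\<tau> a = s"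
        using kx Nd.prems unfoldsD(2)[OF assms(3)] by (metis tr.sel(2))
      note pa = path_arrow[OF assms(1) a(1)]
      have "wft s" using Nd.IH[OF kx a(3) pa(1)] .
      then show ?thesis using pa a unfoldsD(1)[OF assms(3) pa(1)] by simp
    qed
    ultimately show ?case unfolding wft_Nd by blast
  qed
  then show ?thesis using assms(4) by blast
qed

lemma rooted_wft_nodes:
  assumes "rooted p r" "unfolds p \<tau>" "wft (\<tau> r)" "w \<in> nodes p"
  shows "wft (\<tau> w)"
  using rootedD(6)[OF assms(1,4)]
proof (induction rule: converse_rtrancl_induct)
  case base
  then show ?case by (rule assms(3))
next
  case (step y z)
  have "kd (\<tau> z) (out p y) = Some (\<tau> y)"
    using unfoldsD(2)[OF assms(2)] step.hyps(1) rootedD(3)[OF assms(1)] by blast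
  then show ?case using wft_kid[OF step.IH] by blast
qed

text \<open>Each node except the root starts exactly one arrow, which gives the number of arrows of
  a tree; connectedness goes through the root.\<close>

lemma rooted_is_path:
  assumes p: "rooted p r" "unfolds p \<tau>" "wft (\<tau> r)"
  shows "is_path V E p"
proof -
  let ?A = "arrs p"
  note wfn = rooted_wft_nodes[OF p]
  have fin: "finite (nodes p)" and sub: "?A \<subseteq> nodes p \<times> nodes p"
    using p(1) unfolding rooted_def by blast+
  have arr: "btgt (lab p a) = {out p a}" "out p a \<in> bsrc (lab p w)" if "(a, w) \<in> ?A" for a w
  proof -
    have n: "a \<in> nodes p" "w \<in> nodes p" using sub that by auto
    then have "kd (\<tau> w) (out p a) = Some (\<tau> a)" using unfoldsD(2)[OF p(2)] that by blast
    from wft_kid[OF wfn[OF n(2)] this]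
    show "btgt (lab p a) = {out p a}" "out p a \<in> bsrc (lab p w)"
      using unfoldsD(1)[OF p(2)] n by auto
  qed
  have av: "avert p (a, w) = out p a" "btgt (lab p a) \<inter> bsrc (lab p w) = {out p a}"
    if "(a, w) \<in> ?A" for a w
    using arr[OF that] by (auto simp: avert_def)
  have "card ?A + 1 = card (nodes p)"
  proof -
    have "inj_on fst ?A" using rootedD(4)[OF p(1)] by (auto simp: inj_on_def)
    then have "card (fst ` ?A) = card ?A" by (rule card_image)
    moreover have "fst ` ?A = nodes p - {r}"
    proof
      show "fst ` ?A \<subseteq> nodes p - {r}" using sub rootedD(5)[OF p(1)] by auto
      show "nodes p - {r} \<subseteq> fst ` ?A"
      proof
        fix w
        assume w: "w \<in> nodes p - {r}"
        then obtain b where "(w, b) \<in> ?A" using rooted_parent[OF p(1)] by blast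
        then show "w \<in> fst ` ?A" by force
      qed
    qed
    ultimately show ?thesis
      using fin rootedD(2)[OF p(1)] by (metis Suc_eq_plus1 card.remove)
  qed
  moreover have "(x, y) \<in> (?A \<union> ?A\<inverse>)\<^sup>*" if "x \<in> nodes p" "y \<in> nodes p" for x y
  proof -
    have "(x, r) \<in> (?A \<union> ?A\<inverse>)\<^sup>*"
      using rootedD(6)[OF p(1) that(1)] by (meson in_rtrancl_UnI)
    moreover have "(r, y) \<in> (?A\<inverse>)\<^sup>*"
      using rootedD(6)[OF p(1) that(2)] by (simp add: rtrancl_converse)
    then have "(r, y) \<in> (?A \<union> ?A\<inverse>)\<^sup>*" by (meson in_rtrancl_UnI)
    ultimately show ?thesis by (rule rtrancl_trans)
  qed
  moreover have "a \<noteq> b \<and> (b, a) \<notin> ?A" if "(a, b) \<in> ?A" for a b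
    using rooted_wf[OF p(1)] that by (metis wf_not_refl wf_not_sym)
  ultimately have "is_dtree (nodes p) ?A"
    unfolding is_dtree_def using fin sub rootedD(2)[OF p(1)] by blast
  moreover have "lab p v \<in> bigraph_edges V E" if "v \<in> nodes p" for v
    using wft_edge[OF wfn[OF that]] unfoldsD(1)[OF p(2) that] by simp
  moreover have "card (btgt (lab p (fst a)) \<inter> bsrc (lab p (snd a))) = 1" if "a \<in> ?A" for a
    using av(2)[of "fst a" "snd a"] that by simp
  moreover have "avert p a \<noteq> avert p b" if "a \<in> ?A" "b \<in> ?A" "a \<noteq> b \<and> fst a = fst b" for a b
    using rootedD(4)[OF p(1)] that by (metis prod.collapse)
  moreover have "avert p a \<noteq> avert p b" if "a \<in> ?A" "b \<in> ?A" "a \<noteq> b \<and> snd a = snd b" for a b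
    using rootedD(7)[OF p(1)] av(1) that by (metis prod.collapse)
  ultimately show ?thesis unfolding is_path_def by blast
qed

section \<open>Trees as names for isomorphism classes of paths\<close>

definition shape :: "'v pth \<Rightarrow> 'v tr \<Rightarrow> bool" where
  "shape p t \<longleftrightarrow> (\<exists>r \<tau>. rooted p r \<and> unfolds p \<tau> \<and> \<tau> r = t)"

lemma is_path_iff: "is_path V E p \<longleftrightarrow> (\<exists>t. shape p t \<and> wft t)"
proof
  assume p: "is_path V E p"
  obtain r where r: "rooted p r" using path_rooted[OF p] .
  obtain \<tau> where "unfolds p \<tau>" using rooted_unfolds_ex[OF r] .
  then show "\<exists>t. shape p t \<and> wft t"
    using path_unfolds_wft[OF p r] r rootedD(2)[OF r] unfolding shape_def by blast
next
  assume "\<exists>t. shape p t \<and> wft t"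
  then show "is_path V E p" using rooted_is_path unfolding shape_def by blast
qed

lemma shape_piso: "shape p t \<Longrightarrow> shape q t' \<Longrightarrow> piso p q \<longleftrightarrow> t = t'"
  unfolding shape_def by (metis rooted_piso_unfolds unfolds_piso)

lemma shape_unique: "shape p t \<Longrightarrow> shape p t' \<Longrightarrow> t = t'"
  using shape_piso piso_refl by blast

definition cls :: "'v tr \<Rightarrow> 'v pth set" where
  "cls t = {p. is_path V E p \<and> shape p t}"

lemma pclass_cls: "is_path V E p \<Longrightarrow> shape p t \<Longrightarrow> pclass V E p = cls t"
  unfolding pclass_def cls_def is_path_iff by (auto dest: shape_piso)

lemma in_cls: "wft t \<Longrightarrow> p \<in> cls t \<longleftrightarrow> shape p t"
  unfolding cls_def is_path_iff by blast

section \<open>Sources, targets and weights\<close>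

lemma edge_compose:
  assumes "(I, {y}) \<in> E" "(I', J) \<in> E" "y \<in> I'"
  shows "I \<inter> (I' - {y}) = {}" "((I' - {y}) \<union> I, J) \<in> E"
proof -
  have "\<forall>e\<in>E. \<forall>e'\<in>E. snd e \<inter> fst e' \<noteq> {} \<longrightarrow>
        (\<exists>K. snd e \<inter> fst e' = {K} \<and> fst e \<inter> (fst e' - {K}) = {} \<and>
             (snd e - {K}) \<inter> snd e' = {} \<and>
             (fst e \<union> (fst e' - {K}), (snd e - {K}) \<union> snd e') \<in> E)"
    using higraph unfolding higraph_def by blast
  from bspec[OF bspec[OF this assms(1)] assms(2)]
  obtain K where K: "{y} \<inter> I' = {K}" "I \<inter> (I' - {K}) = {}" "(I \<union> (I' - {K}), ({y} - {K}) \<union> J) \<in> E"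
    using assms(3) by auto
  then have "K = y" by blast
  with K show "I \<inter> (I' - {y}) = {}" "((I' - {y}) \<union> I, J) \<in> E" by (simp_all add: Un_commute)
qed

lemma bigraph_edgeD:
  assumes "e \<in> bigraph_edges V E"
  shows "(fst ` bsrc e, fst ` btgt e) \<in> E" "inj_on fst (bsrc e)" "bsrc e \<subseteq> V \<times> UNIV"
    "btgt e \<subseteq> V \<times> UNIV"
    "\<not> bboundary e \<Longrightarrow> x \<in> bsrc e \<Longrightarrow> snd x \<noteq> Stab_s"
    "\<not> bboundary e \<Longrightarrow> x \<in> btgt e \<Longrightarrow> snd x \<noteq> Unst_u"
    "bboundary e \<Longrightarrow> x \<in> bsrc e \<Longrightarrow> snd x \<noteq> Int_o"
    "bboundary e \<Longrightarrow> x \<in> btgt e \<Longrightarrow> snd x \<noteq> Int_o"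
  using assms by (auto simp: bigraph_edges_def bsrc_def btgt_def bboundary_def)

text \<open>The kids at \<open>S\<close> are absorbed into the root edge one after the other,
  \<open>A x\<close> standing for the open sources of the kid at \<open>x\<close>. Every absorption
  is one use of (Transitive); edge, injectivity and disjointness have to be carried along
  together.\<close>

lemma wft_compose_partial:
  assumes e: "e \<in> bigraph_edges V E"
    and k: "\<And>x. x \<in> S \<Longrightarrow> x \<in> bsrc e \<and> (fst ` A x, {fst x}) \<in> E \<and> inj_on fst (A x)"
    and "finite S"
  shows "(fst ` ((bsrc e - S) \<union> (\<Union>x\<in>S. A x)), fst ` btgt e) \<in> E \<and>
    inj_on fst ((bsrc e - S) \<union> (\<Union>x\<in>S. A x)) \<and>
    (\<forall>x\<in>S. A x \<inter> (bsrc e - {x}) = {}) \<and> (\<forall>x\<in>S. \<forall>y\<in>S. x \<noteq> y \<longrightarrow> A x \<inter> A y = {})"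
  using \<open>finite S\<close> k
proof (induction S)
  case empty
  then show ?case using bigraph_edgeD[OF e] by simp
next
  case (insert y S)
  let ?C = "(bsrc e - S) \<union> (\<Union>x\<in>S. A x)" and ?C' = "(bsrc e - insert y S) \<union> (\<Union>x\<in>insert y S. A x)"
  have IH: "(fst ` ?C, fst ` btgt e) \<in> E" "inj_on fst ?C" "\<And>x. x \<in> S \<Longrightarrow> A x \<inter> (bsrc e - {x}) = {}"
    "\<And>x z. x \<in> S \<Longrightarrow> z \<in> S \<Longrightarrow> x \<noteq> z \<Longrightarrow> A x \<inter> A z = {}"
    using insert.IH insert.prems by auto
  have y: "y \<in> bsrc e" "(fst ` A y, {fst y}) \<in> E" "inj_on fst (A y)" using insert.prems by auto
  have disj_fst: "fst ` A x \<inter> (fst ` bsrc e - {fst x}) = {}" if "x \<in> insert y S" for x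
    using edge_compose(1)[OF _ bigraph_edgeD(1)[OF e]] insert.prems[OF that] by blast
  \<comment> \<open>(Transitive) speaks about \<open>V\<close>. Injectivity of the projection on
    \<open>bsrc e\<close> lifts its disjointness to bigraph vertices.\<close>
  have disj: "A x \<inter> (bsrc e - {x}) = {}" if "x \<in> insert y S" for x
  proof -
    have "z = x" if "z \<in> A x" "z \<in> bsrc e" for z
    proof -
      have "fst z = fst x" using disj_fst[OF \<open>x \<in> insert y S\<close>] that by blast
      then show ?thesis using bigraph_edgeD(2)[OF e] that insert.prems[OF \<open>x \<in> insert y S\<close>]
        by (auto dest: inj_onD)
    qed
    then show ?thesis by blast
  qed
  \<comment> \<open>The next kid is composed with the edge accumulated so far, of which
    \<open>y\<close> is still a source.\<close>
  have yC: "y \<in> ?C" using y insert.hyps by blast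
  note comp = edge_compose[OF y(2) IH(1) imageI[OF yC]]
  have fC: "fst ` ?C - {fst y} = fst ` (?C - {y})"
    using inj_on_image_set_diff[OF IH(2), of ?C "{y}"] yC by auto
  have C': "?C' = (?C - {y}) \<union> A y"
  proof -
    have "y \<notin> A x" if "x \<in> S" for x using disj[of x] that y insert.hyps by blast
    then show ?thesis by blast
  qed
  have d: "fst ` A y \<inter> fst ` (?C - {y}) = {}" using comp(1) unfolding fC .
  have "(fst ` ?C', fst ` btgt e) \<in> E"
    unfolding C' image_Un[of fst "?C - {y}"] using comp(2) unfolding fC .
  moreover have "inj_on fst ?C'"
    unfolding C' inj_on_Un using d IH(2) y(3) by (auto intro: inj_on_diff)
  moreover have "A x \<inter> A y = {}" if "x \<in> S" for x
  proof -
    have "A x \<subseteq> ?C - {y}" using disj[of x] that y insert.hyps by blast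
    then show ?thesis using d by blast
  qed
  ultimately show ?case using disj IH(4) by (simp add: Int_commute)
qed

lemma wft_kids_finite:
  assumes "wft (Nd e k)"
  shows "dom k \<subseteq> bsrc e" "finite (dom k)" "finite (bsrc e)"
proof -
  show 1: "dom k \<subseteq> bsrc e" using assms unfolding wft_Nd by blast
  show 2: "finite (bsrc e)" using assms edge_finite unfolding wft_Nd by blast
  show "finite (dom k)" using 1 2 by (rule finite_subset)
qed

text \<open>Absorbing all kids collapses a tree to one edge of the higraph. The vertex
  \<open>x\<close> is exempted from disjointness because an edge over ({K}, {K}) may source the very
  vertex that it targets.\<close>

lemma wft_compose:
  assumes "wft t"
  shows "(fst ` tsrc t, fst ` btgt (lb t)) \<in> E \<and> inj_on fst (tsrc t)"
    and "kd t x = Some s \<Longrightarrow> tsrc s \<inter> (bsrc (lb t) - {x}) = {}"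
    and "kd t x = Some s \<Longrightarrow> kd t y = Some s' \<Longrightarrow> x \<noteq> y \<Longrightarrow> tsrc s \<inter> tsrc s' = {}"
proof -
  have *: "(fst ` tsrc t, fst ` btgt (lb t)) \<in> E \<and> inj_on fst (tsrc t) \<and>
     (\<forall>x s. kd t x = Some s \<longrightarrow> tsrc s \<inter> (bsrc (lb t) - {x}) = {}) \<and>
     (\<forall>x y s s'. kd t x = Some s \<longrightarrow> kd t y = Some s' \<longrightarrow> x \<noteq> y \<longrightarrow> tsrc s \<inter> tsrc s' = {})"
    using assms
  proof (induction t rule: tr_induct)
    case (Nd e k)
    let ?A = "\<lambda>x. tsrc (the (k x))"
    have e: "e \<in> bigraph_edges V E" using Nd.prems unfolding wft_Nd by blast
    have k: "x \<in> bsrc e \<and> (fst ` ?A x, {fst x}) \<in> E \<and> inj_on fst (?A x)" if "x \<in> dom k" for x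
    proof -
      obtain s where s: "k x = Some s" using \<open>x \<in> dom k\<close> by blast
      have "x \<in> bsrc e \<and> btgt (lb s) = {x} \<and> wft s"
        using Nd.prems s unfolding wft_Nd by blast
      then show ?thesis using Nd.IH[OF s] s by simp
    qed
    have "(bsrc e - dom k) \<union> (\<Union>x\<in>dom k. ?A x) = tsrc (Nd e k)"
    proof -
      have "(\<Union>x\<in>dom k. ?A x) = (\<Union>s\<in>ran k. tsrc s)"
      proof
        show "(\<Union>x\<in>dom k. ?A x) \<subseteq> (\<Union>s\<in>ran k. tsrc s)" by (force intro: ranI)
        show "(\<Union>s\<in>ran k. tsrc s) \<subseteq> (\<Union>x\<in>dom k. ?A x)" unfolding ran_def by force
      qed
      then show ?thesis unfolding tsrc_Nd by simp
    qed
    with wft_compose_partial[OF e k wft_kids_finite(2)[OF Nd.prems]]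
    have 1: "(fst ` tsrc (Nd e k), fst ` btgt e) \<in> E \<and> inj_on fst (tsrc (Nd e k)) \<and>
      (\<forall>x\<in>dom k. ?A x \<inter> (bsrc e - {x}) = {}) \<and>
      (\<forall>x\<in>dom k. \<forall>y\<in>dom k. x \<noteq> y \<longrightarrow> ?A x \<inter> ?A y = {})"
      by simp
    then have a: "tsrc s \<inter> (bsrc e - {x}) = {}" if "k x = Some s" for x s
      using that by (metis domI option.sel)
    have b: "tsrc s \<inter> tsrc s' = {}" if "k x = Some s" "k y = Some s'" "x \<noteq> y" for x y s s'
      using 1 that by (metis domI option.sel)
    show ?case
      unfolding tr.sel by (intro conjI allI impI conjunct1[OF 1] conjunct1[OF conjunct2[OF 1]]) (fact a b)+
  qed
  then show "(fst ` tsrc t, fst ` btgt (lb t)) \<in> E \<and> inj_on fst (tsrc t)" by blast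
  from * show "kd t x = Some s \<Longrightarrow> tsrc s \<inter> (bsrc (lb t) - {x}) = {}" by blast
  from * show "kd t x = Some s \<Longrightarrow> kd t y = Some s' \<Longrightarrow> x \<noteq> y \<Longrightarrow> tsrc s \<inter> tsrc s' = {}" by blast
qed

section \<open>Source, target and weight of a path read off its tree\<close>

definition ssrc :: "'v tr \<Rightarrow> 'v bvert set" where
  "ssrc t = bsrc (lb t) - dom (kd t)"

lemma ssrc_tsrc: "ssrc t \<subseteq> tsrc t"
  by (cases t) (simp add: ssrc_def tsrc_Nd)

lemma tsrc_kid: "kd t x = Some s \<Longrightarrow> tsrc s \<subseteq> tsrc t"
  by (metis subsetI tr.collapse tsrc_NdI(2))

lemma reach_tsrc:
  assumes "rooted p r" "unfolds p \<tau>" "(m, w) \<in> (arrs p)\<^sup>*"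
  shows "ssrc (\<tau> m) \<subseteq> tsrc (\<tau> w)"
  using assms(3)
proof (induction rule: rtrancl_induct)
  case base
  show ?case by (rule ssrc_tsrc)
next
  case (step y z)
  have "kd (\<tau> z) (out p y) = Some (\<tau> y)"
    using unfoldsD(2)[OF assms(2)] step.hyps(2) rootedD(3)[OF assms(1)] by blast
  then show ?case using tsrc_kid step.IH by blast
qed

text \<open>Where the chains from two such nodes meet, the vertex would be open in two siblings, or
  in a kid and in its parent edge; \<open>wft_compose\<close> excludes both. This makes the choices
  \<open>SOME w\<close> of a sourcing node in \<open>concat\<close> and \<open>refine\<close>
  determinate.\<close>

lemma source_node_unique:
  assumes p: "rooted p r" "unfolds p \<tau>" "wft (\<tau> r)"
    and "m \<in> nodes p" "m' \<in> nodes p" "x \<in> ssrc (\<tau> m)" "x \<in> ssrc (\<tau> m')"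
  shows "m = m'"
proof -
  have "\<lbrakk>\<tau> w = t; w \<in> nodes p; (m, w) \<in> (arrs p)\<^sup>*; (m', w) \<in> (arrs p)\<^sup>*\<rbrakk> \<Longrightarrow> m = m'" for w t
  proof (induction t arbitrary: w rule: tr_induct)
    case (Nd e k)
    note wf = rooted_wft_nodes[OF p Nd.prems(2)]
    have own: "n = w \<or> (\<exists>a. (a, w) \<in> arrs p \<and> (n, a) \<in> (arrs p)\<^sup>*)"
      if "(n, w) \<in> (arrs p)\<^sup>*" for n
      using that by (meson rtranclE)
    have kid: "kd (\<tau> w) (out p a) = Some (\<tau> a)" if "(a, w) \<in> arrs p" for a
      using unfoldsD(2)[OF p(2) Nd.prems(2)] that by blast
    have top: False if "(a, w) \<in> arrs p" "(n, a) \<in> (arrs p)\<^sup>*" "x \<in> ssrc (\<tau> n)" "x \<in> ssrc (\<tau> w)" for a n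
    proof -
      have "x \<in> tsrc (\<tau> a)" using reach_tsrc[OF p(1,2) that(2)] that(3) by blast
      moreover have "x \<in> bsrc (lb (\<tau> w)) - {out p a}"
        using that(4) kid[OF that(1)] by (auto simp: ssrc_def)
      ultimately show False using wft_compose(2)[OF wf kid[OF that(1)]] by blast
    qed
    show ?case
    proof (cases "m = w \<or> m' = w")
      case True
      then show ?thesis using own[OF Nd.prems(3)] own[OF Nd.prems(4)] top assms(6,7) by metis
    next
      case False
      obtain a b where a: "(a, w) \<in> arrs p" "(m, a) \<in> (arrs p)\<^sup>*"
        and b: "(b, w) \<in> arrs p" "(m', b) \<in> (arrs p)\<^sup>*"
        using False own[OF Nd.prems(3)] own[OF Nd.prems(4)] by blast
      have "x \<in> tsrc (\<tau> a)" "x \<in> tsrc (\<tau> b)"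
        using reach_tsrc[OF p(1,2)] a b assms(6,7) by blast+
      then have "out p a = out p b"
        using wft_compose(3)[OF wf kid[OF a(1)] kid[OF b(1)]] by blast
      then have "a = b" using rootedD(7)[OF p(1) a(1) b(1)] by blast
      moreover have "k (out p a) = Some (\<tau> a)" using kid[OF a(1)] Nd.prems(1) by simp
      ultimately show ?thesis using Nd.IH a b rootedD(3)[OF p(1) a(1)] by blast
    qed
  qed
  then show ?thesis using rootedD(2,6)[OF p(1)] assms(4,5) by blast
qed

lemma sourced_by_ssrc:
  assumes p: "is_path V E p" "unfolds p \<tau>" and "w \<in> nodes p"
  shows "sourced_by p w = ssrc (\<tau> w)"
proof -
  have "{avert p a |a. a \<in> arrs p \<and> snd a = w} = {out p a |a. (a, w) \<in> arrs p}"
    using path_arrow(5)[OF p(1)] by force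
  also have "\<dots> = dom (kd (\<tau> w))"
    unfolding unfolds_dom[OF p(2) assms(3)] by blast
  finally show ?thesis
    unfolding sourced_by_def ssrc_def using unfoldsD(1)[OF p(2) assms(3)] by simp
qed

text \<open>The arrow leaving a node uses up its only target, so a free target remains at the root
  alone.\<close>

lemma targeted_by_root:
  assumes p: "is_path V E p" "rooted p r" and "w \<in> nodes p"
  shows "targeted_by p w = (if w = r then btgt (lab p r) else {})"
proof (cases "w = r")
  case True
  then show ?thesis using rootedD(5)[OF p(2)] unfolding targeted_by_def by force
next
  case False
  then obtain b where b: "(w, b) \<in> arrs p" using rooted_parent[OF p(2) assms(3)] by blast
  then have "btgt (lab p w) = {avert p (w, b)}" using path_arrow(3,5)[OF p(1) b] by simp
  then show ?thesis using False b unfolding targeted_by_def by force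
qed

lemma psrc_shape:
  assumes "is_path V E p" "shape p t"
  shows "psrc p = tsrc t"
proof -
  obtain r \<tau> where p: "rooted p r" "unfolds p \<tau>" and t: "\<tau> r = t"
    using assms(2) unfolding shape_def by blast
  have psrc: "psrc p = (\<Union>w\<in>nodes p. ssrc (\<tau> w))"
    unfolding psrc_def using sourced_by_ssrc[OF assms(1) p(2)] by simp
  have sub: "(\<Union>w\<in>nodes p. ssrc (\<tau> w)) \<subseteq> tsrc t"
    using reach_tsrc[OF p] rootedD(6)[OF p(1)] t by blast
  have sup: "\<tau> w = t' \<Longrightarrow> w \<in> nodes p \<Longrightarrow> tsrc t' \<subseteq> (\<Union>w\<in>nodes p. ssrc (\<tau> w))" for t' w
  proof (induction t' arbitrary: w rule: tr_induct)
    case (Nd e k)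
    show ?case
    proof
      fix y
      assume "y \<in> tsrc (Nd e k)"
      then show "y \<in> (\<Union>w\<in>nodes p. ssrc (\<tau> w))"
      proof (cases rule: tsrc_cases)
        case 1
        then have "y \<in> ssrc (\<tau> w)" using Nd.prems by (auto simp: ssrc_def)
        then show ?thesis using Nd.prems by blast
      next
        case (2 x s)
        then obtain a where "(a, w) \<in> arrs p" "\<tau> a = s"
          using Nd.prems unfoldsD(2)[OF p(2)] by (metis tr.sel(2))
        then show ?thesis using Nd.IH[OF 2(1)] 2(2) rootedD(3)[OF p(1)] by blast
      qed
    qed
  qed
  show ?thesis unfolding psrc using sub sup[OF t rootedD(2)[OF p(1)]] by (rule subset_antisym)
qed

lemma ptgt_shape:
  assumes "is_path V E p" "shape p t"
  shows "ptgt p = btgt (lb t)"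
proof -
  obtain r \<tau> where p: "rooted p r" "unfolds p \<tau>" and t: "\<tau> r = t"
    using assms(2) unfolding shape_def by blast
  have "ptgt p = (\<Union>w\<in>nodes p. if w = r then btgt (lab p r) else {})"
    unfolding ptgt_def using targeted_by_root[OF assms(1) p(1)] by simp
  also have "\<dots> = btgt (lab p r)" using rootedD(2)[OF p(1)] by auto
  finally show ?thesis using unfoldsD(1)[OF p(2) rootedD(2)[OF p(1)]] t by simp
qed

text \<open>The nodes flowing into \<open>w\<close> are \<open>w\<close> itself and, disjointly,
  those flowing into its kids; so the sum obeys the recursion of \<open>tsum\<close>.\<close>

lemma sum_shape:
  assumes "is_path V E p" "shape p t"
  shows "(\<Sum>v\<in>nodes p. g (lab p v)) = tsum g t"
proof -
  obtain r \<tau> where p: "rooted p r" "unfolds p \<tau>" and t: "\<tau> r = t"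
    using assms(2) unfolding shape_def by blast
  let ?D = "\<lambda>w. {v. (v, w) \<in> (arrs p)\<^sup>*}"
  have sub: "?D w \<subseteq> nodes p" if "w \<in> nodes p" for w
  proof
    fix v
    assume "v \<in> ?D w"
    then show "v \<in> nodes p" using that rootedD(3)[OF p(1)] by (metis converse_rtranclE mem_Collect_eq)
  qed
  have "\<tau> w = t' \<Longrightarrow> w \<in> nodes p \<Longrightarrow> (\<Sum>v\<in>?D w. g (lab p v)) = tsum g t'" for w t'
  proof (induction t' arbitrary: w rule: tr_induct)
    case (Nd e k)
    have wf: "wft (Nd e k)"
      using path_unfolds_wft[OF assms(1) p Nd.prems(2)] Nd.prems(1) by simp
    let ?K = "{a. (a, w) \<in> arrs p}"
    have acyc: "(a, w) \<notin> (arrs p)\<^sup>*" if "(w, a) \<in> arrs p" for a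
      using rooted_wf[OF p(1)] that by (meson acyclic_def rtrancl_into_trancl2 wf_acyclic)
    have kn: "a \<in> nodes p" if "a \<in> ?K" for a using that rootedD(3)[OF p(1)] by blast
    have D: "?D w = insert w (\<Union>a\<in>?K. ?D a)"
      by (auto intro: rtrancl_into_rtrancl elim: rtranclE)
    have wn: "w \<notin> (\<Union>a\<in>?K. ?D a)"
      using rooted_wf[OF p(1)] by (auto dest!: wf_acyclic simp: acyclic_def dest: rtrancl_into_trancl1)
    \<comment> \<open>If a node flows into two siblings, single-valuedness makes one sibling flow
      into the other; since its arrow goes to \<open>w\<close>, then \<open>w\<close> would flow
      into its own kid.\<close>
    have disj: "?D a \<inter> ?D b = {}" if ab: "a \<in> ?K" "b \<in> ?K" "a \<noteq> b" for a b
    proof -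
      have "(a, b) \<in> (arrs p)\<^sup>* \<or> (b, a) \<in> (arrs p)\<^sup>*" if "v \<in> ?D a \<inter> ?D b" for v
        using that assms(1) p(1) single_valued_confluent[of "arrs p"]
        unfolding rooted_def by blast
      moreover have "(a, b) \<notin> (arrs p)\<^sup>*" if ab: "a \<in> ?K" "b \<in> ?K" "a \<noteq> b" for a b
      proof
        assume "(a, b) \<in> (arrs p)\<^sup>*"
        then obtain c where "(a, c) \<in> arrs p" "(c, b) \<in> (arrs p)\<^sup>*"
          using ab(3) by (meson converse_rtranclE)
        then have "(w, b) \<in> (arrs p)\<^sup>*" using rootedD(4)[OF p(1)] ab by blast
        then show False using wn ab by blast
      qed
      ultimately show ?thesis using ab by blast
    qed
    have fin: "finite ?K" using kn rootedD(1)[OF p(1)] by (meson finite_subset subsetI)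
    have finD: "finite (?D a)" if "a \<in> ?K" for a
      using sub[OF kn[OF that]] rootedD(1)[OF p(1)] by (rule finite_subset)
    have kid: "k (out p a) = Some (\<tau> a)" if "a \<in> ?K" for a
      using unfoldsD(2)[OF p(2) Nd.prems(2)] Nd.prems(1) that by (metis mem_Collect_eq tr.sel(2))
    have "(\<Sum>v\<in>?D w. g (lab p v)) = g (lab p w) + (\<Sum>v\<in>(\<Union>a\<in>?K. ?D a). g (lab p v))"
      unfolding D using fin finD wn by (subst sum.insert) auto
    also have "(\<Sum>v\<in>(\<Union>a\<in>?K. ?D a). g (lab p v)) = (\<Sum>a\<in>?K. \<Sum>v\<in>?D a. g (lab p v))"
      using fin finD disj by (intro sum.UNION_disjoint) auto
    also have "\<dots> = (\<Sum>a\<in>?K. tsum g (the (k (out p a))))"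
      using Nd.IH[OF kid] kn kid by (intro sum.cong) auto
    also have "\<dots> = (\<Sum>x\<in>dom k. tsum g (the (k x)))"
    proof (rule sum.reindex_bij_betw)
      show "bij_betw (out p) ?K (dom k)"
        unfolding bij_betw_def
      proof
        show "inj_on (out p) ?K" using rootedD(7)[OF p(1)] by (auto intro: inj_onI)
        show "out p ` ?K = dom k"
          using unfolds_dom[OF p(2) Nd.prems(2)] Nd.prems(1) by simp
      qed
    qed
    also have "g (lab p w) + (\<Sum>x\<in>dom k. tsum g (the (k x))) = tsum g (Nd e k)"
      using tsum_Nd[OF wft_kids_finite(3)[OF wf] wft_kids_finite(1)[OF wf]]
        unfoldsD(1)[OF p(2) Nd.prems(2)] Nd.prems(1) by simp
    finally show ?case .
  qed
  from this[OF t rootedD(2)[OF p(1)]] show ?thesis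
    using rootedD(6)[OF p(1)] sub[OF rootedD(2)[OF p(1)]]
    by (metis (no_types, lifting) mem_Collect_eq subsetI subset_antisym)
qed

end

section \<open>Products and realizability\<close>

text \<open>\<open>concat\<close> and \<open>refine\<close> give even numbers to the nodes of one
  path and odd numbers to those of the other; this split tells where a node comes from.\<close>

lemma nat_parity_cases:
  fixes n :: nat
  obtains a where "n = 2 * a" | a where "n = Suc (2 * a)"
  by (metis Suc_eq_plus1 even_two_times_div_two odd_two_times_div_two_succ)

lemma rtrancl_map:
  assumes "(x, y) \<in> R\<^sup>*" "\<And>a b. (a, b) \<in> R \<Longrightarrow> (f a, f b) \<in> S"
  shows "(f x, f y) \<in> S\<^sup>*"
  using assms(1) by (induction rule: rtrancl_induct) (auto intro: assms(2) rtrancl_into_rtrancl)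

lemma double_ne [simp]: "2 * a \<noteq> Suc (2 * b)" "Suc (2 * b) \<noteq> 2 * a" for a b :: nat
  by presburger+

context tree_higraph
begin

lemma tsrc_nodes:
  assumes "is_path V E p" "rooted p r" "unfolds p \<tau>"
  shows "tsrc (\<tau> r) = (\<Union>w\<in>nodes p. ssrc (\<tau> w))"
proof -
  have "shape p (\<tau> r)" using assms(2,3) unfolding shape_def by blast
  from psrc_shape[OF assms(1) this] show ?thesis
    unfolding psrc_def using sourced_by_ssrc[OF assms(1,3)] by simp
qed

lemma targeted_some:
  assumes "is_path V E p" "rooted p r" "x \<in> btgt (lab p r)"
  shows "(SOME w. w \<in> nodes p \<and> x \<in> targeted_by p w) = r"
  using targeted_by_root[OF assms(1,2)] rootedD(2)[OF assms(2)] assms(3)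
  by (intro some_equality) (auto split: if_splits)

lemma sourced_some:
  assumes p: "is_path V E p" "rooted p r" "unfolds p \<tau>" and "m \<in> nodes p" "x \<in> ssrc (\<tau> m)"
  shows "(SOME w. w \<in> nodes p \<and> x \<in> sourced_by p w) = m"
proof (rule some_equality)
  show "m \<in> nodes p \<and> x \<in> sourced_by p m"
    using assms sourced_by_ssrc[OF p(1,3)] by simp
  fix w
  assume w: "w \<in> nodes p \<and> x \<in> sourced_by p w"
  then have "x \<in> ssrc (\<tau> w)" using sourced_by_ssrc[OF p(1,3)] by blast
  then show "w = m"
    using source_node_unique[OF p(2,3) path_unfolds_wft[OF p rootedD(2)[OF p(2)]]] w assms(4,5) by blast
qed

text \<open>The added arrow leaves the root of \<open>p1\<close>, which alone has a free target, and
  enters the unique node of \<open>p2\<close> at which \<open>K\<close> is open.\<close>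

lemma shape_concat:
  assumes paths: "is_path V E p1" "is_path V E p2" and shapes: "shape p1 t1" "shape p2 t2"
    and K: "btgt (lb t1) = {K}" "K \<in> tsrc t2"
  shows "shape (concat p1 p2) (graft [K \<mapsto> t1] t2)"
proof -
  obtain r1 \<tau>1 where p1: "rooted p1 r1" "unfolds p1 \<tau>1" and t1: "\<tau>1 r1 = t1"
    using shapes(1) unfolding shape_def by blast
  obtain r2 \<tau>2 where p2: "rooted p2 r2" "unfolds p2 \<tau>2" and t2: "\<tau>2 r2 = t2"
    using shapes(2) unfolding shape_def by blast
  have r1: "r1 \<in> nodes p1" and r2: "r2 \<in> nodes p2" using rootedD(2) p1 p2 by blast+
  have K1: "btgt (lab p1 r1) = {K}" using unfoldsD(1)[OF p1(2) r1] t1 K(1) by simp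
  obtain v where v: "v \<in> nodes p2" "K \<in> ssrc (\<tau>2 v)"
    using tsrc_nodes[OF paths(2) p2] t2 K(2) by blast
  have uniq: "m = v" if "m \<in> nodes p2" "K \<in> ssrc (\<tau>2 m)" for m
    using source_node_unique[OF p2 path_unfolds_wft[OF paths(2) p2 r2]] that v by blast
  have TK: "(THE K. ptgt p1 \<inter> psrc p2 = {K}) = K"
    using psrc_shape[OF paths(2) shapes(2)] ptgt_shape[OF paths(1) shapes(1)] K by simp
  define c where "c = concat p1 p2"
  have c: "c = \<lparr>nodes = (\<lambda>n. 2 * n) ` nodes p1 \<union> (\<lambda>m. 2 * m + 1) ` nodes p2,
          arrs = {(2 * a, 2 * b) | a b. (a, b) \<in> arrs p1}
               \<union> {(2 * a + 1, 2 * b + 1) | a b. (a, b) \<in> arrs p2} \<union> {(2 * r1, 2 * v + 1)},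
          lab = (\<lambda>n. if even n then lab p1 (n div 2) else lab p2 (n div 2))\<rparr>"
    unfolding c_def concat_def Let_def TK sourced_some[OF paths(2) p2 v]
    using targeted_some[OF paths(1) p1(1)] K1 by simp
  have nd [simp]: "2 * a \<in> nodes c \<longleftrightarrow> a \<in> nodes p1" "Suc (2 * b) \<in> nodes c \<longleftrightarrow> b \<in> nodes p2" for a b
    unfolding c by auto
  have ar [simp]: "(2 * a, 2 * b) \<in> arrs c \<longleftrightarrow> (a, b) \<in> arrs p1"
    "(Suc (2 * a), Suc (2 * b)) \<in> arrs c \<longleftrightarrow> (a, b) \<in> arrs p2"
    "(2 * a, Suc (2 * b)) \<in> arrs c \<longleftrightarrow> a = r1 \<and> b = v"
    "(Suc (2 * a), 2 * b) \<notin> arrs c" for a b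
    unfolding c by auto
  have lab [simp]: "lab c (2 * a) = lab p1 a" "lab c (Suc (2 * a)) = lab p2 a" for a
    unfolding c by auto
  have out [simp]: "out c (2 * a) = out p1 a" "out c (Suc (2 * a)) = out p2 a" for a
    by (simp_all add: out_def)
  have outK: "out p1 r1 = K" using K1 by (simp add: out_def)
  \<comment> \<open>\<open>K\<close> is open at \<open>v\<close>, so the new arrow does not collide
    with an arrow already entering \<open>v\<close>.\<close>
  have notK: "out p2 a \<noteq> K" if "(a, v) \<in> arrs p2" for a
    using v(2) that unfolding ssrc_def unfolds_dom[OF p2(2) v(1)] by blast
  have "finite (nodes c)" unfolding c using rootedD(1) p1 p2 by auto
  moreover have "arrs c \<subseteq> nodes c \<times> nodes c"
  proof clarify
    fix x y
    assume "(x, y) \<in> arrs c"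
    then show "x \<in> nodes c \<and> y \<in> nodes c"
      using rootedD(3)[OF p1(1)] rootedD(3)[OF p2(1)] r1 v(1)
      by (cases x rule: nat_parity_cases; cases y rule: nat_parity_cases) auto
  qed
  moreover have "single_valued (arrs c)"
  proof (rule single_valuedI)
    fix x y z
    assume "(x, y) \<in> arrs c" "(x, z) \<in> arrs c"
    then show "y = z"
      using rootedD(4)[OF p1(1)] rootedD(4)[OF p2(1)] rootedD(5)[OF p1(1)]
      by (cases x rule: nat_parity_cases; cases y rule: nat_parity_cases; cases z rule: nat_parity_cases) auto
  qed
  moreover have "Suc (2 * r2) \<notin> Domain (arrs c)"
  proof
    assume "Suc (2 * r2) \<in> Domain (arrs c)"
    then obtain y where "(Suc (2 * r2), y) \<in> arrs c" by blast
    then show False using rootedD(5)[OF p2(1)] by (cases y rule: nat_parity_cases) auto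
  qed
  moreover have "(x, Suc (2 * r2)) \<in> (arrs c)\<^sup>*" if "x \<in> nodes c" for x
  proof -
    have odd: "(Suc (2 * b), Suc (2 * r2)) \<in> (arrs c)\<^sup>*" if "b \<in> nodes p2" for b
      using rtrancl_map[OF rootedD(6)[OF p2(1) that], of "\<lambda>a. Suc (2 * a)" "arrs c"] by simp
    show ?thesis
    proof (cases x rule: nat_parity_cases)
      case (1 a)
      then have "(2 * a, 2 * r1) \<in> (arrs c)\<^sup>*"
        using rtrancl_map[OF rootedD(6)[OF p1(1)], of a "\<lambda>a. 2 * a" "arrs c"] that by simp
      moreover have "(2 * r1, Suc (2 * v)) \<in> arrs c" by simp
      ultimately show ?thesis using odd[OF v(1)] 1
        by (meson converse_rtrancl_into_rtrancl rtrancl_trans)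
    next
      case (2 b)
      then show ?thesis using odd that by simp
    qed
  qed
  moreover have "x = y" if "(x, w) \<in> arrs c" "(y, w) \<in> arrs c" "out c x = out c y" for x y w
    using that rootedD(7)[OF p1(1)] rootedD(7)[OF p2(1)] outK notK
    by (cases x rule: nat_parity_cases; cases y rule: nat_parity_cases; cases w rule: nat_parity_cases) auto
  ultimately have "rooted c (Suc (2 * r2))"
    unfolding rooted_def using r2 by auto
  \<comment> \<open>Grafting at every node of \<open>p2\<close> is harmless: a subtree off the way
    from \<open>v\<close> to the root does not have \<open>K\<close> open.\<close>
  moreover have "unfolds c (\<lambda>n. if even n then \<tau>1 (n div 2) else graft [K \<mapsto> t1] (\<tau>2 (n div 2)))"
    (is "unfolds c ?\<tau>")
    unfolding unfolds_def
  proof (intro ballI conjI allI)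
    fix w x s
    assume w: "w \<in> nodes c"
    show "lb (?\<tau> w) = lab c w"
      using w unfoldsD(1)[OF p1(2)] unfoldsD(1)[OF p2(2)] by (cases w rule: nat_parity_cases) auto
    show "(kd (?\<tau> w) x = Some s) = (\<exists>a. (a, w) \<in> arrs c \<and> out c a = x \<and> ?\<tau> a = s)"
    proof (cases w rule: nat_parity_cases)
      case (1 b)
      have "(\<exists>a. (a, w) \<in> arrs c \<and> out c a = x \<and> ?\<tau> a = s) \<longleftrightarrow>
          (\<exists>a. (a, b) \<in> arrs p1 \<and> out p1 a = x \<and> \<tau>1 a = s)" (is "(\<exists>a. ?P a) = (\<exists>a. ?Q a)")
      proof
        assume "\<exists>a. ?P a"
        then obtain a where "?P a" ..
        then show "\<exists>a. ?Q a" using 1 by (cases a rule: nat_parity_cases) auto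
      next
        assume "\<exists>a. ?Q a"
        then obtain a where "?Q a" ..
        then have "?P (2 * a)" using 1 by simp
        then show "\<exists>a. ?P a" ..
      qed
      then show ?thesis using 1 w unfoldsD(2)[OF p1(2), of b x s] by simp
    next
      case (2 b)
      then have b: "b \<in> nodes p2" using w by simp
      have lb: "lb (\<tau>2 b) = lab p2 b" using unfoldsD(1)[OF p2(2) b] .
      have "(\<exists>a. (a, w) \<in> arrs c \<and> out c a = x \<and> ?\<tau> a = s) \<longleftrightarrow>
          (\<exists>a. (a, b) \<in> arrs p2 \<and> out p2 a = x \<and> graft [K \<mapsto> t1] (\<tau>2 a) = s) \<or> b = v \<and> x = K \<and> s = t1"
        (is "(\<exists>a. ?P a) = ((\<exists>a. ?Q a) \<or> ?R)")
      proof
        assume "\<exists>a. ?P a"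
        then obtain a where "?P a" ..
        then show "(\<exists>a. ?Q a) \<or> ?R" using 2 t1 outK by (cases a rule: nat_parity_cases) auto
      next
        assume "(\<exists>a. ?Q a) \<or> ?R"
        then consider a where "?Q a" | ?R by blast
        then show "\<exists>a. ?P a"
        proof cases
          case (1 a)
          then have "?P (Suc (2 * a))" using 2 by simp
          then show ?thesis ..
        next
          case 2
          then have "?P (2 * r1)" using \<open>w = Suc (2 * b)\<close> t1 outK by simp
          then show ?thesis ..
        qed
      qed
      also have "\<dots> \<longleftrightarrow> kd (graft [K \<mapsto> t1] (\<tau>2 b)) x = Some s"
      proof (cases "kd (\<tau>2 b) x")
        case None
        then have "\<not> (\<exists>a. ?Q a)" using unfolds_None[OF p2(2) b] by blast
        moreover have "b = v \<and> x = K \<longleftrightarrow> x \<in> bsrc (lb (\<tau>2 b)) \<and> x = K"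
          using None uniq[OF b] v by (auto simp: ssrc_def)
        ultimately show ?thesis using None by (auto simp: kd_graft)
      next
        case (Some u)
        then obtain a where a: "(a, b) \<in> arrs p2" "out p2 a = x" "\<tau>2 a = u"
          using unfoldsD(2)[OF p2(2) b] by blast
        then have "(\<exists>a. ?Q a) \<longleftrightarrow> graft [K \<mapsto> t1] u = s"
          using rootedD(7)[OF p2(1)] by blast
        moreover have "\<not> ?R" using a notK by blast
        ultimately show ?thesis using Some by (auto simp: kd_graft)
      qed
      finally show ?thesis using 2 by simp
    qed
  qed
  ultimately show ?thesis
    unfolding shape_def c_def[symmetric] using t2 by (intro exI[of _ "Suc (2 * r2)"] exI[of _ ?\<tau>]) simp
qed

text \<open>The kids are hung one at a time on a one-node path by \<open>concat\<close>, which
  spares an explicit numbering of the nodes of a tree.\<close>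

lemma shape_exists:
  assumes "wft t"
  shows "\<exists>p. shape p t"
  using assms
proof (induction t rule: tr_induct)
  case (Nd e k)
  have sub: "wft (Nd e (k |` S))" for S
    using Nd.prems unfolding wft_Nd by (auto simp: restrict_map_def split: if_splits)
  have "\<exists>p. shape p (Nd e (k |` S))" if "finite S" "S \<subseteq> dom k" for S
    using that
  proof (induction S)
    case empty
    let ?p = "\<lparr>nodes = {0}, arrs = {}, lab = (\<lambda>_. e)\<rparr> :: 'v pth"
    have "rooted ?p 0" by (simp add: rooted_def single_valued_def)
    moreover have "unfolds ?p (\<lambda>_. Nd e Map.empty)" by (simp add: unfolds_def)
    ultimately show ?case unfolding shape_def by auto
  next
    case (insert y S)
    then obtain p2 where p2: "shape p2 (Nd e (k |` S))" by blast
    obtain s where s: "k y = Some s" using insert.prems by blast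
    have sy: "y \<in> bsrc e" "btgt (lb s) = {y}" "wft s" using Nd.prems s unfolding wft_Nd by blast+
    obtain p1 where p1: "shape p1 s" using Nd.IH[OF s sy(3)] by blast
    have "y \<in> tsrc (Nd e (k |` S))"
      using sy(1) insert.hyps by (intro tsrc_NdI(1)) simp_all
    then have "shape (concat p1 p2) (graft [y \<mapsto> s] (Nd e (k |` S)))"
      using shape_concat[OF _ _ p1 p2 sy(2)] p1 p2 sy(3) sub is_path_iff by blast
    moreover have "graft [y \<mapsto> s] (Nd e (k |` S)) = Nd e (k |` insert y S)"
    proof -
      \<comment> \<open>Kids attached earlier do not have \<open>y\<close> among their open sources,
        so the graft happens at the root.\<close>
      have "graft [y \<mapsto> s] u = u" if "x \<in> S" "k x = Some u" for x u
      proof -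
        have "tsrc u \<inter> (bsrc e - {x}) = {}" using wft_compose(2)[OF Nd.prems, of x u] that(2) by simp
        then have "y \<notin> tsrc u" using that(1) insert.hyps sy(1) by blast
        then show ?thesis by (intro graft_idle) simp
      qed
      then have "(case map_option (graft [y \<mapsto> s]) ((k |` S) x) of Some s \<Rightarrow> Some s
          | None \<Rightarrow> if x \<in> bsrc e then [y \<mapsto> s] x else None) = (k |` insert y S) x" for x
        using s sy(1) insert.hyps by (cases "x \<in> S"; cases "k x") (auto simp: restrict_map_def)
      then show ?thesis by simp
    qed
    ultimately show ?case by metis
  qed
  moreover have "k |` dom k = k" by (rule ext) (simp add: restrict_map_def domIff)
  ultimately show ?case using wft_kids_finite(2)[OF Nd.prems] by (metis subset_refl)
qed

lemma rep_cls:
  assumes "wft t"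
  shows "is_path V E (rep (cls t))" "shape (rep (cls t)) t"
proof -
  obtain p where "p \<in> cls t" using shape_exists[OF assms] in_cls[OF assms] by blast
  then have "rep (cls t) \<in> cls t" unfolding rep_def by (rule someI)
  then show "is_path V E (rep (cls t))" "shape (rep (cls t)) t" unfolding cls_def by auto
qed

lemma cls_inject: "wft t \<Longrightarrow> wft t' \<Longrightarrow> cls t = cls t' \<longleftrightarrow> t = t'"
  using rep_cls shape_unique by metis

lemma pclasses_eq: "pclasses V E = cls ` {t. wft t}"
proof
  show "pclasses V E \<subseteq> cls ` {t. wft t}"
    unfolding pclasses_def using pclass_cls is_path_iff by blast
  show "cls ` {t. wft t} \<subseteq> pclasses V E"
  proof
    fix X
    assume "X \<in> cls ` {t. wft t}"
    then obtain t where t: "wft t" "X = cls t" by blast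
    then have "X = pclass V E (rep (cls t))" using pclass_cls[OF rep_cls[OF t(1)]] by simp
    then show "X \<in> pclasses V E" unfolding pclasses_def using rep_cls(1)[OF t(1)] by blast
  qed
qed

end

section \<open>Refinements\<close>

text \<open>One non-zero refinement: the conditions on source and target of \<open>q\<close> are
  those under which the refinement does not vanish. \<open>\<tau>\<close> and
  \<open>\<sigma>\<close> unfold the path and the replacement.\<close>

locale refinement = tree_higraph V E for V :: "'v set" and E :: "'v hedge set" +
  fixes p q c :: "'v pth" and r v rq :: nat and \<tau> \<sigma> :: "nat \<Rightarrow> 'v tr"
  assumes p: "is_path V E p" "rooted p r" "unfolds p \<tau>" and v: "v \<in> nodes p"
    and q: "is_path V E q" "rooted q rq" "unfolds q \<sigma>"
    and psrc_q: "psrc q = bsrc (lab p v)" and ptgt_q: "ptgt q = btgt (lab p v)"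
    and c_eq: "c = refine p v q"
begin

lemma rq: "rq \<in> nodes q"
  by (rule rootedD(2)[OF q(2)])

lemma shape_q: "shape q (\<sigma> rq)"
  using q(2,3) unfolding shape_def by blast

lemma tsrc_q: "tsrc (\<sigma> rq) = bsrc (lab p v)"
  using psrc_shape[OF q(1) shape_q] psrc_q by simp

lemma tgt_q: "btgt (lab q rq) = btgt (lab p v)"
  using ptgt_shape[OF q(1) shape_q] ptgt_q unfoldsD(1)[OF q(3) rq] by simp

text \<open>An arrow into \<open>v\<close> carries a source of the replaced edge. This is an open
  source of the replacement, hence open at exactly one of its nodes.\<close>

lemma entry:
  assumes "(a, v) \<in> arrs p"
  obtains m where "m \<in> nodes q" "out p a \<in> ssrc (\<sigma> m)"
    "(SOME w. w \<in> nodes q \<and> avert p (a, v) \<in> sourced_by q w) = m"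
proof -
  have "out p a \<in> tsrc (\<sigma> rq)" using path_arrow(4)[OF p(1) assms] tsrc_q by simp
  then obtain m where m: "m \<in> nodes q" "out p a \<in> ssrc (\<sigma> m)"
    using tsrc_nodes[OF q] by blast
  then show ?thesis
    using that sourced_some[OF q m] path_arrow(5)[OF p(1) assms] by simp
qed

lemma entry_unique:
  "m \<in> nodes q \<Longrightarrow> m' \<in> nodes q \<Longrightarrow> x \<in> ssrc (\<sigma> m) \<Longrightarrow> x \<in> ssrc (\<sigma> m') \<Longrightarrow> m = m'"
  by (rule source_node_unique[OF q(2,3) path_unfolds_wft[OF q rq]])

lemma exit: "(v, b) \<in> arrs p \<Longrightarrow> (SOME w. w \<in> nodes q \<and> avert p (v, b) \<in> targeted_by q w) = rq"
  using path_arrow(3,5)[OF p(1)] tgt_q by (intro targeted_some[OF q(1,2)]) auto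

lemma no_loop: "(a, a) \<notin> arrs p"
  using rooted_wf[OF p(2)] by (meson wf_not_refl)

lemma nodes_c [simp]:
  "2 * a \<in> nodes c \<longleftrightarrow> a \<in> nodes p \<and> a \<noteq> v" "Suc (2 * b) \<in> nodes c \<longleftrightarrow> b \<in> nodes q"
  unfolding c_eq refine_def by auto

lemma lab_c [simp]: "lab c (2 * a) = lab p a" "lab c (Suc (2 * a)) = lab q a"
  unfolding c_eq refine_def by auto

lemma out_c [simp]: "out c (2 * a) = out p a" "out c (Suc (2 * a)) = out q a"
  by (simp_all add: out_def)

lemma arrs_c [simp]:
  "(2 * a, 2 * b) \<in> arrs c \<longleftrightarrow> (a, b) \<in> arrs p \<and> a \<noteq> v \<and> b \<noteq> v"
  "(Suc (2 * m), Suc (2 * n)) \<in> arrs c \<longleftrightarrow> (m, n) \<in> arrs q"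
  "(2 * a, Suc (2 * m)) \<in> arrs c \<longleftrightarrow> (a, v) \<in> arrs p \<and> m \<in> nodes q \<and> out p a \<in> ssrc (\<sigma> m)"
  "(Suc (2 * m), 2 * b) \<in> arrs c \<longleftrightarrow> (v, b) \<in> arrs p \<and> m = rq"
proof -
  show "(2 * a, 2 * b) \<in> arrs c \<longleftrightarrow> (a, b) \<in> arrs p \<and> a \<noteq> v \<and> b \<noteq> v"
    "(Suc (2 * m), Suc (2 * n)) \<in> arrs c \<longleftrightarrow> (m, n) \<in> arrs q"
    unfolding c_eq refine_def by auto
  show "(Suc (2 * m), 2 * b) \<in> arrs c \<longleftrightarrow> (v, b) \<in> arrs p \<and> m = rq"
    unfolding c_eq refine_def using exit by auto
  have *: "(2 * a, Suc (2 * m)) \<in> arrs c \<longleftrightarrow>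
      (a, v) \<in> arrs p \<and> m = (SOME w. w \<in> nodes q \<and> avert p (a, v) \<in> sourced_by q w)"
    unfolding c_eq refine_def by auto
  show "(2 * a, Suc (2 * m)) \<in> arrs c \<longleftrightarrow> (a, v) \<in> arrs p \<and> m \<in> nodes q \<and> out p a \<in> ssrc (\<sigma> m)"
    (is "?P \<longleftrightarrow> ?Q")
  proof (cases "(a, v) \<in> arrs p")
    case True
    then obtain n where n: "n \<in> nodes q" "out p a \<in> ssrc (\<sigma> n)"
      "(SOME w. w \<in> nodes q \<and> avert p (a, v) \<in> sourced_by q w) = n"
      by (rule entry)
    have "m = n \<longleftrightarrow> m \<in> nodes q \<and> out p a \<in> ssrc (\<sigma> m)"
      using n(1,2) entry_unique by blast
    with * n(3) True show ?thesis by simp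
  next
    case False
    with * show ?thesis by blast
  qed
qed

lemma out_exit: "(v, b) \<in> arrs p \<Longrightarrow> out q rq = out p v"
  by (simp add: out_def tgt_q)

lemma entry_out: "(m, n) \<in> arrs q \<Longrightarrow> out q m \<notin> ssrc (\<sigma> n)"
  using unfolds_dom[OF q(3)] rootedD(3)[OF q(2)] unfolding ssrc_def by blast

definition "root_c = (if v = r then Suc (2 * rq) else 2 * r)"

lemma reach_top: "x \<in> nodes c \<Longrightarrow> (x, root_c) \<in> (arrs c)\<^sup>*"
proof -
  have up: "(Suc (2 * m), Suc (2 * rq)) \<in> (arrs c)\<^sup>*" if "m \<in> nodes q" for m
    using rtrancl_map[OF rootedD(6)[OF q(2) that], of "\<lambda>a. Suc (2 * a)" "arrs c"] by simp
  \<comment> \<open>Follow the chain in \<open>p\<close> with the root of \<open>q\<close> in the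
    place of \<open>v\<close>. A chain that enters \<open>v\<close> first runs from its entry node
    in \<open>q\<close> up to that root.\<close>
  have ev: "(if w = v then Suc (2 * rq) else 2 * w, root_c) \<in> (arrs c)\<^sup>*" if "(w, r) \<in> (arrs p)\<^sup>*" for w
    using that
  proof (induction rule: converse_rtrancl_induct)
    case base
    then show ?case by (auto simp: root_c_def)
  next
    case (step y z)
    consider "y = v" | "y \<noteq> v" "z = v" | "y \<noteq> v" "z \<noteq> v" by blast
    then show ?case
    proof cases
      case 1
      then have "z \<noteq> v" "(Suc (2 * rq), 2 * z) \<in> arrs c" using step.hyps no_loop by auto
      moreover from this have "(2 * z, root_c) \<in> (arrs c)\<^sup>*" using step.IH by simp
      ultimately have "(Suc (2 * rq), root_c) \<in> (arrs c)\<^sup>*" by (meson converse_rtrancl_into_rtrancl)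
      then show ?thesis using 1 by simp
    next
      case 2
      then have "(y, v) \<in> arrs p" using step.hyps by simp
      then obtain m where "m \<in> nodes q" "out p y \<in> ssrc (\<sigma> m)" by (rule entry)
      then have "(2 * y, Suc (2 * m)) \<in> arrs c" "(Suc (2 * m), Suc (2 * rq)) \<in> (arrs c)\<^sup>*"
        using 2 step.hyps up by auto
      then have "(2 * y, Suc (2 * rq)) \<in> (arrs c)\<^sup>*" by (rule converse_rtrancl_into_rtrancl)
      then show ?thesis using 2 step.IH by (simp add: rtrancl_trans)
    next
      case 3
      then have "(2 * y, 2 * z) \<in> arrs c" using step.hyps by simp
      moreover have "(2 * z, root_c) \<in> (arrs c)\<^sup>*" using 3 step.IH by simp
      ultimately have "(2 * y, root_c) \<in> (arrs c)\<^sup>*" by (rule converse_rtrancl_into_rtrancl)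
      then show ?thesis using 3 by simp
    qed
  qed
  assume x: "x \<in> nodes c"
  show ?thesis
  proof (cases x rule: nat_parity_cases)
    case (1 a)
    then show ?thesis using ev[OF rootedD(6)[OF p(2), of a]] x by simp
  next
    case (2 m)
    then have "(x, Suc (2 * rq)) \<in> (arrs c)\<^sup>*" using up x by simp
    then show ?thesis using ev[OF rootedD(6)[OF p(2) v]] by (simp add: rtrancl_trans)
  qed
qed

lemma rooted_c: "rooted c root_c"
proof -
  have "finite (nodes c)"
    unfolding c_eq refine_def using rootedD(1)[OF p(2)] rootedD(1)[OF q(2)] by simp
  moreover have "root_c \<in> nodes c" using rq rootedD(2)[OF p(2)] by (auto simp: root_c_def)
  moreover have "arrs c \<subseteq> nodes c \<times> nodes c"
  proof clarify
    fix x y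
    assume "(x, y) \<in> arrs c"
    then show "x \<in> nodes c \<and> y \<in> nodes c"
      using rootedD(3)[OF p(2)] rootedD(3)[OF q(2)] rq no_loop
      by (cases x rule: nat_parity_cases; cases y rule: nat_parity_cases) auto
  qed
  moreover have "single_valued (arrs c)"
  proof (rule single_valuedI)
    fix x y z
    assume "(x, y) \<in> arrs c" "(x, z) \<in> arrs c"
    then show "y = z"
      using rootedD(4)[OF p(2)] rootedD(4)[OF q(2)] rootedD(5)[OF q(2)] entry_unique
      by (cases x rule: nat_parity_cases; cases y rule: nat_parity_cases; cases z rule: nat_parity_cases)
        (simp_all, blast+)
  qed
  moreover have "root_c \<notin> Domain (arrs c)"
  proof
    assume "root_c \<in> Domain (arrs c)"
    then obtain y where "(root_c, y) \<in> arrs c" by blast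
    then show False using rootedD(5)[OF p(2)] rootedD(5)[OF q(2)]
      by (cases y rule: nat_parity_cases) (auto simp: root_c_def split: if_splits)
  qed
  moreover have "x = y" if "(x, w) \<in> arrs c" "(y, w) \<in> arrs c" "out c x = out c y" for x y w
    using that rootedD(7)[OF p(2)] rootedD(7)[OF q(2)] out_exit entry_out
    by (cases x rule: nat_parity_cases; cases y rule: nat_parity_cases; cases w rule: nat_parity_cases)
      (simp_all, metis+)
  ultimately show ?thesis
    unfolding rooted_def using reach_top by blast
qed

text \<open>Does the parity bookkeeping once: \<open>\<rho>\<close> is prescribed on the remaining
  nodes of \<open>p\<close> and \<open>\<rho>'\<close> on the nodes of \<open>q\<close>.\<close>

lemma unfolds_cI:
  assumes "\<And>w. w \<in> nodes p \<Longrightarrow> w \<noteq> v \<Longrightarrow> lb (\<rho> w) = lab p w \<and> (\<forall>x s. kd (\<rho> w) x = Some s \<longleftrightarrow>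
      (\<exists>a. (a, w) \<in> arrs p \<and> out p a = x \<and> (if a = v then \<rho>' rq else \<rho> a) = s))"
    and "\<And>m. m \<in> nodes q \<Longrightarrow> lb (\<rho>' m) = lab q m \<and> (\<forall>x s. kd (\<rho>' m) x = Some s \<longleftrightarrow>
      (\<exists>a. (a, m) \<in> arrs q \<and> out q a = x \<and> \<rho>' a = s) \<or>
      (\<exists>a. (a, v) \<in> arrs p \<and> out p a = x \<and> x \<in> ssrc (\<sigma> m) \<and> \<rho> a = s))"
  shows "unfolds c (\<lambda>n. if even n then \<rho> (n div 2) else \<rho>' (n div 2))" (is "unfolds c ?\<tau>")
  unfolding unfolds_def
proof (intro ballI conjI allI)
  fix w x s
  assume w: "w \<in> nodes c"
  show "lb (?\<tau> w) = lab c w"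
    using w assms by (cases w rule: nat_parity_cases) auto
  show "(kd (?\<tau> w) x = Some s) = (\<exists>a. (a, w) \<in> arrs c \<and> out c a = x \<and> ?\<tau> a = s)" (is "_ = (\<exists>a. ?P a)")
  proof (cases w rule: nat_parity_cases)
    case (1 b)
    then have b: "b \<in> nodes p" "b \<noteq> v" using w by auto
    let ?Q = "\<lambda>a. (a, b) \<in> arrs p \<and> out p a = x \<and> (if a = v then \<rho>' rq else \<rho> a) = s"
    have "(\<exists>a. ?P a) \<longleftrightarrow> (\<exists>a. ?Q a)"
    proof
      assume "\<exists>a. ?P a"
      then obtain a where "?P a" ..
      then show "\<exists>a. ?Q a" using 1 out_exit by (cases a rule: nat_parity_cases) auto
    next
      assume "\<exists>a. ?Q a"
      then obtain a where a: "?Q a" ..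
      have "?P (if a = v then Suc (2 * rq) else 2 * a)" using a 1 b out_exit by (cases "a = v") auto
      then show "\<exists>a. ?P a" ..
    qed
    then show ?thesis
      using assms(1)[OF b, THEN conjunct2, rule_format, of x s] 1 by (simp only: even_mult_iff even_numeral simp_thms if_True nonzero_mult_div_cancel_left zero_neq_numeral)
  next
    case (2 m)
    then have m: "m \<in> nodes q" using w by simp
    let ?Q = "\<lambda>a. (a, m) \<in> arrs q \<and> out q a = x \<and> \<rho>' a = s"
    let ?R = "\<lambda>a. (a, v) \<in> arrs p \<and> out p a = x \<and> x \<in> ssrc (\<sigma> m) \<and> \<rho> a = s"
    have "(\<exists>a. ?P a) \<longleftrightarrow> (\<exists>a. ?Q a) \<or> (\<exists>a. ?R a)"
    proof
      assume "\<exists>a. ?P a"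
      then obtain a where "?P a" ..
      then show "(\<exists>a. ?Q a) \<or> (\<exists>a. ?R a)" using 2 by (cases a rule: nat_parity_cases) auto
    next
      assume "(\<exists>a. ?Q a) \<or> (\<exists>a. ?R a)"
      then consider a where "?Q a" | a where "?R a" by blast
      then show "\<exists>a. ?P a"
      proof cases
        case (1 a)
        then have "?P (Suc (2 * a))" using 2 by simp
        then show ?thesis ..
      next
        case (2 a)
        then have "?P (2 * a)" using \<open>w = Suc (2 * m)\<close> m by auto
        then show ?thesis ..
      qed
    qed
    then show ?thesis using 2 assms(2)[OF m, THEN conjunct2, rule_format, of x s] by simp
  qed
qed

text \<open>Each subtree that entered the root passes to the node of the replacement at which its
  vertex is open. This is the simultaneous graft with the old kid map.\<close>

lemma shape_refine_root:
  assumes "v = r"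
  shows "shape c (graft (kd (\<tau> r)) (\<sigma> rq))"
proof -
  let ?M = "kd (\<tau> r)"
  have "unfolds c (\<lambda>n. if even n then \<tau> (n div 2) else graft ?M (\<sigma> (n div 2)))"
  proof (rule unfolds_cI)
    fix w
    assume w: "w \<in> nodes p" "w \<noteq> v"
    have "a \<noteq> v" if "(a, w) \<in> arrs p" for a using rootedD(5)[OF p(2)] that assms by blast
    then have "(\<exists>a. (a, w) \<in> arrs p \<and> out p a = x \<and> (if a = v then graft ?M (\<sigma> rq) else \<tau> a) = s) \<longleftrightarrow>
        (\<exists>a. (a, w) \<in> arrs p \<and> out p a = x \<and> \<tau> a = s)" for x s
      by (intro ex_cong1 conj_cong refl) simp
    then show "lb (\<tau> w) = lab p w \<and> (\<forall>x s. kd (\<tau> w) x = Some s \<longleftrightarrow>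
      (\<exists>a. (a, w) \<in> arrs p \<and> out p a = x \<and> (if a = v then graft ?M (\<sigma> rq) else \<tau> a) = s))"
      using unfoldsD[OF p(3) w(1)] by simp
  next
    fix m
    assume m: "m \<in> nodes q"
    have "kd (graft ?M (\<sigma> m)) x = Some s \<longleftrightarrow>
      (\<exists>a. (a, m) \<in> arrs q \<and> out q a = x \<and> graft ?M (\<sigma> a) = s) \<or>
      (\<exists>a. (a, v) \<in> arrs p \<and> out p a = x \<and> x \<in> ssrc (\<sigma> m) \<and> \<tau> a = s)" for x s
    proof (cases "kd (\<sigma> m) x")
      case None
      then have "x \<in> ssrc (\<sigma> m) \<longleftrightarrow> x \<in> bsrc (lb (\<sigma> m))" by (auto simp: ssrc_def)
      moreover have "\<nexists>a. (a, m) \<in> arrs q \<and> out q a = x" using unfolds_None[OF q(3) m] None by blast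
      ultimately show ?thesis
        using None unfoldsD(2)[OF p(3) v, of x s] assms by (auto simp: kd_graft)
    next
      case (Some u)
      then obtain a where a: "(a, m) \<in> arrs q" "out q a = x" "\<sigma> a = u"
        using unfoldsD(2)[OF q(3) m] by blast
      then have "(\<exists>a. (a, m) \<in> arrs q \<and> out q a = x \<and> graft ?M (\<sigma> a) = s) \<longleftrightarrow> graft ?M u = s"
        using rootedD(7)[OF q(2)] by blast
      moreover have "x \<notin> ssrc (\<sigma> m)" using Some by (auto simp: ssrc_def)
      ultimately show ?thesis using Some by (auto simp: kd_graft)
    qed
    then show "lb (graft ?M (\<sigma> m)) = lab q m \<and> (\<forall>x s. kd (graft ?M (\<sigma> m)) x = Some s \<longleftrightarrow>
      (\<exists>a. (a, m) \<in> arrs q \<and> out q a = x \<and> graft ?M (\<sigma> a) = s) \<or>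
      (\<exists>a. (a, v) \<in> arrs p \<and> out p a = x \<and> x \<in> ssrc (\<sigma> m) \<and> \<tau> a = s))"
      using unfoldsD(1)[OF q(3) m] by simp
  qed
  moreover have "root_c = Suc (2 * rq)" unfolding root_c_def using assms by simp
  ultimately show ?thesis
    unfolding shape_def using rooted_c by (intro exI conjI) (assumption+, simp)
qed

text \<open>Nothing enters the replaced node, so its replacement simply takes over its place below
  the root.\<close>

lemma shape_refine_leaf:
  assumes "(v, r) \<in> arrs p" "\<And>a. (a, v) \<notin> arrs p"
  shows "shape c (Nd (lab p r) ((kd (\<tau> r))(out p v \<mapsto> \<sigma> rq)))"
proof -
  let ?t = "Nd (lab p r) ((kd (\<tau> r))(out p v \<mapsto> \<sigma> rq))"
  define \<rho> where "\<rho> w = (if w = r then ?t else \<tau> w)" for w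
  have "v \<noteq> r" using assms(1) no_loop by blast
  have r: "r \<in> nodes p" by (rule rootedD(2)[OF p(2)])
  have "unfolds c (\<lambda>n. if even n then \<rho> (n div 2) else \<sigma> (n div 2))"
  proof (rule unfolds_cI)
    fix w
    assume w: "w \<in> nodes p" "w \<noteq> v"
    show "lb (\<rho> w) = lab p w \<and> (\<forall>x s. kd (\<rho> w) x = Some s \<longleftrightarrow>
      (\<exists>a. (a, w) \<in> arrs p \<and> out p a = x \<and> (if a = v then \<sigma> rq else \<rho> a) = s))"
    proof (cases "w = r")
      case False
      have "a \<noteq> v \<and> a \<noteq> r" if "(a, w) \<in> arrs p" for a
        using that False assms(1) rootedD(4,5)[OF p(2)] by blast
      then have "(\<exists>a. (a, w) \<in> arrs p \<and> out p a = x \<and> (if a = v then \<sigma> rq else \<rho> a) = s) \<longleftrightarrow>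
          (\<exists>a. (a, w) \<in> arrs p \<and> out p a = x \<and> \<tau> a = s)" for x s
        by (intro ex_cong1 conj_cong refl) (simp add: \<rho>_def)
      then show ?thesis using unfoldsD[OF p(3) w(1)] False by (simp add: \<rho>_def)
    next
      case True
      have ne: "a \<noteq> r" if "(a, r) \<in> arrs p" for a using that no_loop by blast
      have "(\<exists>a. (a, r) \<in> arrs p \<and> out p a = x \<and> (if a = v then \<sigma> rq else \<rho> a) = s) \<longleftrightarrow>
          (if x = out p v then \<sigma> rq = s else \<exists>a. (a, r) \<in> arrs p \<and> out p a = x \<and> \<tau> a = s)" for x s
      proof (cases "x = out p v")
        case True
        then have "(a, r) \<in> arrs p \<and> out p a = x \<longleftrightarrow> a = v" for a
          using assms(1) rootedD(7)[OF p(2)] by metis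
        then show ?thesis using True by (simp add: conj_assoc[symmetric])
      next
        case False
        then have "a \<noteq> v" if "out p a = x" for a using that by blast
        then have "(\<exists>a. (a, r) \<in> arrs p \<and> out p a = x \<and> (if a = v then \<sigma> rq else \<rho> a) = s) \<longleftrightarrow>
            (\<exists>a. (a, r) \<in> arrs p \<and> out p a = x \<and> \<tau> a = s)"
          using ne by (intro ex_cong1 conj_cong refl) (simp add: \<rho>_def)
        then show ?thesis using False by simp
      qed
      then show ?thesis using True unfoldsD(2)[OF p(3) r] by (simp add: \<rho>_def)
    qed
  next
    fix m
    assume "m \<in> nodes q"
    then show "lb (\<sigma> m) = lab q m \<and> (\<forall>x s. kd (\<sigma> m) x = Some s \<longleftrightarrow>
      (\<exists>a. (a, m) \<in> arrs q \<and> out q a = x \<and> \<sigma> a = s) \<or>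
      (\<exists>a. (a, v) \<in> arrs p \<and> out p a = x \<and> x \<in> ssrc (\<sigma> m) \<and> \<rho> a = s))"
      using unfoldsD[OF q(3)] assms(2) by blast
  qed
  moreover have "\<rho> r = ?t" by (simp add: \<rho>_def)
  moreover have "root_c = 2 * r" unfolding root_c_def using \<open>v \<noteq> r\<close> by simp
  ultimately show ?thesis
    unfolding shape_def using rooted_c by (intro exI conjI) (assumption+, simp)
qed

end

section \<open>Trees of small weight\<close>

lemma sum_eq_1_iff_nonneg:
  fixes f :: "'a \<Rightarrow> int"
  assumes "finite A" "\<And>x. x \<in> A \<Longrightarrow> f x \<ge> 0"
  shows "sum f A = 1 \<longleftrightarrow> (\<exists>x\<in>A. f x = 1 \<and> (\<forall>y\<in>A. y \<noteq> x \<longrightarrow> f y = 0))"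
proof
  assume 1: "sum f A = 1"
  then obtain x where x: "x \<in> A" "f x \<noteq> 0" by (metis sum.neutral zero_neq_one)
  have "sum f A = f x + sum f (A - {x})" using assms(1) x(1) by (rule sum.remove)
  moreover have "sum f (A - {x}) \<ge> 0" using assms(2) by (intro sum_nonneg) auto
  ultimately have "f x = 1" "sum f (A - {x}) = 0" using 1 x assms(2)[OF x(1)] by linarith+
  moreover from this have "\<forall>y\<in>A - {x}. f y = 0"
    using assms by (subst (asm) sum_nonneg_eq_0_iff) auto
  ultimately show "\<exists>x\<in>A. f x = 1 \<and> (\<forall>y\<in>A. y \<noteq> x \<longrightarrow> f y = 0)" using x(1) by blast
next
  assume "\<exists>x\<in>A. f x = 1 \<and> (\<forall>y\<in>A. y \<noteq> x \<longrightarrow> f y = 0)"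
  then obtain x where x: "x \<in> A" "f x = 1" "\<forall>y\<in>A - {x}. f y = 0" by blast
  then show "sum f A = 1" using sum.remove[OF assms(1) x(1), of f] by simp
qed

lemma sum_eq_1_iff_pos:
  fixes f :: "'a \<Rightarrow> int"
  assumes "finite A" "\<And>x. x \<in> A \<Longrightarrow> f x \<ge> 1"
  shows "sum f A = 1 \<longleftrightarrow> (\<exists>x. A = {x} \<and> f x = 1)"
proof -
  have "f x \<ge> 0" if "x \<in> A" for x using assms(2)[OF that] by linarith
  then have *: "sum f A = 1 \<longleftrightarrow> (\<exists>x\<in>A. f x = 1 \<and> (\<forall>y\<in>A. y \<noteq> x \<longrightarrow> f y = 0))"
    by (rule sum_eq_1_iff_nonneg[OF assms(1)])
  show ?thesis
  proof
    assume "sum f A = 1"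
    then obtain x where x: "x \<in> A" "f x = 1" "\<And>y. y \<in> A \<Longrightarrow> y \<noteq> x \<Longrightarrow> f y = 0" using * by blast
    have "y = x" if y: "y \<in> A" for y using x(3)[OF y] assms(2)[OF y] by fastforce
    then show "\<exists>x. A = {x} \<and> f x = 1" using x(1,2) by blast
  next
    assume "\<exists>x. A = {x} \<and> f x = 1"
    then show "sum f A = 1" by auto
  qed
qed

lemma sum_eq_0_iff_pos:
  fixes f :: "'a \<Rightarrow> int"
  assumes "finite A" "\<And>x. x \<in> A \<Longrightarrow> f x \<ge> 1"
  shows "sum f A = 0 \<longleftrightarrow> A = {}"
proof -
  have "f x \<ge> 0" if "x \<in> A" for x using assms(2)[OF that] by linarith
  then show ?thesis
    using assms by (subst sum_nonneg_eq_0_iff) fastforce+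
qed

section \<open>Types of vertices, feeders and corollas\<close>

definition ty :: "'v bedge \<Rightarrow> vtype" where
  "ty e = snd (the_elem (btgt e))"

definition spart :: "'v bedge \<Rightarrow> 'v bvert set" where
  "spart e = {x \<in> bsrc e. snd x = Stab_s}"

definition unstable_src :: "'v tr \<Rightarrow> bool" where
  "unstable_src t \<longleftrightarrow> (\<forall>x\<in>tsrc t. snd x \<noteq> Stab_s)"

lemma unstable_src_kid: "unstable_src (Nd e k) \<Longrightarrow> k x = Some s \<Longrightarrow> unstable_src s"
  unfolding unstable_src_def using tsrc_NdI(2) by metis

lemma unstable_src_spart: "unstable_src (Nd e k) \<Longrightarrow> spart e \<subseteq> dom k"
  unfolding unstable_src_def spart_def using tsrc_NdI(1) by (metis (mono_tags, lifting) domIff mem_Collect_eq subsetI)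

definition feeder :: "'v tr \<Rightarrow> bool" where
  "feeder t \<longleftrightarrow> (\<exists>e. t = Nd e Map.empty \<and> \<not> bboundary e)"

text \<open>The target type is left open on purpose: an unstable target gives a good tree of weight
  1, a stable one a tree of weight 2 that can replace a feeder.\<close>

definition corolla :: "'v tr \<Rightarrow> bool" where
  "corolla t \<longleftrightarrow> (\<exists>e k. t = Nd e k \<and> bboundary e \<and> dom k = spart e \<and> (\<forall>s\<in>ran k. feeder s))"

lemma corolla_Nd: "corolla (Nd e k) \<longleftrightarrow> bboundary e \<and> dom k = spart e \<and> (\<forall>s\<in>ran k. feeder s)"
  unfolding corolla_def by blast

lemma corolla_Nd': "corolla (Nd e k) \<longleftrightarrow> bboundary e \<and> dom k = spart e \<and> (\<forall>x s. k x = Some s \<longrightarrow> feeder s)"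
  unfolding corolla_Nd ran_def by blast

lemma feeder_Nd: "feeder (Nd e k) \<longleftrightarrow> k = Map.empty \<and> \<not> bboundary e"
  unfolding feeder_def by blast

lemma bedge_eqI: "bboundary e = b \<Longrightarrow> bsrc e = I \<Longrightarrow> btgt e = J \<Longrightarrow> e = (b, I, J)"
  by (cases e rule: prod_cases3) (simp add: bboundary_def bsrc_def btgt_def)

lemma bedge_sel [simp]: "bboundary (b, I, J) = b" "bsrc (b, I, J) = I" "btgt (b, I, J) = J"
  unfolding bboundary_def bsrc_def btgt_def by simp_all

context tree_higraph
begin

abbreviation tw :: "'v tr \<Rightarrow> int" where
  "tw \<equiv> tsum bweight"

lemma edge_ty:
  assumes "e \<in> bigraph_edges V E"
  shows "btgt e = {the_elem (btgt e)}" "\<not> bboundary e \<Longrightarrow> ty e \<noteq> Unst_u" "bboundary e \<Longrightarrow> ty e \<noteq> Int_o"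
proof -
  show *: "btgt e = {the_elem (btgt e)}" using edge_tgt[OF assms] by (metis the_elem_eq)
  show "\<not> bboundary e \<Longrightarrow> ty e \<noteq> Unst_u" "bboundary e \<Longrightarrow> ty e \<noteq> Int_o"
    using bigraph_edgeD(6,8)[OF assms, of "the_elem (btgt e)"] * unfolding ty_def by blast+
qed

lemma ty_kid: "wft (Nd e k) \<Longrightarrow> k x = Some s \<Longrightarrow> ty (lb s) = snd x"
  unfolding wft_Nd ty_def by (metis the_elem_eq)

lemma wft_subst:
  assumes "wft (Nd e k)" "\<And>x s. k' x = Some s \<Longrightarrow> k x = Some s \<or> (x \<in> bsrc e \<and> btgt (lb s) = {x} \<and> wft s)"
  shows "wft (Nd e k')"
  using assms unfolding wft_Nd by blast

lemma tw_interior: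
  assumes "wft (Nd e k)" "\<not> bboundary e"
  shows "tw (Nd e k) = 1 + (\<Sum>x\<in>dom k. tw (the (k x)))"
  using tsum_Nd[OF wft_kids_finite(3,1)[OF assms(1)], of bweight] assms(2) by (simp add: bweight_def)

text \<open>The summand -1 that each stable source contributes to the weight of the edge is moved to
  the kid at this source. Once kids have weight at least 1, all sums here are nonnegative and the
  leading 1 or 2 is a lower bound.\<close>

lemma tw_boundary:
  assumes "wft (Nd e k)" "bboundary e" "spart e \<subseteq> dom k"
  shows "tw (Nd e k) = (if ty e = Unst_u then 1 else 2) +
    (\<Sum>x\<in>dom k - spart e. tw (the (k x))) + (\<Sum>x\<in>spart e. tw (the (k x)) - 1)"
proof -
  have e: "e \<in> bigraph_edges V E" using assms(1) unfolding wft_Nd by blast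
  have fin: "finite (dom k)" by (rule wft_kids_finite(2)[OF assms(1)])
  obtain z where z: "btgt e = {z}" using edge_tgt[OF e] .
  have "{x \<in> btgt e. snd x = Unst_u} = (if snd z = Unst_u then {z} else {})" unfolding z by auto
  then have "int (card {x \<in> btgt e. snd x = Unst_u}) = (if ty e = Unst_u then 1 else 0)"
    by (simp add: ty_def z)
  then have "bweight e = (if ty e = Unst_u then 1 else 2) - int (card (spart e))"
    using assms(2) unfolding bweight_def spart_def by simp
  moreover have "(\<Sum>x\<in>dom k. tw (the (k x))) = (\<Sum>x\<in>dom k - spart e. tw (the (k x))) + (\<Sum>x\<in>spart e. tw (the (k x)))"
    using assms(3) fin by (rule sum.subset_diff)
  moreover have "(\<Sum>x\<in>spart e. tw (the (k x)) - 1) = (\<Sum>x\<in>spart e. tw (the (k x))) - int (card (spart e))"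
    by (simp add: sum_subtractf)
  ultimately show ?thesis
    using tsum_Nd[OF wft_kids_finite(3,1)[OF assms(1)], of bweight] by simp
qed

lemma tw_pos: "wft t \<Longrightarrow> unstable_src t \<Longrightarrow> tw t \<ge> 1"
proof (induction t rule: tr_induct)
  case (Nd e k)
  have kid: "tw (the (k x)) \<ge> 1" if x: "x \<in> dom k" for x
  proof -
    obtain s where s: "k x = Some s" using x by blast
    then have "wft s" using Nd.prems(1) unfolding wft_Nd by blast
    then show ?thesis using Nd.IH[OF s] unstable_src_kid[OF Nd.prems(2) s] s by simp
  qed
  note sp = unstable_src_spart[OF Nd.prems(2)]
  show ?case
  proof (cases "bboundary e")
    case False
    have "(\<Sum>x\<in>dom k. tw (the (k x))) \<ge> 0" using kid by (intro sum_nonneg) force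
    then show ?thesis using tw_interior[OF Nd.prems(1) False] by simp
  next
    case True
    have "(\<Sum>x\<in>dom k - spart e. tw (the (k x))) \<ge> 0" using kid by (intro sum_nonneg) force
    moreover have "(\<Sum>x\<in>spart e. tw (the (k x)) - 1) \<ge> 0" using kid sp by (intro sum_nonneg) force
    ultimately show ?thesis using tw_boundary[OF Nd.prems(1) True sp] by simp
  qed
qed

lemma tw_pos_kid:
  assumes "wft (Nd e k)" "unstable_src (Nd e k)" "x \<in> dom k"
  shows "tw (the (k x)) \<ge> 1"
proof -
  obtain s where s: "k x = Some s" using assms(3) by blast
  then have "wft s" using assms(1) unfolding wft_Nd by blast
  then show ?thesis using tw_pos unstable_src_kid[OF assms(2) s] s by simp
qed

lemma unstable_src_interior:
  assumes "wft (Nd e k)" "\<not> bboundary e" "\<And>x s. k x = Some s \<Longrightarrow> unstable_src s"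
  shows "unstable_src (Nd e k)"
  unfolding unstable_src_def
proof
  fix x
  assume "x \<in> tsrc (Nd e k)"
  then show "snd x \<noteq> Stab_s"
    using assms bigraph_edgeD(5)[of e] unfolding wft_Nd unstable_src_def
    by (cases rule: tsrc_cases) blast+
qed

lemma feeder_tw:
  assumes "wft t" "feeder t"
  shows "unstable_src t" "tw t = 1"
proof -
  obtain e where e: "t = Nd e Map.empty" "\<not> bboundary e" using assms(2) unfolding feeder_def by blast
  show "unstable_src t"
    unfolding e(1) by (rule unstable_src_interior) (use e assms(1) in simp_all)
  show "tw t = 1" using tw_interior[of e Map.empty] e assms(1) by simp
qed

lemma corolla_tw:
  assumes "wft t" "corolla t"
  shows "unstable_src t" "tw t = (if ty (lb t) = Unst_u then 1 else 2)"
proof -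
  obtain e k where t: "t = Nd e k" by (cases t)
  have c: "bboundary e" "dom k = spart e" "\<And>x s. k x = Some s \<Longrightarrow> feeder s"
    using assms(2) unfolding t corolla_Nd' by blast+
  have wf: "wft s" if "k x = Some s" for x s using assms(1) that unfolding t wft_Nd by blast
  show "unstable_src t"
    unfolding unstable_src_def t
  proof
    fix x
    assume "x \<in> tsrc (Nd e k)"
    then show "snd x \<noteq> Stab_s"
    proof (cases rule: tsrc_cases)
      case 1
      then have "x \<notin> spart e" using c(2) by blast
      then show ?thesis using 1 unfolding spart_def by blast
    next
      case (2 z s)
      then show ?thesis using feeder_tw(1)[OF wf c(3)] unfolding unstable_src_def by blast
    qed
  qed
  have "(\<Sum>x\<in>spart e. tw (the (k x)) - 1) = 0"
  proof (rule sum.neutral, rule ballI)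
    fix x
    assume "x \<in> spart e"
    then obtain s where "k x = Some s" using c(2) by blast
    then show "tw (the (k x)) - 1 = 0" using feeder_tw(2)[OF wf c(3)] by simp
  qed
  then show "tw t = (if ty (lb t) = Unst_u then 1 else 2)"
    using tw_boundary[OF assms(1)[unfolded t] c(1)] c(2) unfolding t by simp
qed

text \<open>A boundary root with stable target contributes 2 already. So the root is interior, and
  its own weight 1 leaves no room for kids.\<close>

lemma tw_eq_1_stable:
  assumes "wft t" "unstable_src t" "ty (lb t) = Stab_s" "tw t = 1"
  shows "feeder t"
proof -
  obtain e k where t: "t = Nd e k" by (cases t)
  note wf = assms(1)[unfolded t] and us = assms(2)[unfolded t]
  note pos = tw_pos_kid[OF wf us] and sp = unstable_src_spart[OF us]
  have fin: "finite (dom k)" by (rule wft_kids_finite(2)[OF wf])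
  have "\<not> bboundary e"
  proof
    assume b: "bboundary e"
    have "(\<Sum>x\<in>dom k - spart e. tw (the (k x))) \<ge> 0" using pos by (intro sum_nonneg) force
    moreover have "(\<Sum>x\<in>spart e. tw (the (k x)) - 1) \<ge> 0" using pos sp by (intro sum_nonneg) force
    ultimately show False using tw_boundary[OF wf b sp] assms(3,4) unfolding t by simp
  qed
  moreover have "dom k = {}"
    using tw_interior[OF wf] sum_eq_0_iff_pos[OF fin pos] calculation assms(4) unfolding t by simp
  ultimately show ?thesis unfolding t feeder_Nd by simp
qed

text \<open>The weight equals the leading constant of \<open>tw_boundary\<close>, so both
  nonnegative sums vanish: no kid hangs at a source that is not stable, and kids at stable sources
  have weight 1.\<close>

lemma tw_kids_feeders:
  assumes wf: "wft (Nd e k)" and us: "unstable_src (Nd e k)" and b: "bboundary e"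
    and tw: "tw (Nd e k) = (if ty e = Unst_u then 1 else 2)"
  shows "corolla (Nd e k)"
proof -
  note pos = tw_pos_kid[OF wf us] and sp = unstable_src_spart[OF us]
  have fin: "finite (dom k)" by (rule wft_kids_finite(2)[OF wf])
  have 1: "(\<Sum>x\<in>dom k - spart e. tw (the (k x))) \<ge> 0" using pos by (intro sum_nonneg) force
  have 2: "(\<Sum>x\<in>spart e. tw (the (k x)) - 1) \<ge> 0" using pos sp by (intro sum_nonneg) force
  have "(\<Sum>x\<in>dom k - spart e. tw (the (k x))) = 0" "(\<Sum>x\<in>spart e. tw (the (k x)) - 1) = 0"
    using tw_boundary[OF wf b sp] tw 1 2 by auto
  note z = this
  have "dom k - spart e = {}"
    using z(1) sum_eq_0_iff_pos[of "dom k - spart e" "\<lambda>x. tw (the (k x))"] fin pos by blast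
  then have dom: "dom k = spart e" using sp by blast
  have "\<forall>x\<in>spart e. tw (the (k x)) - 1 = 0"
  proof (rule sum_nonneg_eq_0_iff[THEN iffD1, OF _ _ z(2)])
    show "finite (spart e)" using fin dom by simp
    show "tw (the (k x)) - 1 \<ge> 0" if x: "x \<in> spart e" for x
    proof -
      have "x \<in> dom k" using x dom by blast
      then show ?thesis using pos[of x] by linarith
    qed
  qed
  then have one: "tw (the (k x)) = 1" if "x \<in> spart e" for x using that by fastforce
  have "feeder s" if s: "k x = Some s" for x s
  proof (rule tw_eq_1_stable)
    have x: "x \<in> spart e" using s dom by blast
    show "wft s" using wf s unfolding wft_Nd by blast
    show "unstable_src s" by (rule unstable_src_kid[OF us s])
    show "ty (lb s) = Stab_s" using ty_kid[OF wf s] x unfolding spart_def by simp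
    show "tw s = 1" using one[OF x] s by simp
  qed
  then show ?thesis unfolding corolla_Nd' using b dom by blast
qed

text \<open>The trees of the classes in \<open>Dset\<close>. The condition on the root edge is the
  target half of goodness.\<close>

definition dtree :: "'v tr \<Rightarrow> bool" where
  "dtree t \<longleftrightarrow> wft t \<and> unstable_src t \<and> ty (lb t) \<noteq> Stab_s \<and> tw t = 1"

lemma dtree_Nd: "dtree (Nd e k) \<longleftrightarrow> wft (Nd e k) \<and>
    (\<not> bboundary e \<and> ty e = Int_o \<and> k = Map.empty \<or> corolla (Nd e k) \<and> ty e = Unst_u)"
proof
  assume "dtree (Nd e k)"
  then have wf: "wft (Nd e k)" and us: "unstable_src (Nd e k)" and ty: "ty e \<noteq> Stab_s" and tw: "tw (Nd e k) = 1"
    unfolding dtree_def by simp_all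
  have e: "e \<in> bigraph_edges V E" using wf unfolding wft_Nd by blast
  show "wft (Nd e k) \<and>
    (\<not> bboundary e \<and> ty e = Int_o \<and> k = Map.empty \<or> corolla (Nd e k) \<and> ty e = Unst_u)"
  proof (cases "bboundary e")
    case False
    then have "dom k = {}"
      using tw_interior[OF wf] sum_eq_0_iff_pos[OF wft_kids_finite(2)[OF wf] tw_pos_kid[OF wf us]] tw by simp
    moreover have "ty e = Int_o" using edge_ty(2)[OF e False] ty by (cases "ty e") auto
    ultimately show ?thesis using False wf by simp
  next
    case True
    then have "ty e = Unst_u" using edge_ty(3)[OF e True] ty by (cases "ty e") auto
    then show ?thesis using tw_kids_feeders[OF wf us True] tw wf by simp
  qed
next
  assume *: "wft (Nd e k) \<and>
    (\<not> bboundary e \<and> ty e = Int_o \<and> k = Map.empty \<or> corolla (Nd e k) \<and> ty e = Unst_u)"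
  then show "dtree (Nd e k)"
    unfolding dtree_def using feeder_tw[of "Nd e k"] corolla_tw[of "Nd e k"] feeder_Nd[of e k] by auto
qed

text \<open>Together with the corollas of stable target, these are the trees of weight 2 by which an
  interior edge of a good tree of weight 1 gets replaced.\<close>

definition inode :: "'v tr \<Rightarrow> bool" where
  "inode t \<longleftrightarrow> (\<exists>e y s. t = Nd e [y \<mapsto> s] \<and> \<not> bboundary e \<and> dtree s)"

lemma inode_tw:
  assumes "wft t" "inode t"
  shows "unstable_src t" "tw t = 2"
proof -
  obtain e y s where t: "t = Nd e [y \<mapsto> s]" "\<not> bboundary e" "dtree s"
    using assms(2) unfolding inode_def by blast
  show "unstable_src t"
    unfolding t(1)
  proof (rule unstable_src_interior)
    show "wft (Nd e [y \<mapsto> s])" "\<not> bboundary e" using t assms(1) by simp_all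
    fix x u
    assume "[y \<mapsto> s] x = Some u"
    then have "u = s" by (cases "x = y") simp_all
    then show "unstable_src u" using t(3) unfolding dtree_def by blast
  qed
  show "tw t = 2" using tw_interior[of e "[y \<mapsto> s]"] t assms(1) unfolding dtree_def by simp
qed

text \<open>The root takes 1 of the weight 2 and every kid at least 1, so there is one kid, of
  weight 1. An interior edge has no stable source, hence this kid has no stable target.\<close>

lemma tw_eq_2_interior:
  assumes wf: "wft (Nd e k)" and us: "unstable_src (Nd e k)" and i: "\<not> bboundary e" and "tw (Nd e k) = 2"
  shows "inode (Nd e k)"
proof -
  have "(\<Sum>x\<in>dom k. tw (the (k x))) = 1" using tw_interior[OF wf i] assms(4) by simp
  then obtain x where x: "dom k = {x}" "tw (the (k x)) = 1"
    using sum_eq_1_iff_pos[OF wft_kids_finite(2)[OF wf], of "\<lambda>x. tw (the (k x))"] tw_pos_kid[OF wf us] by blast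
  obtain s where s: "k x = Some s" using x(1) by blast
  have k: "k = [x \<mapsto> s]" using x(1) s by (metis dom_eq_singleton_conv option.inject fun_upd_same)
  have "x \<in> bsrc e" "wft s" "e \<in> bigraph_edges V E" using wf s unfolding wft_Nd by blast+
  then have "snd x \<noteq> Stab_s" using bigraph_edgeD(5) i by blast
  then have "dtree s"
    unfolding dtree_def using \<open>wft s\<close> unstable_src_kid[OF us s] ty_kid[OF wf s] x(2) s by simp
  then show ?thesis unfolding inode_def using k i by blast
qed

lemma tw_eq_2_stable:
  assumes "wft t" "unstable_src t" "ty (lb t) = Stab_s"
  shows "tw t = 2 \<longleftrightarrow> inode t \<or> corolla t"
proof
  assume tw: "tw t = 2"
  obtain e k where t: "t = Nd e k" by (cases t)
  show "inode t \<or> corolla t"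
  proof (cases "bboundary e")
    case True
    then show ?thesis
      using tw_kids_feeders[OF assms(1,2)[unfolded t]] assms(3) tw unfolding t by simp
  next
    case False
    then show ?thesis
      using tw_eq_2_interior[OF assms(1,2)[unfolded t]] tw unfolding t by simp
  qed
next
  assume "inode t \<or> corolla t"
  then show "tw t = 2"
  proof
    assume "inode t"
    then show ?thesis by (rule inode_tw(2)[OF assms(1)])
  next
    assume "corolla t"
    then show ?thesis using corolla_tw(2)[OF assms(1)] assms(3) by simp
  qed
qed

text \<open>By \<open>wft_compose\<close> no kid has \<open>K\<close> open, so only the root
  changes. With \<open>graft_below\<close>, this locates the one place at which a product alters a
  tree.\<close>

lemma graft_here:
  assumes "wft (Nd e k)" "K \<in> bsrc e" "k K = None"
  shows "graft [K \<mapsto> s] (Nd e k) = Nd e (k(K \<mapsto> s))"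
proof -
  have "graft [K \<mapsto> s] u = u" if u: "k x = Some u" for x u
  proof (rule graft_idle)
    have "tsrc u \<inter> (bsrc e - {x}) = {}" using wft_compose(2)[OF assms(1), of x u] u by simp
    then show "tsrc u \<inter> dom [K \<mapsto> s] = {}" using u assms(2,3) by (cases "K = x") auto
  qed
  then have "(case map_option (graft [K \<mapsto> s]) (k x) of Some s \<Rightarrow> Some s
      | None \<Rightarrow> if x \<in> bsrc e then [K \<mapsto> s] x else None) = (k(K \<mapsto> s)) x" for x
    using assms(2,3) by (cases "k x") auto
  then show ?thesis by (simp add: fun_eq_iff)
qed

lemma graft_below:
  assumes "wft (Nd e k)" "k x = Some u" "K \<in> tsrc u"
  shows "graft [K \<mapsto> s] (Nd e k) = Nd e (k(x \<mapsto> graft [K \<mapsto> s] u))"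
proof -
  have "graft [K \<mapsto> s] w = w" if w: "k z = Some w" "z \<noteq> x" for z w
  proof (rule graft_idle)
    have "tsrc w \<inter> tsrc u = {}" using wft_compose(3)[OF assms(1), of z w x u] w assms(2) by simp
    then show "tsrc w \<inter> dom [K \<mapsto> s] = {}" using assms(3) by auto
  qed
  moreover have "\<not> (K \<in> bsrc e \<and> k K = None)"
    using wft_compose(2)[OF assms(1), of x u] assms(2,3) by auto
  ultimately have "(case map_option (graft [K \<mapsto> s]) (k z) of Some s \<Rightarrow> Some s
      | None \<Rightarrow> if z \<in> bsrc e then [K \<mapsto> s] z else None) = (k(x \<mapsto> graft [K \<mapsto> s] u)) z" for z
    using assms(2) by (cases "k z") auto
  then show ?thesis by (simp add: fun_eq_iff)
qed

section \<open>Decompositions of a tree\<close>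

text \<open>Two nodes and no interior edge, written as sums so that \<open>sum_shape\<close> carries
  the condition over from paths.\<close>

definition two_boundary :: "'v tr \<Rightarrow> bool" where
  "two_boundary t \<longleftrightarrow> tsum (\<lambda>_. 1) t = 2 \<and> tsum (\<lambda>e. if bboundary e then 0 else 1) t = 0"

lemma size_pos: "wft t \<Longrightarrow> tsum (\<lambda>_. 1) t \<ge> 1"
proof (induction t rule: tr_induct)
  case (Nd e k)
  have "tsum (\<lambda>_. 1) (the (k x)) \<ge> 0" if x: "x \<in> dom k" for x
  proof -
    obtain s where s: "k x = Some s" using x by blast
    then have "wft s" using Nd.prems unfolding wft_Nd by blast
    then show ?thesis using Nd.IH[OF s] s by simp
  qed
  then have "(\<Sum>x\<in>dom k. tsum (\<lambda>_. 1) (the (k x))) \<ge> 0" by (rule sum_nonneg)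
  then show ?case using tsum_Nd[OF wft_kids_finite(3,1)[OF Nd.prems], of "\<lambda>_. 1"] by simp
qed

lemma dom_singleton: "dom k = {x} \<Longrightarrow> k x = Some s \<Longrightarrow> k = [x \<mapsto> s]"
  by (metis dom_eq_singleton_conv fun_upd_same option.inject)

lemma two_boundary_iff:
  assumes "wft t"
  shows "two_boundary t \<longleftrightarrow> (\<exists>e1 x e2. t = Nd e1 [x \<mapsto> Nd e2 Map.empty] \<and> bboundary e1 \<and> bboundary e2)"
proof
  assume tb: "two_boundary t"
  have kid: "tsum (\<lambda>_. 1) (the (k x)) \<ge> 1" if w: "wft (Nd e k)" and x: "x \<in> dom k" for e k x
  proof -
    obtain s where s: "k x = Some s" using x by blast
    then have "wft s" using w unfolding wft_Nd by blast
    then show ?thesis using size_pos s by simp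
  qed
  obtain e1 k1 where t: "t = Nd e1 k1" by (cases t)
  note wf = assms[unfolded t] and g = tsum_Nd[OF wft_kids_finite(3,1)]
  have "(\<Sum>x\<in>dom k1. tsum (\<lambda>_. 1) (the (k1 x))) = 1"
    using tb g[OF wf wf, of "\<lambda>_. 1"] unfolding two_boundary_def t by simp
  then obtain x where x: "dom k1 = {x}" "tsum (\<lambda>_. 1) (the (k1 x)) = 1"
    using sum_eq_1_iff_pos[OF wft_kids_finite(2)[OF wf], of "\<lambda>x. tsum (\<lambda>_. 1) (the (k1 x))"] kid[OF wf] by blast
  obtain s where s: "k1 x = Some s" using x(1) by blast
  obtain e2 k2 where s2: "s = Nd e2 k2" by (cases s)
  have wf2: "wft (Nd e2 k2)" using wf s unfolding s2 wft_Nd[of e1] by blast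
  have "(\<Sum>x\<in>dom k2. tsum (\<lambda>_. 1) (the (k2 x))) = 0"
    using x(2) g[OF wf2 wf2, of "\<lambda>_. 1"] unfolding s s2 by simp
  then have "dom k2 = {}"
    using sum_eq_0_iff_pos[OF wft_kids_finite(2)[OF wf2], of "\<lambda>x. tsum (\<lambda>_. 1) (the (k2 x))"] kid[OF wf2] by blast
  then have k2: "k2 = Map.empty" by simp
  have k1: "k1 = [x \<mapsto> Nd e2 Map.empty]" using dom_singleton[OF x(1) s] s2 k2 by simp
  have "tsum (\<lambda>e. if bboundary e then 0 else 1) t =
      (if bboundary e1 then 0 else 1) + (if bboundary e2 then 0 else 1)"
    using g[OF wf wf, of "\<lambda>e. if bboundary e then 0 else 1"] g[OF wf2 wf2, of "\<lambda>e. if bboundary e then 0 else 1"]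
    unfolding t k1 k2 by simp
  then have "bboundary e1 \<and> bboundary e2"
    using tb unfolding two_boundary_def by (auto split: if_splits)
  then show "\<exists>e1 x e2. t = Nd e1 [x \<mapsto> Nd e2 Map.empty] \<and> bboundary e1 \<and> bboundary e2"
    using t k1 by blast
next
  assume "\<exists>e1 x e2. t = Nd e1 [x \<mapsto> Nd e2 Map.empty] \<and> bboundary e1 \<and> bboundary e2"
  then obtain e1 x e2 where t: "t = Nd e1 [x \<mapsto> Nd e2 Map.empty]" and b: "bboundary e1" "bboundary e2" by blast
  note wf = assms[unfolded t]
  have wf2: "wft (Nd e2 Map.empty)" using wft_kid[OF wf, of x] by simp
  show "two_boundary t"
    using tsum_Nd[OF wft_kids_finite(3,1)[OF wf]] tsum_Nd[OF wft_kids_finite(3,1)[OF wf2]] b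
    unfolding two_boundary_def t by simp
qed

lemma tr_eqI: "lb t = lb u \<Longrightarrow> (\<And>x. kd t x = kd u x) \<Longrightarrow> t = u"
  by (rule tr.expand) (simp add: fun_eq_iff)

lemma corolla_feeder: "corolla (Nd e k) \<Longrightarrow> k x = Some s \<Longrightarrow> feeder s"
  unfolding corolla_Nd' by blast

section \<open>Factorizations of a fixed tree and its preimages under refinement\<close>

definition DDpairs :: "'v tr \<Rightarrow> ('v tr \<times> 'v tr) set" where
  "DDpairs t = {(t1, t2). dtree t1 \<and> dtree t2 \<and>
     (\<exists>K. btgt (lb t1) = {K} \<and> K \<in> tsrc t2 \<and> graft [K \<mapsto> t1] t2 = t)}"

text \<open>In \<open>node_at\<close> and \<open>refine_at\<close> the index \<open>None\<close> is the root and \<open>Some x\<close> the kid at \<open>x\<close>; the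
  kids of the trees in question are leaves, so no other nodes occur and nothing has to be grafted
  onto the replacement of a kid.\<close>

definition node_at :: "'v tr \<Rightarrow> 'v bvert option \<Rightarrow> 'v tr" where
  "node_at t i = (case i of None \<Rightarrow> t | Some x \<Rightarrow> the (kd t x))"

definition refine_at :: "'v tr \<Rightarrow> 'v bvert option \<Rightarrow> 'v tr \<Rightarrow> 'v tr" where
  "refine_at t i u = (case i of None \<Rightarrow> graft (kd t) u | Some x \<Rightarrow> Nd (lb t) ((kd t)(x \<mapsto> u)))"

text \<open>The condition of \<open>delta_terms\<close> on a class replacing a node with label
  \<open>e\<close>, read on trees.\<close>

definition replaces :: "'v bedge \<Rightarrow> 'v tr \<Rightarrow> bool" where
  "replaces e u \<longleftrightarrow> tsrc u = bsrc e \<and> btgt (lb u) = btgt e \<and>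
     (if \<not> bboundary e then tw u = 2 else two_boundary u)"

definition Drefinements :: "'v tr \<Rightarrow> ('v tr \<times> 'v bvert option \<times> 'v tr) set" where
  "Drefinements t = {(t', i, u). dtree t' \<and> wft u \<and> set_option i \<subseteq> dom (kd t') \<and>
     replaces (lb (node_at t' i)) u \<and> refine_at t' i u = t}"

text \<open>A corolla with an arbitrary kid at \<open>x\<close>. For stable \<open>x\<close> this
  kid takes the place of a feeder and \<open>insert x\<close> adds nothing; for unstable
  \<open>x\<close> it is an additional kid.\<close>

definition almost_corolla :: "'v bedge \<Rightarrow> ('v bvert \<Rightarrow> 'v tr option) \<Rightarrow> 'v bvert \<Rightarrow> bool" where
  "almost_corolla e k x \<longleftrightarrow> bboundary e \<and> ty e = Unst_u \<and> x \<in> bsrc e \<and> dom k = insert x (spart e) \<and>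
     (\<forall>z s. z \<noteq> x \<longrightarrow> k z = Some s \<longrightarrow> feeder s)"

lemma almost_corollaD:
  assumes "almost_corolla e k x"
  shows "bboundary e" "ty e = Unst_u" "x \<in> bsrc e" "dom k = insert x (spart e)"
    "z \<noteq> x \<Longrightarrow> k z = Some s \<Longrightarrow> feeder s"
  using assms unfolding almost_corolla_def by blast+

lemma wft_upd:
  assumes "wft (Nd e k)" "x \<in> bsrc e" "btgt (lb s) = {x}" "wft s"
  shows "wft (Nd e (k(x \<mapsto> s)))"
proof (rule wft_subst[OF assms(1)])
  fix z u
  assume "(k(x \<mapsto> s)) z = Some u"
  then show "k z = Some u \<or> (z \<in> bsrc e \<and> btgt (lb u) = {z} \<and> wft u)"
    using assms by (cases "z = x") simp_all
qed

lemma wft_leaf: "wft (Nd e k) \<Longrightarrow> wft (Nd e Map.empty)"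
  by (erule wft_subst) simp

lemma corolla_dtree: "wft t \<Longrightarrow> corolla t \<Longrightarrow> ty (lb t) = Unst_u \<Longrightarrow> dtree t"
  using dtree_Nd[of "lb t" "kd t"] by simp

text \<open>The second factor is an interior edge or a corolla; in a corolla the vertex
  \<open>K\<close> is open either at the root or at one of the feeders.\<close>

lemma DDpairs_sub:
  assumes wf: "wft (Nd e k)" and mem: "(t1, t2) \<in> DDpairs (Nd e k)"
  obtains (interior) x where "\<not> bboundary e" "ty e = Int_o" "k = [x \<mapsto> t1]" "dtree t1" "t2 = Nd e Map.empty"
  | (boundary) x where "almost_corolla e k x" "snd x = Unst_u" "k x = Some t1" "corolla t1" "t2 = Nd e (k(x := None))"
  | (stable) x e1 y where "almost_corolla e k x" "snd x = Stab_s" "k x = Some (Nd e1 [y \<mapsto> t1])"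
      "\<not> bboundary e1" "dtree t1" "t2 = Nd e (k(x \<mapsto> Nd e1 Map.empty))"
proof -
  from mem obtain K where d: "dtree t1" "dtree t2" and K: "btgt (lb t1) = {K}" "K \<in> tsrc t2"
    and g: "graft [K \<mapsto> t1] t2 = Nd e k"
    unfolding DDpairs_def by blast
  have "lb t2 = e" using g by (metis lb_graft tr.sel(1))
  then obtain k' where t2: "t2 = Nd e k'" by (cases t2) simp
  have wf2: "wft (Nd e k')" and
    alt: "\<not> bboundary e \<and> ty e = Int_o \<and> k' = Map.empty \<or> corolla (Nd e k') \<and> ty e = Unst_u"
    using d(2) unfolding t2 dtree_Nd by blast+
  from alt show thesis
  proof (elim disjE conjE)
    assume i: "\<not> bboundary e" "ty e = Int_o" "k' = Map.empty"
    have "K \<in> bsrc e" using K(2) i(3) unfolding t2 tsrc_Nd by simp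
    then have "k = [K \<mapsto> t1]" using g graft_here[OF wf2, of K t1] i(3) unfolding t2 by simp
    then show thesis using interior[of K] i d t2 by blast
  next
    assume c: "corolla (Nd e k')" and u: "ty e = Unst_u"
    from K(2) show thesis
      unfolding t2
    proof (cases rule: tsrc_cases)
      case 1
      have k: "k = k'(K \<mapsto> t1)" using g graft_here[OF wf2 1] unfolding t2 by simp
      have "k' = k(K := None)" using k 1(2) by auto
      moreover have b: "bboundary e" "dom k' = spart e" using c unfolding corolla_Nd by blast+
      \<comment> \<open>A corolla has all its stable sources filled, and a boundary edge has no
        interior vertices; only unstable sources stay open at its root.\<close>
      moreover have K_u: "snd K = Unst_u"
      proof -
        have "e \<in> bigraph_edges V E" using wf unfolding wft_Nd by blast
        then have "snd K \<noteq> Int_o" using bigraph_edgeD(7) b(1) 1(1) by blast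
        moreover have "K \<notin> spart e" using b(2) 1(2) by blast
        ultimately show ?thesis using 1(1) unfolding spart_def by (cases "snd K") auto
      qed
      moreover have "almost_corolla e k K"
        unfolding almost_corolla_def
      proof (intro conjI allI impI)
        show "dom k = insert K (spart e)" using k b(2) by simp
        fix z s
        assume "z \<noteq> K" "k z = Some s"
        then have "k' z = Some s" using k by simp
        then show "feeder s" by (rule corolla_feeder[OF c])
      qed (use b u 1 in blast)+
      moreover have "corolla t1"
      proof -
        obtain e1 k1 where t1: "t1 = Nd e1 k1" by (cases t1)
        have "ty e1 = Unst_u" using K(1) K_u unfolding t1 ty_def by simp
        then show ?thesis using d(1) unfolding t1 dtree_Nd by auto
      qed
      ultimately show thesis using boundary[of K] k t2 by simp
    next
      case (2 x s)
      then obtain e1 where s: "s = Nd e1 Map.empty" "\<not> bboundary e1"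
        using c unfolding corolla_Nd' feeder_def by blast
      have wfs: "wft (Nd e1 Map.empty)" using wf2 2(1) s unfolding wft_Nd[of e] by blast
      have "K \<in> bsrc e1" using 2(2) unfolding s tsrc_Nd by simp
      then have "graft [K \<mapsto> t1] s = Nd e1 [K \<mapsto> t1]" using graft_here[OF wfs, of K t1] s by simp
      then have k: "k = k'(x \<mapsto> Nd e1 [K \<mapsto> t1])"
        using g graft_below[OF wf2 2, of t1] unfolding t2 by simp
      have k': "k' = k(x \<mapsto> Nd e1 Map.empty)" using k 2(1) s by auto
      have b: "bboundary e" "dom k' = spart e" using c unfolding corolla_Nd by blast+
      have x: "x \<in> spart e" using 2(1) b(2) by blast
      have "almost_corolla e k x"
        unfolding almost_corolla_def
      proof (intro conjI allI impI)
        show "dom k = insert x (spart e)" using k b(2) by simp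
        show "x \<in> bsrc e" using x unfolding spart_def by blast
        fix z s
        assume "z \<noteq> x" "k z = Some s"
        then have "k' z = Some s" using k by simp
        then show "feeder s" by (rule corolla_feeder[OF c])
      qed (use b u in blast)+
      moreover have "snd x = Stab_s" using x unfolding spart_def by simp
      moreover have "k x = Some (Nd e1 [K \<mapsto> t1])" unfolding k by simp
      moreover have "t2 = Nd e (k(x \<mapsto> Nd e1 Map.empty))" unfolding t2 using k' by simp
      ultimately show thesis using stable s(2) d(1) by blast
    qed
  qed
qed

text \<open>This and the next two lemmas realize the three cases of \<open>DDpairs_sub\<close>:
  cutting the tree at the indicated arrow leaves two good trees of weight 1.\<close>

lemma DDpairs_interior:
  assumes wf: "wft (Nd e [x \<mapsto> s])" and "\<not> bboundary e" "ty e = Int_o" "dtree s"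
  shows "(s, Nd e Map.empty) \<in> DDpairs (Nd e [x \<mapsto> s])"
proof -
  have x: "x \<in> bsrc e" "btgt (lb s) = {x}" using wft_kid[OF wf, of x s] by simp_all
  have wf0: "wft (Nd e Map.empty)" using wft_leaf[OF wf] .
  then have "dtree (Nd e Map.empty)" using assms(2,3) unfolding dtree_Nd by blast
  moreover have "x \<in> tsrc (Nd e Map.empty)" using x(1) by (simp add: tsrc_Nd)
  moreover have "graft [x \<mapsto> s] (Nd e Map.empty) = Nd e [x \<mapsto> s]"
    using graft_here[OF wf0 x(1), of s] by simp
  ultimately show ?thesis unfolding DDpairs_def using assms(4) x(2) by blast
qed

lemma DDpairs_boundary:
  assumes wf: "wft (Nd e k)" and ac: "almost_corolla e k x" and "snd x = Unst_u" and s: "k x = Some s" and "corolla s"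
  shows "(s, Nd e (k(x := None))) \<in> DDpairs (Nd e k)"
proof -
  note ac = almost_corollaD[OF ac]
  have x: "x \<in> bsrc e" "btgt (lb s) = {x}" "wft s" using wf s unfolding wft_Nd[of e] by blast+
  have wf0: "wft (Nd e (k(x := None)))" by (rule wft_subst[OF wf]) (simp split: if_splits)
  have "x \<notin> spart e" using assms(3) by (simp add: spart_def)
  then have "corolla (Nd e (k(x := None)))"
    unfolding corolla_Nd' using ac by (simp split: if_splits)
  then have "dtree (Nd e (k(x := None)))" using wf0 ac(2) unfolding dtree_Nd by blast
  moreover have "dtree s" using corolla_dtree[OF x(3) assms(5)] x(2) assms(3) unfolding ty_def by simp
  moreover have "x \<in> tsrc (Nd e (k(x := None)))" using x(1) by (intro tsrc_NdI(1)) simp_all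
  moreover have "graft [x \<mapsto> s] (Nd e (k(x := None))) = Nd e k"
    using graft_here[OF wf0 x(1), of s] s by (simp add: fun_upd_idem)
  ultimately show ?thesis unfolding DDpairs_def using x(2) by blast
qed

lemma DDpairs_stable:
  assumes wf: "wft (Nd e k)" and ac: "almost_corolla e k x" and st: "snd x = Stab_s"
    and s: "k x = Some (Nd e1 [y \<mapsto> s])" and "\<not> bboundary e1" and "dtree s"
  shows "(s, Nd e (k(x \<mapsto> Nd e1 Map.empty))) \<in> DDpairs (Nd e k)"
proof -
  note ac = almost_corollaD[OF ac]
  have x: "x \<in> bsrc e" "btgt e1 = {x}" "wft (Nd e1 [y \<mapsto> s])"
    using wf s unfolding wft_Nd[of e] by (metis tr.sel(1))+
  have wf1: "wft (Nd e1 Map.empty)" using wft_leaf[OF x(3)] .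
  have y: "y \<in> bsrc e1" "btgt (lb s) = {y}" using wft_kid[OF x(3), of y s] by simp_all
  have wf0: "wft (Nd e (k(x \<mapsto> Nd e1 Map.empty)))"
    using wft_upd[OF wf x(1) _ wf1] x(2) by simp
  have "x \<in> spart e" using st x(1) by (simp add: spart_def)
  then have "corolla (Nd e (k(x \<mapsto> Nd e1 Map.empty)))"
    unfolding corolla_Nd' using ac assms(5) by (simp add: insert_absorb feeder_Nd split: if_splits)
  then have "dtree (Nd e (k(x \<mapsto> Nd e1 Map.empty)))" using wf0 ac(2) unfolding dtree_Nd by blast
  moreover have y1: "y \<in> tsrc (Nd e1 Map.empty)" using y(1) by (simp add: tsrc_Nd)
  then have "y \<in> tsrc (Nd e (k(x \<mapsto> Nd e1 Map.empty)))"
    by (rule tsrc_NdI(2)[of _ x "Nd e1 Map.empty", rotated]) simp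
  moreover have "graft [y \<mapsto> s] (Nd e (k(x \<mapsto> Nd e1 Map.empty))) = Nd e k"
    using graft_below[OF wf0, of x "Nd e1 Map.empty" y s] y1 graft_here[OF wf1 y(1), of s] s
    by (simp add: fun_upd_idem)
  ultimately show ?thesis unfolding DDpairs_def using y(2) assms(6) by blast
qed

text \<open>The edge to which \<open>t\<close> collapses. (Transitive) provides it in the higraph,
  and the types of the open sources and of the target permit the label 0.\<close>

lemma interior_composite:
  assumes "wft t" "unstable_src t" "ty (lb t) \<noteq> Unst_u"
  shows "(False, tsrc t, btgt (lb t)) \<in> bigraph_edges V E"
proof -
  have e: "lb t \<in> bigraph_edges V E" by (rule wft_edge[OF assms(1)])
  have c: "(fst ` tsrc t, fst ` btgt (lb t)) \<in> E" "inj_on fst (tsrc t)" using wft_compose(1)[OF assms(1)] by auto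
  have "E \<subseteq> Pow V \<times> Pow V" using higraph by (simp add: higraph_def)
  with c(1) have V: "fst ` tsrc t \<subseteq> V" by blast
  have "tsrc t \<subseteq> V \<times> UNIV"
  proof
    fix x
    assume "x \<in> tsrc t"
    then have "fst x \<in> V" using V by blast
    then show "x \<in> V \<times> UNIV" by (simp add: mem_Times_iff)
  qed
  moreover obtain y where y: "btgt (lb t) = {y}" using edge_tgt[OF e] .
  moreover have "snd y \<noteq> Unst_u" using assms(3) unfolding ty_def y by simp
  ultimately show ?thesis
    using c assms(2) bigraph_edgeD(4)[OF e] unfolding bigraph_edges_def unstable_src_def y by simp
qed

lemma boundary_composite:
  assumes "wft t" "\<And>x. x \<in> tsrc t \<Longrightarrow> snd x \<noteq> Int_o" "ty (lb t) \<noteq> Int_o"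
  shows "(True, tsrc t, btgt (lb t)) \<in> bigraph_edges V E"
proof -
  have e: "lb t \<in> bigraph_edges V E" by (rule wft_edge[OF assms(1)])
  have c: "(fst ` tsrc t, fst ` btgt (lb t)) \<in> E" "inj_on fst (tsrc t)" using wft_compose(1)[OF assms(1)] by auto
  have "E \<subseteq> Pow V \<times> Pow V" using higraph by (simp add: higraph_def)
  with c(1) have V: "fst ` tsrc t \<subseteq> V" by blast
  have "tsrc t \<subseteq> V \<times> UNIV"
  proof
    fix x
    assume "x \<in> tsrc t"
    then have "fst x \<in> V" using V by blast
    then show "x \<in> V \<times> UNIV" by (simp add: mem_Times_iff)
  qed
  moreover obtain y where y: "btgt (lb t) = {y}" using edge_tgt[OF e] .
  moreover have "snd y \<noteq> Int_o" using assms(3) unfolding ty_def y by simp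
  ultimately show ?thesis
    using c assms(2) bigraph_edgeD(4)[OF e] unfolding bigraph_edges_def y by simp
qed

lemma Drefinements_interior:
  assumes wf: "wft t" and "inode t" "ty (lb t) = Int_o"
  shows "(Nd (False, tsrc t, btgt (lb t)) Map.empty, None, t) \<in> Drefinements t"
proof -
  let ?e = "(False, tsrc t, btgt (lb t))"
  have "?e \<in> bigraph_edges V E"
    using interior_composite[OF wf inode_tw(1)[OF wf assms(2)]] assms(3) by simp
  then have "dtree (Nd ?e Map.empty)"
    using assms(3) unfolding dtree_Nd wft_Nd ty_def by simp
  moreover have "graft Map.empty t = t" by (rule graft_idle) simp
  ultimately show ?thesis
    unfolding Drefinements_def node_at_def refine_at_def replaces_def
    using wf inode_tw(2)[OF wf assms(2)] by simp
qed

text \<open>Collapsing the kid at \<open>x\<close> to one interior edge restores a feeder there. In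
  both cases the kid has weight 2, since its target is stable.\<close>

lemma Drefinements_stable:
  assumes wf: "wft (Nd e k)" and ac: "almost_corolla e k x" and st: "snd x = Stab_s"
    and s: "k x = Some s" and c: "inode s \<or> corolla s"
  shows "(Nd e (k(x \<mapsto> Nd (False, tsrc s, {x}) Map.empty)), Some x, s) \<in> Drefinements (Nd e k)"
proof -
  let ?e = "(False, tsrc s, {x})"
  note ac = almost_corollaD[OF ac]
  have x: "x \<in> bsrc e" "btgt (lb s) = {x}" "wft s" using wf s unfolding wft_Nd[of e] by blast+
  have ty: "ty (lb s) = Stab_s" using ty_kid[OF wf s] st by simp
  have us: "unstable_src s" using c inode_tw(1)[OF x(3)] corolla_tw(1)[OF x(3)] by blast
  have "?e \<in> bigraph_edges V E"
    using interior_composite[OF x(3) us] ty x(2) by simp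
  then have wf1: "wft (Nd ?e Map.empty)" unfolding wft_Nd by simp
  have wf0: "wft (Nd e (k(x \<mapsto> Nd ?e Map.empty)))"
    using wft_upd[OF wf x(1) _ wf1] x(2) by simp
  have "x \<in> spart e" using st x(1) by (simp add: spart_def)
  then have "corolla (Nd e (k(x \<mapsto> Nd ?e Map.empty)))"
    unfolding corolla_Nd' using ac by (simp add: insert_absorb feeder_Nd split: if_splits)
  then have "dtree (Nd e (k(x \<mapsto> Nd ?e Map.empty)))" using wf0 ac(2) unfolding dtree_Nd by blast
  moreover have "tw s = 2" using tw_eq_2_stable[OF x(3) us ty] c by blast
  ultimately show ?thesis
    unfolding Drefinements_def node_at_def refine_at_def replaces_def
    using x s by (simp add: fun_upd_idem)
qed

text \<open>The root edge and the edge of the kid merge into one boundary edge, and the feeders of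
  both become its feeders. For unstable \<open>x\<close> this preimage corresponds to a product; for
  stable \<open>x\<close> it is the partner of the one in
  \<open>Drefinements_stable\<close>.\<close>

lemma Drefinements_boundary:
  assumes wf: "wft (Nd e k)" and ac: "almost_corolla e k x" and s: "k x = Some s" and c: "corolla s"
  shows "(Nd (True, bsrc e - {x} \<union> bsrc (lb s), btgt e) (k(x := None) ++ kd s), None,
      Nd e [x \<mapsto> Nd (lb s) Map.empty]) \<in> Drefinements (Nd e k)"
proof -
  obtain e2 k2 where s2: "s = Nd e2 k2" by (cases s)
  note ac = almost_corollaD[OF ac]
  let ?u = "Nd e [x \<mapsto> Nd e2 Map.empty]" and ?I = "bsrc e - {x} \<union> bsrc e2" and ?k = "k(x := None) ++ k2"
  let ?e = "(True, ?I, btgt e)"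
  have c2: "bboundary e2" "dom k2 = spart e2" using c unfolding s2 corolla_Nd by blast+
  have feed: "feeder u" if "k2 z = Some u" for z u using corolla_feeder[OF c[unfolded s2] that] .
  have x: "x \<in> bsrc e" "btgt e2 = {x}" "wft (Nd e2 k2)"
    using wft_kid[OF wf, of x s] s s2 by simp_all
  have e: "e \<in> bigraph_edges V E" and e2: "e2 \<in> bigraph_edges V E"
    using wf x(3) unfolding wft_Nd by blast+
  have wf2: "wft (Nd e2 Map.empty)" using wft_leaf[OF x(3)] .
  have wfu: "wft ?u"
    using wft_upd[OF wft_leaf[OF wf] x(1) _ wf2] x(2) by simp
  have src2: "tsrc (Nd e2 Map.empty) = bsrc e2" by (simp add: tsrc_Nd)
  have srcu: "tsrc ?u = ?I"
    using src2 by (simp add: tsrc_Nd)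
  have disj: "bsrc e2 \<inter> (bsrc e - {x}) = {}"
    using wft_compose(2)[OF wfu, of x "Nd e2 Map.empty"] src2 by simp
  have "snd z \<noteq> Int_o" if "z \<in> ?I" for z
    using that bigraph_edgeD(7)[OF e ac(1)] bigraph_edgeD(7)[OF e2 c2(1)] by blast
  then have edge: "?e \<in> bigraph_edges V E"
    using boundary_composite[OF wfu] srcu ac(2) by simp
  have k: "?k z = (if z \<in> dom k2 then k2 z else if z = x then None else k z)" for z
    by (auto simp: map_add_def split: option.splits)
  have wfX: "wft (Nd ?e ?k)"
    unfolding wft_Nd
  proof (intro conjI allI impI)
    show "?e \<in> bigraph_edges V E" by (rule edge)
    fix z u
    assume "?k z = Some u"
    then consider "k2 z = Some u" | "z \<noteq> x" "k z = Some u"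
      unfolding k by (auto split: if_splits)
    then have "z \<in> ?I \<and> btgt (lb u) = {z} \<and> wft u"
    proof cases
      case 1
      then show ?thesis using wft_kid[OF x(3), of z u] by simp
    next
      case 2
      then show ?thesis using wft_kid[OF wf, of z u] by simp
    qed
    then show "z \<in> bsrc ?e" "btgt (lb u) = {z}" "wft u" by simp_all
  qed
  have "corolla (Nd ?e ?k)"
    unfolding corolla_Nd'
  proof (intro conjI allI impI)
    show "bboundary ?e" by simp
    have "dom ?k = (dom k - {x}) \<union> dom k2" by auto
    also have "\<dots> = (spart e - {x}) \<union> spart e2" using ac(4) c2(2) by blast
    also have "\<dots> = spart ?e" unfolding spart_def by auto
    finally show "dom ?k = spart ?e" .
    fix z u
    assume "?k z = Some u"
    then consider "k2 z = Some u" | "z \<noteq> x" "k z = Some u"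
      unfolding k by (auto split: if_splits)
    then show "feeder u" using feed ac(5) by cases blast+
  qed
  then have "dtree (Nd ?e ?k)" using wfX ac(2) unfolding dtree_Nd ty_def by simp
  moreover have "two_boundary ?u" using two_boundary_iff[OF wfu] ac(1) c2(1) by blast
  moreover have "graft ?k ?u = Nd e k"
  proof -
    \<comment> \<open>A source of \<open>e2\<close> without a kid is not stable, so \<open>e\<close>
      has no kid there either, except possibly at \<open>x\<close>, where it was removed.\<close>
    have inner: "(if z \<in> bsrc e2 then ?k z else None) = k2 z" for z
    proof (cases "z \<in> bsrc e2 \<and> z \<notin> dom k2")
      case True
      then have "z \<notin> spart e2" using c2(2) by simp
      then have "snd z \<noteq> Stab_s" using True unfolding spart_def by simp
      then have "z \<notin> spart e" unfolding spart_def by simp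
      then have "z = x \<or> z \<notin> dom k" using ac(4) by blast
      then show ?thesis using True unfolding k by auto
    next
      case False
      then show ?thesis using wft_kids_finite(1)[OF x(3)] unfolding k by (cases "k2 z") auto
    qed
    \<comment> \<open>The other sources of \<open>e\<close> are disjoint from those of
      \<open>e2\<close> and keep their own kids.\<close>
    have outer: "(if z \<in> bsrc e then ?k z else None) = k z" if z: "z \<noteq> x" for z
    proof (cases "z \<in> bsrc e")
      case True
      then have "z \<notin> dom k2" using disj z wft_kids_finite(1)[OF x(3)] by blast
      then show ?thesis using True z unfolding k by simp
    next
      case False
      then have "z \<notin> dom k" using wft_kids_finite(1)[OF wf] by blast
      then show ?thesis using False by (simp add: domIff)
    qed
    have "graft ?k (Nd e2 Map.empty) = s"
      unfolding s2 by (simp add: inner)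
    then have "kd (graft ?k ?u) z = kd (Nd e k) z" for z
      using outer[of z] s unfolding kd_graft by simp
    then show ?thesis by (rule tr_eqI[rotated]) simp
  qed
  ultimately show ?thesis
    unfolding Drefinements_def node_at_def refine_at_def replaces_def
    using wfu srcu s2 by simp
qed

text \<open>Reads a refinement backwards. \<open>replaces\<close> fixes source and target of the
  refined edge and the case fixes whether it is interior or boundary, so \<open>t'\<close> is
  determined by \<open>t\<close> and the place.\<close>

lemma Drefinements_sub:
  assumes wf: "wft (Nd e k)" and mem: "(t', i, u) \<in> Drefinements (Nd e k)"
  obtains (interior) "inode (Nd e k)" "ty e = Int_o"
      "t' = Nd (False, tsrc (Nd e k), btgt e) Map.empty" "i = None" "u = Nd e k"
  | (stable) x s where "almost_corolla e k x" "snd x = Stab_s" "k x = Some s" "inode s \<or> corolla s"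
      "t' = Nd e (k(x \<mapsto> Nd (False, tsrc s, {x}) Map.empty))" "i = Some x" "u = s"
  | (boundary) x s where "almost_corolla e k x" "k x = Some s" "corolla s"
      "t' = Nd (True, bsrc e - {x} \<union> bsrc (lb s), btgt e) (k(x := None) ++ kd s)" "i = None"
      "u = Nd e [x \<mapsto> Nd (lb s) Map.empty]"
proof -
  obtain e' k' where t': "t' = Nd e' k'" by (cases t')
  have d: "dtree (Nd e' k')" and wfu: "wft u" and i: "set_option i \<subseteq> dom k'"
    and rp: "replaces (lb (node_at t' i)) u" and eq: "refine_at t' i u = Nd e k"
    using mem unfolding Drefinements_def t' by simp_all
  have wf': "wft (Nd e' k')" and
    alt: "\<not> bboundary e' \<and> ty e' = Int_o \<and> k' = Map.empty \<or> corolla (Nd e' k') \<and> ty e' = Unst_u"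
    using d unfolding dtree_Nd by blast+
  from alt show thesis
  proof (elim disjE conjE)
    assume a: "\<not> bboundary e'" "ty e' = Int_o" "k' = Map.empty"
    then have n: "i = None" using i by (cases i) simp_all
    then have u: "u = Nd e k"
      using eq a(3) graft_idle[of u Map.empty] unfolding refine_at_def t' by simp
    have r: "tsrc u = bsrc e'" "btgt e = btgt e'" "tw u = 2"
      using rp a(1) n u unfolding replaces_def node_at_def t' by simp_all
    have us: "unstable_src (Nd e k)"
      using r(1) bigraph_edgeD(5)[of e'] a(1) wf' unfolding unstable_src_def u wft_Nd by blast
    have ty: "ty e = Int_o" using r(2) a(2) unfolding ty_def by simp
    have "e \<in> bigraph_edges V E" using wf unfolding wft_Nd by blast
    then have "\<not> bboundary e" using edge_ty(3) ty by blast
    then have "inode (Nd e k)" using tw_eq_2_interior[OF wf us] r(3) u by simp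
    moreover have "e' = (False, tsrc (Nd e k), btgt e)"
      using r u a(1) by (intro bedge_eqI) simp_all
    ultimately show thesis using interior ty t' a(3) n u by simp
  next
    assume c: "corolla (Nd e' k')" and ty: "ty e' = Unst_u"
    have b: "bboundary e'" "dom k' = spart e'" using c unfolding corolla_Nd by blast+
    show thesis
    proof (cases i)
      case (Some x)
      then obtain s0 where s0: "k' x = Some s0" using i by auto
      have k: "e = e'" "k = k'(x \<mapsto> u)" using eq unfolding refine_at_def Some t' by simp_all
      obtain e0 where e0: "s0 = Nd e0 Map.empty" "\<not> bboundary e0"
        using corolla_feeder[OF c s0] unfolding feeder_def by blast
      have x: "x \<in> spart e" using s0 b(2) k(1) by blast
      have w0: "btgt e0 = {x}" "wft s0" using wft_kid[OF wf', of x s0] s0 e0 by simp_all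
      have r: "tsrc u = bsrc e0" "btgt (lb u) = {x}" "tw u = 2"
        using rp s0 e0 w0 unfolding replaces_def node_at_def t' Some by simp_all
      have kx: "k x = Some u" using k by simp
      have us: "unstable_src u"
        using r(1) bigraph_edgeD(5)[of e0] e0(2) w0(2) unfolding unstable_src_def e0(1) wft_Nd by blast
      have st: "snd x = Stab_s" using x unfolding spart_def by simp
      have "inode u \<or> corolla u"
        using tw_eq_2_stable[OF wfu us] ty_kid[OF wf kx] r(3) st by simp
      moreover have "almost_corolla e k x"
        unfolding almost_corolla_def
      proof (intro conjI allI impI)
        show "dom k = insert x (spart e)" using k b(2) by simp
        show "x \<in> bsrc e" using x unfolding spart_def by blast
        show "bboundary e" "ty e = Unst_u" using b(1) ty k(1) by simp_all
        fix z s
        assume "z \<noteq> x" "k z = Some s"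
        then have "k' z = Some s" using k by simp
        then show "feeder s" by (rule corolla_feeder[OF c])
      qed
      moreover have "e0 = (False, tsrc u, {x})"
        using r w0 e0(2) by (intro bedge_eqI) simp_all
      then have "k' = k(x \<mapsto> Nd (False, tsrc u, {x}) Map.empty)" using k s0 e0(1) by auto
      ultimately show thesis using stable[of x u] st kx t' k(1) Some by simp
    next
      case None
      have r: "tsrc u = bsrc e'" "btgt (lb u) = btgt e'" "two_boundary u"
        using rp b(1) unfolding replaces_def node_at_def t' None by simp_all
      obtain e1 x e2 where u: "u = Nd e1 [x \<mapsto> Nd e2 Map.empty]" and bd: "bboundary e1" "bboundary e2"
        using r(3) two_boundary_iff[OF wfu] by blast
      have g: "graft k' u = Nd e k" using eq unfolding refine_at_def t' None by simp
      have e1: "e1 = e" using arg_cong[OF g, of lb] u by simp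
      \<comment> \<open>The kid at \<open>x\<close> after the refinement: the lower of the two new
        nodes with the feeders it inherits from \<open>k'\<close>.\<close>
      define s where "s = graft k' (Nd e2 Map.empty)"
      obtain k2 where s2: "s = Nd e2 k2" unfolding s_def by simp
      have k2: "k2 z = (if z \<in> bsrc e2 then k' z else None)" for z
        using arg_cong[OF s2, of "\<lambda>t. kd t z"] unfolding s_def kd_graft by simp
      have k: "k z = (if z = x then Some s else if z \<in> bsrc e then k' z else None)" for z
      proof -
        have "k z = kd (graft k' u) z" unfolding g by simp
        also have "\<dots> = (if z = x then Some s else if z \<in> bsrc e then k' z else None)"
          unfolding kd_graft u e1 s_def by (simp del: graft.simps)
        finally show ?thesis .
      qed
      have kx: "k x = Some s" unfolding k by simp
      have wf2: "wft (Nd e2 Map.empty)" and x: "x \<in> bsrc e"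
        using wft_kid[OF wfu, of x "Nd e2 Map.empty"] u e1 by simp_all
      have src: "bsrc e' = bsrc e - {x} \<union> bsrc e2"
        using r(1) unfolding u e1 by (simp add: tsrc_Nd)
      have ac: "almost_corolla e k x"
        unfolding almost_corolla_def
      proof (intro conjI allI impI)
        show "dom k = insert x (spart e)"
        proof (rule set_eqI)
          fix z
          have "z \<in> dom k' \<longleftrightarrow> z \<in> spart e'" using b(2) by simp
          then have "z \<noteq> x \<Longrightarrow> z \<in> bsrc e \<Longrightarrow> k' z \<noteq> None \<longleftrightarrow> snd z = Stab_s"
            unfolding spart_def src by auto
          then show "z \<in> dom k \<longleftrightarrow> z \<in> insert x (spart e)"
            unfolding domIff k spart_def by auto
        qed
        show "x \<in> bsrc e" by (rule x)
        show "bboundary e" using bd e1 by simp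
        show "ty e = Unst_u" using r(2) ty unfolding u e1 ty_def by simp
        fix z s'
        assume "z \<noteq> x" "k z = Some s'"
        then have "k' z = Some s'" unfolding k by (simp split: if_splits)
        then show "feeder s'" by (rule corolla_feeder[OF c])
      qed
      have co: "corolla s"
        unfolding s2 corolla_Nd'
      proof (intro conjI allI impI)
        show "bboundary e2" by (rule bd)
        show "dom k2 = spart e2"
        proof (rule set_eqI)
          fix z
          have "z \<in> dom k' \<longleftrightarrow> z \<in> spart e'" using b(2) by simp
          then have "z \<in> bsrc e2 \<Longrightarrow> k' z \<noteq> None \<longleftrightarrow> snd z = Stab_s"
            unfolding spart_def src by auto
          then show "z \<in> dom k2 \<longleftrightarrow> z \<in> spart e2"
            unfolding domIff k2 spart_def by auto
        qed
        fix z s'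
        assume "k2 z = Some s'"
        then have "k' z = Some s'" unfolding k2 by (simp split: if_splits)
        then show "feeder s'" by (rule corolla_feeder[OF c])
      qed
      \<comment> \<open>The old feeders are recovered by joining those of the two nodes; at
        \<open>x\<close>, only a feeder of the lower node can count.\<close>
      have "k' z = (k(x := None) ++ k2) z" for z
      proof (cases "z \<in> bsrc e2")
        case True
        show ?thesis
        proof (cases "k' z")
          case None
          then show ?thesis using True unfolding map_add_def k2 fun_upd_def k by simp
        next
          case (Some w)
          then show ?thesis using True unfolding map_add_def k2 by simp
        qed
      next
        case False
        have "k' z = None" if "z = x \<or> z \<notin> bsrc e"
        proof -
          have "z \<notin> bsrc e'" unfolding src using that False by blast
          then show ?thesis using wft_kids_finite(1)[OF wf'] by blast
        qed
        then show ?thesis using False unfolding map_add_def k2 fun_upd_def k by auto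
      qed
      then have "k' = k(x := None) ++ kd s" unfolding s2 by auto
      moreover have "e' = (True, bsrc e - {x} \<union> bsrc (lb s), btgt e)"
        using r(2) b(1) src unfolding u e1 s2 by (intro bedge_eqI) simp_all
      ultimately show thesis
        using boundary[OF ac kx co] t' None u e1 s2 by simp
    qed
  qed
qed

section \<open>Counting\<close>

text \<open>Away from the exceptional vertex all kids are feeders, and neither an
  \<open>inode\<close> nor a corolla is one. So the position of the defect can be read off the
  tree.\<close>

lemma almost_corolla_unique:
  assumes "almost_corolla e k x'" "k x = Some s" "inode s \<or> corolla s"
  shows "x' = x"
proof (rule ccontr)
  assume "x' \<noteq> x"
  then have "feeder s" using almost_corollaD(5)[OF assms(1), of x s] assms(2) by simp
  then show False using assms(3) unfolding feeder_def inode_def corolla_def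
    by (auto simp: map_upd_nonempty[THEN not_sym])
qed

text \<open>Refinements and products are both 1 or both 0 in number, except for a corolla at a
  stable source, where they number 2 and 0. Finiteness is part of the claim because
  \<open>card\<close> is 0 on infinite sets and the later double count needs genuine
  cardinalities.\<close>

lemma Drefinements_DDpairs_parity:
  assumes wf: "wft t"
  shows "finite (Drefinements t) \<and> odd (card (Drefinements t)) = odd (card (DDpairs t))"
proof -
  obtain e k where t: "t = Nd e k" by (cases t)
  note wf = wf[unfolded t]
  have e: "e \<in> bigraph_edges V E" using wf unfolding wft_Nd by blast
  consider (interior) "inode t" "ty e = Int_o"
    | (boundary) x s where "almost_corolla e k x" "k x = Some s" "corolla s" "snd x = Unst_u"
    | (both) x s where "almost_corolla e k x" "k x = Some s" "corolla s" "snd x = Stab_s"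
    | (stable) x s where "almost_corolla e k x" "k x = Some s" "inode s" "snd x = Stab_s"
    | (none) "\<not> (inode t \<and> ty e = Int_o)" "\<And>x s. almost_corolla e k x \<Longrightarrow> k x = Some s \<Longrightarrow> \<not> corolla s"
      "\<And>x s. almost_corolla e k x \<Longrightarrow> k x = Some s \<Longrightarrow> snd x = Stab_s \<Longrightarrow> \<not> inode s"
  proof -
    have "snd x = Unst_u \<or> snd x = Stab_s" if "almost_corolla e k x" for x
      using bigraph_edgeD(7)[OF e] almost_corollaD(1,3)[OF that] by (cases "snd x") auto
    then show thesis using that by blast
  qed
  then show ?thesis
  proof cases
    case interior
    then obtain x s where k: "k = [x \<mapsto> s]" and i: "\<not> bboundary e" "dtree s"
      unfolding t inode_def by blast
    have no: "\<not> almost_corolla e k x" for x using almost_corollaD(1) i(1) by blast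
    have "DDpairs t = {(s, Nd e Map.empty)}"
    proof
      show "DDpairs t \<subseteq> {(s, Nd e Map.empty)}"
      proof clarify
        fix t1 t2
        assume "(t1, t2) \<in> DDpairs t"
        then show "t1 = s \<and> t2 = Nd e Map.empty"
        unfolding t
        proof (cases rule: DDpairs_sub[OF wf, consumes 1, case_names interior boundary stable])
          case (interior x')
          then have "[x' \<mapsto> t1] x' = [x \<mapsto> s] x'" using k by simp
          then have "t1 = s" by (simp split: if_splits)
          then show ?thesis using interior by blast
        qed (use no in blast)+
      qed
      show "{(s, Nd e Map.empty)} \<subseteq> DDpairs t"
        using DDpairs_interior[of e x s] wf i interior(2) unfolding t k by blast
    qed
    moreover have "Drefinements t = {(Nd (False, tsrc t, btgt e) Map.empty, None, t)}"
    proof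
      show "Drefinements t \<subseteq> {(Nd (False, tsrc t, btgt e) Map.empty, None, t)}"
      proof
        fix z
        assume z: "z \<in> Drefinements t"
        obtain t' i u where zz: "z = (t', i, u)" by (cases z rule: prod_cases3)
        from z show "z \<in> {(Nd (False, tsrc t, btgt e) Map.empty, None, t)}"
          unfolding t zz by (cases rule: Drefinements_sub[OF wf]) (use no in blast)+
      qed
      show "{(Nd (False, tsrc t, btgt e) Map.empty, None, t)} \<subseteq> Drefinements t"
        using Drefinements_interior[of t] wf interior unfolding t by simp
    qed
    ultimately show ?thesis by simp
  next
    case (boundary x s)
    note unique = almost_corolla_unique[of e k _ x s, OF _ boundary(2)]
    have b: "bboundary e" using almost_corollaD(1)[OF boundary(1)] .
    have ty: "ty e \<noteq> Int_o" using almost_corollaD(2)[OF boundary(1)] by simp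
    have "DDpairs t = {(s, Nd e (k(x := None)))}"
    proof
      show "DDpairs t \<subseteq> {(s, Nd e (k(x := None)))}"
      proof clarify
        fix t1 t2
        assume "(t1, t2) \<in> DDpairs t"
        then show "t1 = s \<and> t2 = Nd e (k(x := None))"
        unfolding t
        proof (cases rule: DDpairs_sub[OF wf, consumes 1, case_names interior boundary stable])
          case (boundary x')
          then show ?thesis using unique[of x'] \<open>corolla s\<close> \<open>k x = Some s\<close> by simp
        next
          case (stable x' e1 y)
          then show ?thesis using unique[of x'] \<open>corolla s\<close> \<open>snd x = Unst_u\<close> by simp
        qed (use b in blast)
      qed
      show "{(s, Nd e (k(x := None)))} \<subseteq> DDpairs t"
        using DDpairs_boundary[OF wf boundary(1,4,2,3)] unfolding t by blast
    qed
    moreover have "Drefinements t = {(Nd (True, bsrc e - {x} \<union> bsrc (lb s), btgt e) (k(x := None) ++ kd s), None,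
      Nd e [x \<mapsto> Nd (lb s) Map.empty])}" (is "_ = {?b}")
    proof
      show "Drefinements t \<subseteq> {?b}"
      proof
        fix z
        assume z: "z \<in> Drefinements t"
        obtain t' i u where zz: "z = (t', i, u)" by (cases z rule: prod_cases3)
        have "(t', i, u) \<in> Drefinements (Nd e k)" using z unfolding t zz .
        then show "z \<in> {?b}"
        proof (cases rule: Drefinements_sub[OF wf, consumes 1, case_names interior stable boundary])
          case (boundary x' s')
          then have "x' = x" using unique[of x'] \<open>corolla s\<close> by simp
          then show ?thesis using boundary zz \<open>k x = Some s\<close> by simp
        next
          case (stable x' s')
          then show ?thesis using unique[of x'] \<open>corolla s\<close> \<open>snd x = Unst_u\<close> by simp
        qed (use ty in blast)
      qed
      show "{?b} \<subseteq> Drefinements t"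
        using Drefinements_boundary[OF wf boundary(1-3)] unfolding t by blast
    qed
    ultimately show ?thesis by simp
  next
    case (both x s)
    note unique = almost_corolla_unique[of e k _ x s, OF _ both(2)]
    have b: "bboundary e" using almost_corollaD(1)[OF both(1)] .
    have ty: "ty e \<noteq> Int_o" using almost_corollaD(2)[OF both(1)] by simp
    \<comment> \<open>A factor attached at the stable vertex \<open>x\<close> would have a stable
      target and not be good, and a factor attached to a feeder would give the kid an interior
      root.\<close>
    have "DDpairs t = {}"
    proof -
      have False if "(t1, t2) \<in> DDpairs t" for t1 t2
        using that unfolding t
      proof (cases rule: DDpairs_sub[OF wf, consumes 1, case_names interior boundary stable])
        case (boundary x')
        then show ?thesis using unique[of x'] both by simp
      next
        case (stable x' e1 y)
        then have "Nd e1 [y \<mapsto> t1] = s" using unique[of x'] both by simp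
        then show ?thesis using stable(4) both(3) by (auto simp: corolla_def)
      qed (use b in blast)
      then show ?thesis by auto
    qed
    \<comment> \<open>The cancelling pair: \<open>?b\<close> merges the kid with the root edge,
      \<open>?c\<close> collapses the kid to a feeder.\<close>
    moreover have "Drefinements t = {(Nd (True, bsrc e - {x} \<union> bsrc (lb s), btgt e) (k(x := None) ++ kd s), None,
      Nd e [x \<mapsto> Nd (lb s) Map.empty]), (Nd e (k(x \<mapsto> Nd (False, tsrc s, {x}) Map.empty)), Some x, s)}"
      (is "_ = {?b, ?c}")
    proof
      show "Drefinements t \<subseteq> {?b, ?c}"
      proof
        fix z
        assume z: "z \<in> Drefinements t"
        obtain t' i u where zz: "z = (t', i, u)" by (cases z rule: prod_cases3)
        have "(t', i, u) \<in> Drefinements (Nd e k)" using z unfolding t zz .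
        then show "z \<in> {?b, ?c}"
        proof (cases rule: Drefinements_sub[OF wf, consumes 1, case_names interior stable boundary])
          case (boundary x' s')
          then have "x' = x" using unique[of x'] both by simp
          then show ?thesis using boundary zz both by simp
        next
          case (stable x' s')
          then have "x' = x" using unique[of x'] both by simp
          then show ?thesis using stable zz both by simp
        qed (use ty in blast)
      qed
      show "{?b, ?c} \<subseteq> Drefinements t"
        using Drefinements_boundary[OF wf both(1-3)] Drefinements_stable[OF wf both(1,4,2)] both(3) unfolding t by blast
    qed
    moreover have "?b \<noteq> ?c" by simp
    ultimately show ?thesis by simp
  next
    case (stable x s)
    note unique = almost_corolla_unique[of e k _ x s, OF _ stable(2)]
    have b: "bboundary e" using almost_corollaD(1)[OF stable(1)] .
    have ty: "ty e \<noteq> Int_o" using almost_corollaD(2)[OF stable(1)] by simp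
    obtain e1 y w where s: "s = Nd e1 [y \<mapsto> w]" "\<not> bboundary e1" "dtree w"
      using stable(3) unfolding inode_def by blast
    have nc: "\<not> corolla s" using s(1,2) by (simp add: corolla_def)
    have "DDpairs t = {(w, Nd e (k(x \<mapsto> Nd e1 Map.empty)))}"
    proof
      show "DDpairs t \<subseteq> {(w, Nd e (k(x \<mapsto> Nd e1 Map.empty)))}"
      proof clarify
        fix t1 t2
        assume "(t1, t2) \<in> DDpairs t"
        then show "t1 = w \<and> t2 = Nd e (k(x \<mapsto> Nd e1 Map.empty))"
        unfolding t
        proof (cases rule: DDpairs_sub[OF wf, consumes 1, case_names interior boundary stable])
          case (boundary x')
          then show ?thesis using unique[of x'] stable by simp
        next
          case (stable x' e1' y')
          then have x': "x' = x" using unique[of x'] \<open>inode s\<close> by simp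
          then have eq: "Nd e1' [y' \<mapsto> t1] = Nd e1 [y \<mapsto> w]" using stable s(1) \<open>k x = Some s\<close> by simp
          then have "[y' \<mapsto> t1] y' = [y \<mapsto> w] y'" by simp
          then have "t1 = w" by (simp split: if_splits)
          then show ?thesis using stable x' eq by simp
        qed (use b in blast)
      qed
      show "{(w, Nd e (k(x \<mapsto> Nd e1 Map.empty)))} \<subseteq> DDpairs t"
        using DDpairs_stable[OF wf stable(1,4) _ s(2,3)] stable(2) s(1) unfolding t by blast
    qed
    moreover have "Drefinements t = {(Nd e (k(x \<mapsto> Nd (False, tsrc s, {x}) Map.empty)), Some x, s)}"
      (is "_ = {?c}")
    proof
      show "Drefinements t \<subseteq> {?c}"
      proof
        fix z
        assume z: "z \<in> Drefinements t"
        obtain t' i u where zz: "z = (t', i, u)" by (cases z rule: prod_cases3)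
        have "(t', i, u) \<in> Drefinements (Nd e k)" using z unfolding t zz .
        then show "z \<in> {?c}"
        proof (cases rule: Drefinements_sub[OF wf, consumes 1, case_names interior stable boundary])
          case (boundary x' s')
          then have "x' = x" using unique[of x'] \<open>inode s\<close> by simp
          then show ?thesis using boundary nc \<open>k x = Some s\<close> by simp
        next
          case (stable x' s')
          then have "x' = x" using unique[of x'] \<open>inode s\<close> by simp
          then show ?thesis using stable zz \<open>k x = Some s\<close> by simp
        qed (use ty in blast)
      qed
      show "{?c} \<subseteq> Drefinements t"
        using Drefinements_stable[OF wf stable(1,4,2)] stable(3) unfolding t by blast
    qed
    ultimately show ?thesis by simp
  next
    case none
    have "DDpairs t = {}"
    proof -
      have False if "(t1, t2) \<in> DDpairs t" for t1 t2
        using that unfolding t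
      proof (cases rule: DDpairs_sub[OF wf, consumes 1, case_names interior boundary stable])
        case (interior x')
        then have "inode t" unfolding t inode_def by blast
        then show ?thesis using none(1) interior by blast
      next
        case (boundary x')
        then show ?thesis using none(2) by blast
      next
        case (stable x' e1 y)
        then have "inode (Nd e1 [y \<mapsto> t1])" unfolding inode_def by blast
        then show ?thesis using none(3) stable by blast
      qed
      then show ?thesis by auto
    qed
    moreover have "Drefinements t = {}"
    proof -
      have False if "(t', i, u) \<in> Drefinements t" for t' i u
        using that unfolding t by (cases rule: Drefinements_sub[OF wf]) (use none t in blast)+
      then show ?thesis by auto
    qed
    ultimately show ?thesis by simp
  qed
qed

section \<open>Coefficients of both sides as numbers of trees\<close>

lemma rep_cls_data:
  assumes "wft t"
  shows "psrc (rep (cls t)) = tsrc t" "ptgt (rep (cls t)) = btgt (lb t)" "pweight (rep (cls t)) = tw t"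
    "boundary_path (rep (cls t)) \<and> plength (rep (cls t)) = 2 \<longleftrightarrow> two_boundary t"
proof -
  let ?p = "rep (cls t)"
  note p = rep_cls[OF assms]
  show "psrc ?p = tsrc t" by (rule psrc_shape[OF p])
  show "ptgt ?p = btgt (lb t)" by (rule ptgt_shape[OF p])
  show "pweight ?p = tw t" unfolding pweight_def by (rule sum_shape[OF p])
  have fin: "finite (nodes ?p)" using p(1) unfolding is_path_def is_dtree_def by blast
  have "tsum (\<lambda>_. 1) t = int (plength ?p)"
    using sum_shape[OF p, of "\<lambda>_. 1"] unfolding plength_def by simp
  moreover have "tsum (\<lambda>e. if bboundary e then 0 else 1) t = 0 \<longleftrightarrow> boundary_path ?p"
    unfolding sum_shape[OF p, of "\<lambda>e. if bboundary e then 0 else 1", symmetric] boundary_path_def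
    using fin by (subst sum_nonneg_eq_0_iff) auto
  ultimately show "boundary_path ?p \<and> plength ?p = 2 \<longleftrightarrow> two_boundary t"
    unfolding two_boundary_def by auto
qed

lemma Dset_cls: "Dset V E = cls ` {t. dtree t}"
proof -
  have "good (rep (cls t)) \<and> pweight (rep (cls t)) = 1 \<longleftrightarrow> dtree t" if t: "wft t" for t
  proof -
    obtain y where y: "btgt (lb t) = {y}" using edge_tgt[OF wft_edge[OF t]] .
    have "a = Int_o \<or> a = Unst_u \<longleftrightarrow> a \<noteq> Stab_s" for a by (cases a) auto
    then show ?thesis
      unfolding good_def rep_cls_data[OF t] dtree_def unstable_src_def ty_def y using t by auto
  qed
  then have "Dset V E = {X \<in> cls ` {t. wft t}. X \<in> cls ` {t. dtree t}}"
    unfolding Dset_def pclasses_eq using cls_inject dtree_def by blast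
  then show ?thesis using dtree_def by blast
qed

text \<open>The first factor has a single target, so the product is defined as soon as that vertex
  is open in the second factor, and its class is that of the graft.\<close>

lemma DD_coeff_cls:
  assumes wf: "wft t"
  shows "DD_coeff V E (cls t) = odd (card (DDpairs t))"
proof -
  have eq: "prod_defined (rep (cls t1)) (rep (cls t2)) \<and> concat (rep (cls t1)) (rep (cls t2)) \<in> cls t
      \<longleftrightarrow> (t1, t2) \<in> DDpairs t" if d: "dtree t1" "dtree t2" for t1 t2
  proof -
    have w: "wft t1" "wft t2" using d unfolding dtree_def by auto
    obtain y where y: "btgt (lb t1) = {y}" using edge_tgt[OF wft_edge[OF w(1)]] .
    have pd: "prod_defined (rep (cls t1)) (rep (cls t2)) \<longleftrightarrow> y \<in> tsrc t2"
      unfolding prod_defined_def rep_cls_data(2)[OF w(1)] rep_cls_data(1)[OF w(2)] y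
      by (cases "y \<in> tsrc t2") simp_all
    have "concat (rep (cls t1)) (rep (cls t2)) \<in> cls t \<longleftrightarrow> graft [y \<mapsto> t1] t2 = t" if "y \<in> tsrc t2"
      using shape_concat[OF rep_cls(1)[OF w(1)] rep_cls(1)[OF w(2)] rep_cls(2)[OF w(1)] rep_cls(2)[OF w(2)] y that]
      unfolding in_cls[OF wf] using shape_unique by blast
    moreover have "(t1, t2) \<in> DDpairs t \<longleftrightarrow> y \<in> tsrc t2 \<and> graft [y \<mapsto> t1] t2 = t"
      unfolding DDpairs_def using d y by (auto simp del: split_paired_Ex)
    ultimately show ?thesis unfolding pd by blast
  qed
  have "{(X1, X2) \<in> Dset V E \<times> Dset V E. prod_defined (rep X1) (rep X2) \<and> concat (rep X1) (rep X2) \<in> cls t}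
      = map_prod cls cls ` DDpairs t"
  proof (intro equalityI subsetI)
    fix z
    assume "z \<in> {(X1, X2) \<in> Dset V E \<times> Dset V E. prod_defined (rep X1) (rep X2) \<and> concat (rep X1) (rep X2) \<in> cls t}"
    then obtain t1 t2 where "z = (cls t1, cls t2)" "dtree t1" "dtree t2"
      "prod_defined (rep (cls t1)) (rep (cls t2)) \<and> concat (rep (cls t1)) (rep (cls t2)) \<in> cls t"
      unfolding Dset_cls by blast
    then show "z \<in> map_prod cls cls ` DDpairs t" using eq by force
  next
    fix z
    assume "z \<in> map_prod cls cls ` DDpairs t"
    then obtain t1 t2 where "z = (cls t1, cls t2)" "(t1, t2) \<in> DDpairs t" by auto
    moreover from this have "dtree t1" "dtree t2" unfolding DDpairs_def by auto
    ultimately show "z \<in> {(X1, X2) \<in> Dset V E \<times> Dset V E. prod_defined (rep X1) (rep X2) \<and> concat (rep X1) (rep X2) \<in> cls t}"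
      unfolding Dset_cls using eq by blast
  qed
  moreover have "inj_on (map_prod cls cls) (DDpairs t)"
    unfolding DDpairs_def dtree_def inj_on_def using cls_inject by auto
  ultimately show ?thesis unfolding DD_coeff_def by (simp add: card_image)
qed

lemma dtree_kid_leaf:
  assumes "dtree t" "kd t x = Some s"
  shows "kd s = Map.empty"
proof -
  obtain e k where t: "t = Nd e k" by (cases t)
  have "k \<noteq> Map.empty" using assms(2) t by auto
  then have "corolla (Nd e k)" using assms(1) unfolding t dtree_Nd by blast
  then have "feeder s" using corolla_feeder assms(2) t by simp
  then show ?thesis unfolding feeder_def by auto
qed

text \<open>The last arrow of a chain to the root starts at a kid of the root, which has no kids of
  its own; so the chain consists of this arrow only.\<close>

lemma dtree_nodes:
  assumes "dtree (\<tau> r)" "rooted p r" "unfolds p \<tau>" "v \<in> nodes p" "v \<noteq> r"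
  shows "(v, r) \<in> arrs p" "(a, v) \<notin> arrs p"
proof -
  have leaf: "(a, c) \<notin> arrs p" if c: "(c, r) \<in> arrs p" for a c
  proof
    assume "(a, c) \<in> arrs p"
    then have "kd (\<tau> c) (out p a) = Some (\<tau> a)"
      using unfoldsD(2)[OF assms(3)] rootedD(3)[OF assms(2)] by blast
    moreover have "kd (\<tau> r) (out p c) = Some (\<tau> c)"
      using unfoldsD(2)[OF assms(3) rootedD(2)[OF assms(2)]] c by blast
    ultimately show False using dtree_kid_leaf[OF assms(1)] by simp
  qed
  obtain c where c: "(v, c) \<in> (arrs p)\<^sup>*" "(c, r) \<in> arrs p"
    using rootedD(6)[OF assms(2,4)] assms(5) by (meson rtranclE)
  then show *: "(v, r) \<in> arrs p" using leaf[OF c(2)] by (metis rtranclE)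
  show "(a, v) \<notin> arrs p" by (rule leaf[OF *])
qed

text \<open>Terms of the differential refer to node numbers of a chosen representative.
  \<open>\<omega>\<close> translates positions in the tree into these numbers, and
  \<open>cls\<close> translates replacing trees into classes.\<close>

lemma delta_terms_bij:
  assumes wf: "wft t" and d: "dtree t'"
  shows "card {(v, Y) \<in> delta_terms V E (cls t'). refine (rep (cls t')) v (rep Y) \<in> cls t}
    = card {(i, u). (t', i, u) \<in> Drefinements t}"
proof -
  let ?p = "rep (cls t')"
  have wf': "wft t'" using d unfolding dtree_def by blast
  note p1 = rep_cls[OF wf']
  obtain r \<tau> where p: "rooted ?p r" "unfolds ?p \<tau>" and r: "\<tau> r = t'"
    using p1(2) unfolding shape_def by blast
  have rn: "r \<in> nodes ?p" by (rule rootedD(2)[OF p(1)])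
  note nodes = dtree_nodes[OF d[folded r] p]
  define \<omega> where "\<omega> i = (case i of None \<Rightarrow> r | Some x \<Rightarrow> (THE a. (a, r) \<in> arrs ?p \<and> out ?p a = x))" for i
  have \<omega>_None: "\<omega> None = r" by (simp add: \<omega>_def)
  have \<omega>_Some: "\<omega> (Some (out ?p a)) = a" if "(a, r) \<in> arrs ?p" for a
    unfolding \<omega>_def option.case
    by (rule the_equality) (use that rootedD(7)[OF p(1)] in blast)+
  define I where "I = {i. set_option i \<subseteq> dom (kd t')}"
  have I_cases: "i = None \<or> (\<exists>a. i = Some (out ?p a) \<and> (a, r) \<in> arrs ?p \<and> kd t' (out ?p a) = Some (\<tau> a))" if "i \<in> I" for i
  proof (cases i)
    case (Some x)
    then have "x \<in> dom (kd (\<tau> r))" using that r unfolding I_def by simp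
    then obtain s where "kd (\<tau> r) x = Some s" by blast
    then obtain a where "(a, r) \<in> arrs ?p" "out ?p a = x" "\<tau> a = s"
      using unfoldsD(2)[OF p(2) rn] by blast
    then show ?thesis using Some \<open>kd (\<tau> r) x = Some s\<close> r by auto
  qed simp
  have \<omega>_node: "\<omega> i \<in> nodes ?p \<and> lab ?p (\<omega> i) = lb (node_at t' i)" if "i \<in> I" for i
    using I_cases[OF that]
  proof (elim disjE exE conjE)
    assume "i = None"
    then show ?thesis using rn unfoldsD(1)[OF p(2) rn] r \<omega>_None by (simp add: node_at_def)
  next
    fix a
    assume a: "i = Some (out ?p a)" "(a, r) \<in> arrs ?p" "kd t' (out ?p a) = Some (\<tau> a)"
    then have an: "a \<in> nodes ?p" using rootedD(3)[OF p(1)] by blast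
    then show ?thesis using a unfoldsD(1)[OF p(2) an] \<omega>_Some[OF a(2)] by (simp add: node_at_def)
  qed
  have \<omega>_inj: "i = j" if "i \<in> I" "j \<in> I" "\<omega> i = \<omega> j" for i j
    using I_cases[OF that(1)] I_cases[OF that(2)] that(3) \<omega>_None \<omega>_Some rootedD(5)[OF p(1)] by metis
  have \<omega>_surj: "\<exists>i\<in>I. \<omega> i = v" if v: "v \<in> nodes ?p" for v
  proof (cases "v = r")
    case True
    then show ?thesis using \<omega>_None unfolding I_def by (intro bexI[of _ None]) auto
  next
    case False
    have a: "(v, r) \<in> arrs ?p" by (rule nodes(1)[OF v False])
    then have "kd t' (out ?p v) = Some (\<tau> v)" using unfoldsD(2)[OF p(2) rn] r by blast
    then show ?thesis using \<omega>_Some[OF a] unfolding I_def by (intro bexI[of _ "Some (out ?p v)"]) auto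
  qed
  have terms: "(\<omega> i, cls u) \<in> delta_terms V E (cls t') \<and> refine ?p (\<omega> i) (rep (cls u)) \<in> cls t
      \<longleftrightarrow> (t', i, u) \<in> Drefinements t" if i: "i \<in> I" and u: "wft u" for i u
  proof -
    have dt: "(\<omega> i, cls u) \<in> delta_terms V E (cls t') \<longleftrightarrow> replaces (lb (node_at t' i)) u"
      unfolding delta_terms_def replaces_def pclasses_eq
      using \<omega>_node[OF i] u rep_cls_data[OF u] by auto
    have rf: "refine ?p (\<omega> i) (rep (cls u)) \<in> cls t \<longleftrightarrow> refine_at t' i u = t"
      if rp: "replaces (lb (node_at t' i)) u"
    proof -
      let ?q = "rep (cls u)"
      note q1 = rep_cls[OF u]
      obtain rq \<sigma> where q: "rooted ?q rq" "unfolds ?q \<sigma>" and rq: "\<sigma> rq = u"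
        using q1(2) unfolding shape_def by blast
      \<comment> \<open>\<open>replaces\<close> contains the source and target conditions, so the
        refinement is non-zero and its tree is known at the root and at the leaves.\<close>
      interpret R: refinement V E ?p ?q "refine ?p (\<omega> i) ?q" r "\<omega> i" rq \<tau> \<sigma>
        using p1(1) p \<omega>_node[OF i] q1(1) q rep_cls_data[OF u] rp
        unfolding replaces_def by unfold_locales auto
      have "shape (refine ?p (\<omega> i) ?q) (refine_at t' i u)"
        using I_cases[OF i]
      proof (elim disjE exE conjE)
        assume "i = None"
        then show ?thesis
          using R.shape_refine_root \<omega>_None r rq unfolding refine_at_def by simp
      next
        fix a
        assume a: "i = Some (out ?p a)" "(a, r) \<in> arrs ?p"
        have an: "a \<in> nodes ?p" "a \<noteq> r" using rootedD(3,5)[OF p(1)] a(2) by blast+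
        have w: "\<omega> i = a" using \<omega>_Some[OF a(2)] a(1) by simp
        have "shape (refine ?p (\<omega> i) ?q) (Nd (lab ?p r) ((kd (\<tau> r))(out ?p (\<omega> i) \<mapsto> \<sigma> rq)))"
          by (rule R.shape_refine_leaf) (use a(2) nodes(2)[OF an] w in simp_all)
        moreover have "refine_at t' i u = Nd (lab ?p r) ((kd (\<tau> r))(out ?p (\<omega> i) \<mapsto> \<sigma> rq))"
          unfolding w unfolding refine_at_def a(1) option.case r rq using unfoldsD(1)[OF p(2) rn] r by simp
        ultimately show ?thesis by simp
      qed
      then show ?thesis unfolding in_cls[OF wf] using shape_unique by blast
    qed
    show ?thesis
      using dt rf d u i unfolding Drefinements_def I_def by auto
  qed
  have "bij_betw (\<lambda>(i, u). (\<omega> i, cls u)) {(i, u). (t', i, u) \<in> Drefinements t}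
    {(v, Y) \<in> delta_terms V E (cls t'). refine ?p v (rep Y) \<in> cls t}"
    unfolding bij_betw_def
  proof
    have dom: "i \<in> I \<and> wft u" if "(t', i, u) \<in> Drefinements t" for i u
      using that unfolding Drefinements_def I_def by auto
    show "inj_on (\<lambda>(i, u). (\<omega> i, cls u)) {(i, u). (t', i, u) \<in> Drefinements t}"
      using dom \<omega>_inj cls_inject by (auto simp: inj_on_def)
    show "(\<lambda>(i, u). (\<omega> i, cls u)) ` {(i, u). (t', i, u) \<in> Drefinements t} =
      {(v, Y) \<in> delta_terms V E (cls t'). refine ?p v (rep Y) \<in> cls t}"
    proof (intro equalityI subsetI)
      fix z
      assume "z \<in> (\<lambda>(i, u). (\<omega> i, cls u)) ` {(i, u). (t', i, u) \<in> Drefinements t}"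
      then obtain i u where z: "z = (\<omega> i, cls u)" and iu: "(t', i, u) \<in> Drefinements t" by auto
      then show "z \<in> {(v, Y) \<in> delta_terms V E (cls t'). refine ?p v (rep Y) \<in> cls t}"
        using terms dom[OF iu] by simp
    next
      fix z
      assume "z \<in> {(v, Y) \<in> delta_terms V E (cls t'). refine ?p v (rep Y) \<in> cls t}"
      then obtain v Y where z: "z = (v, Y)" "(v, Y) \<in> delta_terms V E (cls t')" "refine ?p v (rep Y) \<in> cls t"
        by auto
      then have "v \<in> nodes ?p" "Y \<in> cls ` {u. wft u}"
        unfolding delta_terms_def pclasses_eq by auto
      then obtain i u where iu: "i \<in> I" "\<omega> i = v" "wft u" "Y = cls u" using \<omega>_surj by blast
      then have "(t', i, u) \<in> Drefinements t" using terms z by blast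
      then show "z \<in> (\<lambda>(i, u). (\<omega> i, cls u)) ` {(i, u). (t', i, u) \<in> Drefinements t}"
        using iu z(1) by (intro image_eqI[of _ _ "(i, u)"]) auto
    qed
  qed
  then show ?thesis by (simp add: bij_betw_same_card)
qed

text \<open>The coefficient counts the trees \<open>t'\<close> with an odd number of refinements to
  \<open>t\<close>. Modulo 2 this is the total number of refinements, and trees outside
  \<open>?A\<close> contribute none.\<close>

lemma deltaD_coeff_cls:
  assumes wf: "wft t"
  shows "deltaD_coeff V E (cls t) = odd (card (Drefinements t))"
proof -
  define R where "R t' = {(i, u). (t', i, u) \<in> Drefinements t}" for t'
  let ?A = "fst ` Drefinements t"
  have fin: "finite (Drefinements t)" using Drefinements_DDpairs_parity[OF wf] by blast
  have coeff: "delta_coeff V E (cls t') (cls t) = odd (card (R t'))" if "dtree t'" for t'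
    unfolding delta_coeff_def R_def using delta_terms_bij[OF wf that] by simp
  have A: "dtree t'" if "t' \<in> ?A" for t'
    using that unfolding Drefinements_def by auto
  have "{X \<in> Dset V E. delta_coeff V E X (cls t)} = cls ` {t' \<in> ?A. odd (card (R t'))}"
  proof (intro equalityI subsetI)
    fix X
    assume "X \<in> {X \<in> Dset V E. delta_coeff V E X (cls t)}"
    then obtain t' where t': "X = cls t'" "dtree t'" "odd (card (R t'))"
      unfolding Dset_cls using coeff by blast
    then have "R t' \<noteq> {}" by auto
    then have "t' \<in> ?A" unfolding R_def by force
    then show "X \<in> cls ` {t' \<in> ?A. odd (card (R t'))}" using t' by blast
  next
    fix X
    assume "X \<in> cls ` {t' \<in> ?A. odd (card (R t'))}"
    then show "X \<in> {X \<in> Dset V E. delta_coeff V E X (cls t)}"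
      unfolding Dset_cls using A coeff by blast
  qed
  moreover have "inj_on cls {t' \<in> ?A. odd (card (R t'))}"
    using A cls_inject unfolding dtree_def inj_on_def by blast
  ultimately have "deltaD_coeff V E (cls t) = odd (card {t' \<in> ?A. odd (card (R t'))})"
    unfolding deltaD_coeff_def by (simp add: card_image)
  \<comment> \<open>A finite sum has the parity of the number of its odd summands.\<close>
  also have "\<dots> = odd (\<Sum>t'\<in>?A. card (R t'))"
    using even_sum_iff[of ?A "\<lambda>t'. card (R t')"] fin by simp
  also have "(\<Sum>t'\<in>?A. card (R t')) = card (Sigma ?A R)"
  proof (rule card_SigmaI[symmetric])
    show "finite ?A" using fin by simp
    have "R t' \<subseteq> snd ` Drefinements t" for t' unfolding R_def by force
    then show "\<forall>t'\<in>?A. finite (R t')" using fin by (meson finite_imageI finite_subset)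
  qed
  also have "Sigma ?A R = Drefinements t" unfolding R_def by force
  finally show ?thesis .
qed

end

theorem theorem4p11:
  fixes V :: "'v set" and E :: "'v hedge set"
  assumes "higraph V E" and "tree_like E"
  shows "\<forall>C\<in>pclasses V E. deltaD_coeff V E C = DD_coeff V E C"
proof
  interpret tree_higraph V E
    using assms by unfold_locales
  fix C
  assume "C \<in> pclasses V E"
  then obtain t where t: "wft t" "C = cls t" unfolding pclasses_eq by blast
  then show "deltaD_coeff V E C = DD_coeff V E C"
    using deltaD_coeff_cls DD_coeff_cls Drefinements_DDpairs_parity by simp
qed

end
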